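(* Let $k\ge1$, let $\mathfrak g=\mathfrak{gl}_n$ or $\mathfrak{sl}_n$, and let $a,b,p,q$ be positive integers with $p\ge q$ and $p+q\le n$ if $\mathfrak g=\mathfrak{gl}_n$, $p+q\le n-1$ if $\mathfrak g=\mathfrak{sl}_n$. Let $M=L((a^p))$, $N=L((b^q))$ and $V=L(\omega_1)$. (a) When $\mathfrak g=\mathfrak{gl}_n$, put $c_x=c_y=-\tfrac12n$ and $d=0$. (b) When $\mathfrak g=\mathfrak{sl}_n$, put $c_x=\frac{ap}{n}-\frac12\left(n-\frac1n\right)$, $c_y=\frac{bq}{n}-\frac12\left(n-\frac1n\right)$ and $d=\frac1n$. For this choice of $c_x,c_y,d$ and any choice of $c_z\in\mathbb C$, the algebra homomorphism $\Phi':\mathcal G_k\to\mathrm{End}_{\mathfrak g}(M\otimes N\otimes V^{\otimes k})$ given by $$\Phi'(x_i)=\tfrac12(\kappa_{M,\le i}-\kappa_{M,\le i-1})+((i-1)d+c_x)\,\mathrm{id},\qquad \Phi'(y_i)=\tfrac12(\kappa_{N,\le i}-\kappa_{N,\le i-1})+((i-1)d+c_y)\,\mathrm{id},$$ $$\Phi'(z_i)=\tfrac12(\kappa_{M\otimes N,\le i}-\kappa_{M\otimes N,\le i-1}+\kappa_V)+((i-1)d+c_x+c_y)\,\mathrm{id}\quad(1\le i\le k),$$ $$\Phi'(z_0)=\gamma_{M,N}+c_z\,\mathrm{id},\qquad \Phi'(t_{s_j})=\mathrm{id}_M\otimes\mathrm{id}_N\otimes\mathrm{id}_V^{\otimes(j-1)}\otimes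 s\otimes\mathrm{id}_V^{\otimes(k-j-1)}\quad(1\le j\le k-1),$$ with $s\cdot(u\otimes v)=v\otimes u$, factors through the quotient $\mathcal H_k^{\mathrm{ext}}$ of $\mathcal G_k$ (with parameters $a,b,p,q$), i.e. through the quotient by $$t_{s_i}x_i=x_{i+1}t_{s_i}-1,\quad t_{s_i}y_i=y_{i+1}t_{s_i}-1\ (1\le i\le k-1),\quad (x_1-a)(x_1+p)=0,\quad (y_1-b)(y_1+q)=0,$$ and so defines an action of $\mathcal H_k^{\mathrm{ext}}$ on $M\otimes N\otimes V^{\otimes k}$ which commutes with the action of $\mathfrak g$.
   Context: **The algebra $\mathcal G_k$.** Let $S_k$ be the symmetric group, $s_i=(i\ i{+}1)$. The degenerate two-boundary braid algebra $\mathcal G_k$ is the unital associative $\mathbb C$-algebra generated by $t_w$ ($w\in S_k$), $x_1,\dots,x_k$, $y_1,\dots,y_k$, $z_0,z_1,\dots,z_k$, subject to the relations below. Here $m_1=0$ and, for $j>1$, $m_j=\sum_{1\le i<j}m_{i,j}$, where $m_{j-1,j}=x_j-t_{s_{j-1}}x_{j-1}t_{s_{j-1}}$ and $m_{i,j}=t_{(i\ j-1)}\,m_{j-1,j}\,t_{(i\ j-1)}$ for $1\le i<j-1$. - $z_i=x_i+y_i-m_i$ for $1\le i\le k$; - $t_wt_{w'}=t_{ww'}$ for $w,w'\in S_k$ (with $t_e=1$); - $x_ix_j=x_jx_i$, $y_iy_j=y_jy_i$, $z_iz_j=z_jz_i$ for all admissible $i,j$; - $t_{s_i}x_j=x_jt_{s_i}$,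 $t_{s_i}y_j=y_jt_{s_i}$, $t_{s_i}z_j=z_jt_{s_i}$ for $j\ne i,i+1$; - $(z_0+\cdots+z_i)x_j=x_j(z_0+\cdots+z_i)$ and $(z_0+\cdots+z_i)y_j=y_j(z_0+\cdots+z_i)$ for $i\ge j$; - $t_{s_i}(x_i+x_{i+1})=(x_i+x_{i+1})t_{s_i}$ and $t_{s_i}(y_i+y_{i+1})=(y_i+y_{i+1})t_{s_i}$ for $1\le i\le k-1$; - $t_{s_i}t_{s_{i+1}}(x_{i+1}-t_{s_i}x_it_{s_i})t_{s_{i+1}}t_{s_i}=x_{i+2}-t_{s_{i+1}}x_{i+1}t_{s_{i+1}}$, and the same with $y$ in place of $x$, for $1\le i\le k-2$; - $x_{i+1}-t_{s_i}x_it_{s_i}=y_{i+1}-t_{s_i}y_it_{s_i}$ for $1\le i\le k-1$. The degenerate extended two-boundary Hecke algebra $\mathcal H_k^{\mathrm{ext}}$ (with parameters $a,b,p,q$) is the quotient of $\mathcal G_k$ by the four families of relations displayed at the end of the claim. **Modules and operators.** $L(\lambda)$ is the finite-dimensional irreducible $\mathfrak g$-module of highest weight $\lambda$. A partition $\lambda$ denotes the weight $\sum_i\lambda_i\varepsilon_i$ for $\mathfrak{gl}_n$ and $\sum_i\lambda_i\varepsilon_i-\frac{|\lambda|}{n}(\varepsilon_1+\cdots+\varepsilon_n)$ for $\mathfrak{sl}_n$, where $\varepsilon_i$ is the $i$-th diagonal coordinate. $(a^p)$ is the rectangular partition with $p$ rows of length $a$; $\omega_1$ is the partition with a single box, so $V=L(\omega_1)=\mathbb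 C^n$ is the standard representation. The form on $\mathfrak g$ is the trace form $\langle x,y\rangle=\mathrm{tr}(xy)$ of the standard representation. With $\{b_i\}$ a basis of $\mathfrak g$ and $\{b_i^*\}$ its dual basis, $\kappa=\sum_ib_ib_i^*$ (Casimir) and $\gamma=\sum_ib_i\otimes b_i^*$. On $M\otimes N\otimes V^{\otimes k}$, for $X=M,N,M\otimes N$: $\kappa_{X,\le j}$ is $\kappa$ acting on the tensor product of $X$ with the first $j$ copies of $V$ (identity elsewhere), $\kappa_{X,\le0}=\kappa_X$ is $\kappa$ acting on $X$; $\kappa_V$ is the scalar by which $\kappa$ acts on $V$; $\gamma_{M,N}$ is $\gamma$ acting on the factors $M,N$. $\mathrm{End}_{\mathfrak g}(U)$ is the commutant of $\mathfrak g$ in $\mathrm{End}(U)$. *)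

theory Defs
  imports
    "Jordan_Normal_Form.VS_Connect"
    "HOL-Library.Poly_Mapping"
    "HOL-Combinatorics.Permutations"
    "HOL-Algebra.QuotRing"
begin

section \<open>Unital associative algebras over the complex numbers\<close>

text \<open>An algebra is a record of type \<^typ>\<open>(complex, 'a) module\<close>: a ring record of HOL-Algebra together
  with a scalar multiplication. (The locale \<^locale>\<open>algebra\<close> of HOL-Algebra is not usable here: it requires
  commutativity.)\<close>

definition alg_hom :: "(complex, 'a) module \<Rightarrow> (complex, 'b) module \<Rightarrow> ('a \<Rightarrow> 'b) set" where
  "alg_hom A B = {h \<in> Ring.ring_hom A B. \<forall>c. \<forall>x\<in>carrier A. h (c \<odot>\<^bsub>A\<^esub> x) = c \<odot>\<^bsub>B\<^esub> h x}"

text \<open>The quotient by a two-sided ideal: the quotient ring of HOL-Algebra, with the scalar multiplication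
  of cosets defined through representatives in the same way as their product.\<close>

definition quot_alg :: "(complex, 'a) module \<Rightarrow> 'a set \<Rightarrow> (complex, 'a set) module" where
  "quot_alg A I = ring.extend (A Quot I)
     (module.fields (\<lambda>c X. \<Union>x\<in>X. I +>\<^bsub>A\<^esub> (c \<odot>\<^bsub>A\<^esub> x)))"

text \<open>The free algebra is the monoid algebra of the free monoid. The product of
  \<^typ>\<open>'m \<Rightarrow>\<^sub>0 complex\<close> is the convolution product with respect to the (here non-commutative) operation
  \<open>+\<close> of \<^typ>\<open>'m\<close>, which is why concatenation of words is written additively.\<close>

datatype 'g fmon = Mon (letters: "'g list")

instantiation fmon :: (type) monoid_add
begin

definition zero_fmon :: "'a fmon" where "0 = Mon []"

definition plus_fmon :: "'a fmon \<Rightarrow> 'a fmon \<Rightarrow> 'a fmon" where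
  "u + v = Mon (letters u @ letters v)"

instance
  by standard (simp_all add: zero_fmon_def plus_fmon_def)

end

type_synonym 'g fpoly = "'g fmon \<Rightarrow>\<^sub>0 complex"

definition var :: "'g \<Rightarrow> 'g fpoly" where
  "var g = Poly_Mapping.single (Mon [g]) 1"

definition cst :: "complex \<Rightarrow> 'g fpoly" where
  "cst c = Poly_Mapping.single 0 c"

definition free_alg :: "'g set \<Rightarrow> (complex, 'g fpoly) module" where
  "free_alg S = \<lparr>carrier = {f. \<forall>w\<in>Poly_Mapping.keys f. set (letters w) \<subseteq> S},
     mult = (*), one = 1, zero = 0, add = (+), smult = (\<lambda>c f. cst c * f)\<rparr>"


section \<open>The degenerate two-boundary braid algebra and its Hecke quotient\<close>

datatype gen = Gen_t "nat \<Rightarrow> nat" | Gen_x nat | Gen_y nat | Gen_z nat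

definition gens :: "nat \<Rightarrow> gen set" where
  "gens k =
    Gen_t ` {w. w permutes {1..k}} \<union> Gen_x ` {1..k} \<union> Gen_y ` {1..k} \<union> Gen_z ` {0..k}"

abbreviation tt :: "(nat \<Rightarrow> nat) \<Rightarrow> gen fpoly" where "tt w \<equiv> var (Gen_t w)"
abbreviation xx :: "nat \<Rightarrow> gen fpoly" where "xx i \<equiv> var (Gen_x i)"
abbreviation yy :: "nat \<Rightarrow> gen fpoly" where "yy i \<equiv> var (Gen_y i)"
abbreviation zz :: "nat \<Rightarrow> gen fpoly" where "zz i \<equiv> var (Gen_z i)"

abbreviation ss :: "nat \<Rightarrow> nat \<Rightarrow> nat" where "ss i \<equiv> transpose i (i + 1)"

text \<open>\<open>m2 i j\<close> is \<open>m\<^bsub>i,j\<^esub>\<close> and \<open>m1 j\<close> is \<open>m\<^sub>j\<close>, as elements of the free algebra; \<open>m1 1\<close> is an empty sum.\<close>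

definition m2 :: "nat \<Rightarrow> nat \<Rightarrow> gen fpoly" where
  "m2 i j =
    (let m = xx j - tt (ss (j - 1)) * xx (j - 1) * tt (ss (j - 1))
     in if i = j - 1 then m else tt (transpose i (j - 1)) * m * tt (transpose i (j - 1)))"

definition m1 :: "nat \<Rightarrow> gen fpoly" where
  "m1 j = (\<Sum>i\<in>{1..<j}. m2 i j)"

text \<open>\<open>G_rel k u v\<close> is the defining relation \<open>u = v\<close>. Products of permutations are compositions of
  functions.\<close>

inductive G_rel :: "nat \<Rightarrow> gen fpoly \<Rightarrow> gen fpoly \<Rightarrow> bool" for k where
  "i \<in> {1..k} \<Longrightarrow> G_rel k (zz i) (xx i + yy i - m1 i)"
| "G_rel k (tt id) 1"
| "w permutes {1..k} \<Longrightarrow> w' permutes {1..k} \<Longrightarrow> G_rel k (tt w * tt w') (tt (w \<circ> w'))"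
| "i \<in> {1..k} \<Longrightarrow> j \<in> {1..k} \<Longrightarrow> G_rel k (xx i * xx j) (xx j * xx i)"
| "i \<in> {1..k} \<Longrightarrow> j \<in> {1..k} \<Longrightarrow> G_rel k (yy i * yy j) (yy j * yy i)"
| "i \<in> {0..k} \<Longrightarrow> j \<in> {0..k} \<Longrightarrow> G_rel k (zz i * zz j) (zz j * zz i)"
| "i \<in> {1..<k} \<Longrightarrow> j \<in> {1..k} - {i, i + 1} \<Longrightarrow> G_rel k (tt (ss i) * xx j) (xx j * tt (ss i))"
| "i \<in> {1..<k} \<Longrightarrow> j \<in> {1..k} - {i, i + 1} \<Longrightarrow> G_rel k (tt (ss i) * yy j) (yy j * tt (ss i))"
| "i \<in> {1..<k} \<Longrightarrow> j \<in> {0..k} - {i, i + 1} \<Longrightarrow> G_rel k (tt (ss i) * zz j) (zz j * tt (ss i))"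
| "i \<in> {1..k} \<Longrightarrow> j \<in> {1..i} \<Longrightarrow> G_rel k ((\<Sum>l\<in>{0..i}. zz l) * xx j) (xx j * (\<Sum>l\<in>{0..i}. zz l))"
| "i \<in> {1..k} \<Longrightarrow> j \<in> {1..i} \<Longrightarrow> G_rel k ((\<Sum>l\<in>{0..i}. zz l) * yy j) (yy j * (\<Sum>l\<in>{0..i}. zz l))"
| "i \<in> {1..<k} \<Longrightarrow> G_rel k (tt (ss i) * (xx i + xx (i + 1))) ((xx i + xx (i + 1)) * tt (ss i))"
| "i \<in> {1..<k} \<Longrightarrow> G_rel k (tt (ss i) * (yy i + yy (i + 1))) ((yy i + yy (i + 1)) * tt (ss i))"
| "1 \<le> i \<Longrightarrow> i + 2 \<le> k \<Longrightarrow>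
    G_rel k (tt (ss i) * tt (ss (i + 1)) * (xx (i + 1) - tt (ss i) * xx i * tt (ss i)) * tt (ss (i + 1)) * tt (ss i))
      (xx (i + 2) - tt (ss (i + 1)) * xx (i + 1) * tt (ss (i + 1)))"
| "1 \<le> i \<Longrightarrow> i + 2 \<le> k \<Longrightarrow>
    G_rel k (tt (ss i) * tt (ss (i + 1)) * (yy (i + 1) - tt (ss i) * yy i * tt (ss i)) * tt (ss (i + 1)) * tt (ss i))
      (yy (i + 2) - tt (ss (i + 1)) * yy (i + 1) * tt (ss (i + 1)))"
| "i \<in> {1..<k} \<Longrightarrow>
    G_rel k (xx (i + 1) - tt (ss i) * xx i * tt (ss i)) (yy (i + 1) - tt (ss i) * yy i * tt (ss i))"

definition G_ideal :: "nat \<Rightarrow> gen fpoly set" where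
  "G_ideal k = Idl\<^bsub>free_alg (gens k)\<^esub> {u - v |u v. G_rel k u v}"

definition G_alg :: "nat \<Rightarrow> (complex, gen fpoly set) module" where
  "G_alg k = quot_alg (free_alg (gens k)) (G_ideal k)"

definition G_cls :: "nat \<Rightarrow> gen fpoly \<Rightarrow> gen fpoly set" where
  "G_cls k u = G_ideal k +>\<^bsub>free_alg (gens k)\<^esub> u"

inductive H_rel :: "nat \<Rightarrow> complex \<Rightarrow> complex \<Rightarrow> complex \<Rightarrow> complex \<Rightarrow> gen fpoly \<Rightarrow> gen fpoly \<Rightarrow> bool"
  for k a b p q where
  "i \<in> {1..<k} \<Longrightarrow> H_rel k a b p q (tt (ss i) * xx i) (xx (i + 1) * tt (ss i) - 1)"
| "i \<in> {1..<k} \<Longrightarrow> H_rel k a b p q (tt (ss i) * yy i) (yy (i + 1) * tt (ss i) - 1)"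
| "H_rel k a b p q ((xx 1 - cst a) * (xx 1 + cst p)) 0"
| "H_rel k a b p q ((yy 1 - cst b) * (yy 1 + cst q)) 0"

definition H_ideal :: "nat \<Rightarrow> complex \<Rightarrow> complex \<Rightarrow> complex \<Rightarrow> complex \<Rightarrow> gen fpoly set set" where
  "H_ideal k a b p q = Idl\<^bsub>G_alg k\<^esub> {G_cls k (u - v) |u v. H_rel k a b p q u v}"

definition H_alg ::
    "nat \<Rightarrow> complex \<Rightarrow> complex \<Rightarrow> complex \<Rightarrow> complex \<Rightarrow> (complex, gen fpoly set set) module" where
  "H_alg k a b p q = quot_alg (G_alg k) (H_ideal k a b p q)"

definition H_proj ::
    "nat \<Rightarrow> complex \<Rightarrow> complex \<Rightarrow> complex \<Rightarrow> complex \<Rightarrow> gen fpoly set \<Rightarrow> gen fpoly set set" where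
  "H_proj k a b p q g = H_ideal k a b p q +>\<^bsub>G_alg k\<^esub> g"


subsection \<open>The generated ideals are ideals and the quotients are rings\<close>

lemma quot_alg_simps:
  "carrier (quot_alg A I) = carrier (A Quot I)" "mult (quot_alg A I) = mult (A Quot I)"
  "one (quot_alg A I) = one (A Quot I)" "zero (quot_alg A I) = zero (A Quot I)"
  "add (quot_alg A I) = add (A Quot I)"
  "smult (quot_alg A I) = (\<lambda>c X. \<Union>x\<in>X. I +>\<^bsub>A\<^esub> (c \<odot>\<^bsub>A\<^esub> x))"
  by (simp_all add: quot_alg_def ring.defs module.defs FactRing_def)

lemma free_alg_simps:
  "carrier (free_alg S) = {f. \<forall>w\<in>Poly_Mapping.keys f. set (letters w) \<subseteq> S}"
  "mult (free_alg S) = (*)" "one (free_alg S) = 1" "zero (free_alg S) = 0"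
  "add (free_alg S) = (+)" "smult (free_alg S) = (\<lambda>c f. cst c * f)"
  by (simp_all add: free_alg_def)

lemma free_alg_carrier:
  shows "0 \<in> carrier (free_alg S)" "1 \<in> carrier (free_alg S)"
    and "f \<in> carrier (free_alg S) \<Longrightarrow> g \<in> carrier (free_alg S) \<Longrightarrow> f + g \<in> carrier (free_alg S)"
    and "f \<in> carrier (free_alg S) \<Longrightarrow> - f \<in> carrier (free_alg S)"
    and "f \<in> carrier (free_alg S) \<Longrightarrow> g \<in> carrier (free_alg S) \<Longrightarrow> f - g \<in> carrier (free_alg S)"
    and "f \<in> carrier (free_alg S) \<Longrightarrow> g \<in> carrier (free_alg S) \<Longrightarrow> f * g \<in> carrier (free_alg S)"
    and "cst c \<in> carrier (free_alg S)"
    and "g0 \<in> S \<Longrightarrow> var g0 \<in> carrier (free_alg S)"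
proof -
  show 0: "0 \<in> carrier (free_alg S)" by (simp add: free_alg_simps)
  show "1 \<in> carrier (free_alg S)" by (simp add: free_alg_simps zero_fmon_def)
  show p: "f + g \<in> carrier (free_alg S)" if "f \<in> carrier (free_alg S)" "g \<in> carrier (free_alg S)" for f g
    using that Poly_Mapping.keys_add[of f g] by (auto simp: free_alg_simps)
  show m: "- f \<in> carrier (free_alg S)" if "f \<in> carrier (free_alg S)" for f
    using that by (simp add: free_alg_simps)
  show "f - g \<in> carrier (free_alg S)" if "f \<in> carrier (free_alg S)" "g \<in> carrier (free_alg S)"
    using p[OF that(1) m[OF that(2)]] by simp
  show "f * g \<in> carrier (free_alg S)" if "f \<in> carrier (free_alg S)" "g \<in> carrier (free_alg S)"
    using that keys_mult[of f g] by (fastforce simp: free_alg_simps plus_fmon_def)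
  show "cst c \<in> carrier (free_alg S)" by (simp add: free_alg_simps cst_def zero_fmon_def)
  show "var g0 \<in> carrier (free_alg S)" if "g0 \<in> S" using that by (simp add: free_alg_simps var_def)
qed

lemma free_alg_sum:
  "(\<And>i. i \<in> A \<Longrightarrow> f i \<in> carrier (free_alg S)) \<Longrightarrow> sum f A \<in> carrier (free_alg S)"
  by (induction A rule: infinite_finite_induct) (auto simp: free_alg_carrier)

lemma ring_free_alg: "ring (free_alg S)"
proof (rule ringI)
  show "abelian_group (free_alg S)"
  proof (rule abelian_groupI)
    show "\<exists>y\<in>carrier (free_alg S). y \<oplus>\<^bsub>free_alg S\<^esub> x = \<zero>\<^bsub>free_alg S\<^esub>" if "x \<in> carrier (free_alg S)" for x
      using free_alg_carrier(4)[OF that] by (intro bexI[of _ "- x"]) (auto simp: free_alg_simps(2-))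
  qed (auto simp: free_alg_simps(2-) free_alg_carrier add_ac)
  show "Group.monoid (free_alg S)"
    by (rule Group.monoidI) (auto simp: free_alg_simps(2-) free_alg_carrier mult.assoc)
qed (auto simp: free_alg_simps(2-) algebra_simps)

lemma gens_carrier:
  "w permutes {1..k} \<Longrightarrow> tt w \<in> carrier (free_alg (gens k))"
  "i \<in> {1..k} \<Longrightarrow> xx i \<in> carrier (free_alg (gens k))"
  "i \<in> {1..k} \<Longrightarrow> yy i \<in> carrier (free_alg (gens k))"
  "i \<in> {0..k} \<Longrightarrow> zz i \<in> carrier (free_alg (gens k))"
  by (auto intro!: free_alg_carrier simp: gens_def)

lemma tr_carrier:
  "i \<in> {1..k} \<Longrightarrow> j \<in> {1..k} \<Longrightarrow> tt (transpose i j) \<in> carrier (free_alg (gens k))"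
  by (intro gens_carrier permutes_swap_id)

lemma G_rel_carrier:
  assumes "G_rel k u v"
  shows "u \<in> carrier (free_alg (gens k)) \<and> v \<in> carrier (free_alg (gens k))"
  using assms
proof cases
  case (1 i)
  have "m1 i \<in> carrier (free_alg (gens k))"
    unfolding m1_def using 1 by (intro free_alg_sum) (auto simp: m2_def Let_def intro!: free_alg_carrier(3-6) gens_carrier permutes_swap_id)
  then show ?thesis using 1 by (auto intro!: free_alg_carrier(3-6) gens_carrier)
qed (auto intro!: free_alg_carrier(2-6) free_alg_sum gens_carrier permutes_swap_id permutes_compose permutes_id)

lemma ideal_G: "ideal (G_ideal k) (free_alg (gens k))"
  unfolding G_ideal_def
  by (rule ring.genideal_ideal[OF ring_free_alg]) (auto dest: G_rel_carrier intro: free_alg_carrier)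

lemma ring_cong: "ring (A Quot I) \<Longrightarrow> ring (quot_alg A I)"
proof -
  assume "ring (A Quot I)" 
  then interpret R: ring "A Quot I" .
  show "ring (quot_alg A I)"
  proof (rule ringI)
    show "abelian_group (quot_alg A I)"
      by (rule abelian_groupI) (auto simp: quot_alg_simps R.add.m_ac intro: R.add.l_inv_ex)
    show "Group.monoid (quot_alg A I)"
      by (rule Group.monoidI) (auto simp: quot_alg_simps R.m_assoc)
  qed (auto simp: quot_alg_simps R.l_distr R.r_distr)
qed

lemma ring_G_alg: "ring (G_alg k)"
  unfolding G_alg_def by (intro ring_cong ideal.quotient_is_ring ideal_G)

lemma G_cls_carrier: "u \<in> carrier (free_alg (gens k)) \<Longrightarrow> G_cls k u \<in> carrier (G_alg k)"
  unfolding G_alg_def quot_alg_simps G_cls_def FactRing_def A_RCOSETS_def' by auto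

lemma ideal_H: assumes "1 \<le> k" shows "ideal (H_ideal k a b p q) (G_alg k)"
  unfolding H_ideal_def
  by (rule ring.genideal_ideal[OF ring_G_alg])
    (use assms in \<open>auto elim!: H_rel.cases intro!: G_cls_carrier free_alg_carrier gens_carrier permutes_swap_id\<close>)

lemma ring_H_alg: "1 \<le> k \<Longrightarrow> ring (H_alg k a b p q)"
  unfolding H_alg_def by (intro ring_cong ideal.quotient_is_ring ideal_H)

lemma smult_cls: assumes "u \<in> carrier (free_alg (gens k))" 
  shows "c \<odot>\<^bsub>G_alg k\<^esub> G_cls k u = G_cls k (cst c * u)"
proof -
  interpret I: ideal "G_ideal k" "free_alg (gens k)" by (rule ideal_G)
  have *: "G_cls k (cst c * x) = G_cls k (cst c * u)" if "x \<in> G_cls k u" for x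
  proof -
    from that obtain j where j: "j \<in> G_ideal k" "x = j + u" by (auto simp: G_cls_def a_r_coset_def' free_alg_simps)
    have "cst c * j \<in> G_ideal k" using I.I_l_closed[OF j(1) free_alg_carrier(7)] unfolding free_alg_simps(2) .
    then have "cst c * x \<in> G_ideal k +>\<^bsub>free_alg (gens k)\<^esub> (cst c * u)"
      by (auto simp: j(2) a_r_coset_def' free_alg_simps distrib_left)
    then show ?thesis unfolding G_cls_def using assms
      by (metis I.a_repr_independence' free_alg_carrier(6,7))
  qed
  have "u \<in> G_cls k u" unfolding G_cls_def using I.a_rcos_self[OF assms] .
  then show ?thesis using * unfolding G_alg_def quot_alg_simps free_alg_simps(6) G_cls_def[symmetric]
    by blast
qed


section \<open>The Lie algebras and their modules\<close>

definition trace :: "complex mat \<Rightarrow> complex" where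
  "trace A = (\<Sum>i<dim_row A. A $$ (i, i))"

datatype lie_type = GL | SL

fun lie_alg :: "lie_type \<Rightarrow> nat \<Rightarrow> complex mat set" where
  "lie_alg GL n = carrier_mat n n"
| "lie_alg SL n = {A \<in> carrier_mat n n. trace A = 0}"

text \<open>The algebra of endomorphisms of \<open>\<complex>\<^sup>d\<close>.\<close>

abbreviation End :: "nat \<Rightarrow> (complex, complex mat) module" where
  "End d \<equiv> module_mat TYPE(complex) d d"

text \<open>A finite-dimensional module is given in coordinates with respect to some basis: the pair
  \<open>(d, \<rho>)\<close> stands for \<open>\<complex>\<^sup>d\<close> with the Lie algebra element \<open>u\<close> acting by the matrix \<open>\<rho> u\<close>.\<close>

type_synonym lie_module = "nat \<times> (complex mat \<Rightarrow> complex mat)"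

definition is_lie_module :: "complex mat set \<Rightarrow> lie_module \<Rightarrow> bool" where
  "is_lie_module \<gg> M \<longleftrightarrow> (case M of (d, \<rho>) \<Rightarrow>
     (\<forall>u\<in>\<gg>. \<rho> u \<in> carrier_mat d d) \<and>
     (\<forall>u\<in>\<gg>. \<forall>v\<in>\<gg>. \<rho> (u + v) = \<rho> u + \<rho> v) \<and>
     (\<forall>c. \<forall>u\<in>\<gg>. \<rho> (c \<cdot>\<^sub>m u) = c \<cdot>\<^sub>m \<rho> u) \<and>
     (\<forall>u\<in>\<gg>. \<forall>v\<in>\<gg>. \<rho> (u * v - v * u) = \<rho> u * \<rho> v - \<rho> v * \<rho> u))"

definition irreducible_module :: "complex mat set \<Rightarrow> lie_module \<Rightarrow> bool" where
  "irreducible_module \<gg> M \<longleftrightarrow> is_lie_module \<gg> M \<and> (case M of (d, \<rho>) \<Rightarrow>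
     0 < d \<and>
     (\<forall>W. VectorSpace.subspace class_ring W (module_vec TYPE(complex) d) \<and>
          (\<forall>u\<in>\<gg>. \<forall>w\<in>W. \<rho> u *\<^sub>v w \<in> W) \<longrightarrow> W = {0\<^sub>v d} \<or> W = carrier_vec d))"

text \<open>A weight \<open>\<Sum>\<^sub>i \<mu>\<^sub>i \<epsilon>\<^sub>i\<close> is given by its coefficients \<open>\<mu>\<close>. Matrix rows, columns and the parts of a
  partition are numbered from \<open>0\<close>.\<close>

definition has_highest_weight :: "nat \<Rightarrow> complex mat set \<Rightarrow> (nat \<Rightarrow> complex) \<Rightarrow> lie_module \<Rightarrow> bool" where
  "has_highest_weight n \<gg> \<mu> M \<longleftrightarrow> (case M of (d, \<rho>) \<Rightarrow>
     (\<exists>v\<in>carrier_vec d. v \<noteq> 0\<^sub>v d \<and>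
        (\<forall>e\<in>\<gg>. (\<forall>i<n. \<forall>j\<le>i. e $$ (i, j) = 0) \<longrightarrow> \<rho> e *\<^sub>v v = 0\<^sub>v d) \<and>
        (\<forall>h\<in>\<gg>. diagonal_mat h \<longrightarrow> \<rho> h *\<^sub>v v = (\<Sum>i<n. \<mu> i * h $$ (i, i)) \<cdot>\<^sub>v v)))"

fun partition_weight :: "lie_type \<Rightarrow> nat \<Rightarrow> (nat \<Rightarrow> nat) \<Rightarrow> nat \<Rightarrow> complex" where
  "partition_weight GL n pt i = of_nat (pt i)"
| "partition_weight SL n pt i = of_nat (pt i) - of_nat (\<Sum>j<n. pt j) / of_nat n"

text \<open>\<open>is_L ty n pt M\<close>: the module \<open>M\<close> is (isomorphic to) \<open>L(pt)\<close>.\<close>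

definition is_L :: "lie_type \<Rightarrow> nat \<Rightarrow> (nat \<Rightarrow> nat) \<Rightarrow> lie_module \<Rightarrow> bool" where
  "is_L ty n pt M \<longleftrightarrow> irreducible_module (lie_alg ty n) M \<and>
     has_highest_weight n (lie_alg ty n) (partition_weight ty n pt) M"

definition rect :: "nat \<Rightarrow> nat \<Rightarrow> nat \<Rightarrow> nat" where
  "rect a p i = (if i < p then a else 0)"

definition std_module :: "nat \<Rightarrow> lie_module" where
  "std_module n = (n, \<lambda>u. u)"

definition dual_bases :: "lie_type \<Rightarrow> nat \<Rightarrow> nat \<Rightarrow> (nat \<Rightarrow> complex mat) \<Rightarrow> (nat \<Rightarrow> complex mat) \<Rightarrow> bool"
  where
  "dual_bases ty n r B B' \<longleftrightarrow>
     (\<forall>i<r. B i \<in> lie_alg ty n \<and> B' i \<in> lie_alg ty n) \<and>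
     (\<forall>u\<in>lie_alg ty n. \<exists>c. u = (\<Oplus>\<^bsub>End n\<^esub>i\<in>{..<r}. c i \<cdot>\<^sub>m B i)) \<and>
     (\<forall>c. (\<Oplus>\<^bsub>End n\<^esub>i\<in>{..<r}. c i \<cdot>\<^sub>m B i) = 0\<^sub>m n n \<longrightarrow> (\<forall>i<r. c i = 0)) \<and>
     (\<forall>i<r. \<forall>j<r. trace (B i * B' j) = (if i = j then 1 else 0))"

definition casimir :: "nat \<Rightarrow> (nat \<Rightarrow> complex mat) \<Rightarrow> (nat \<Rightarrow> complex mat) \<Rightarrow> lie_module \<Rightarrow> complex mat"
  where
  "casimir r B B' M = (\<Oplus>\<^bsub>End (fst M)\<^esub>i\<in>{..<r}. snd M (B i) * snd M (B' i))"

definition casimir_scalar ::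
    "nat \<Rightarrow> (nat \<Rightarrow> complex mat) \<Rightarrow> (nat \<Rightarrow> complex mat) \<Rightarrow> lie_module \<Rightarrow> complex" where
  "casimir_scalar r B B' M = (THE c. casimir r B B' M = c \<cdot>\<^sub>m 1\<^sub>m (fst M))"


section \<open>Tensor products\<close>

text \<open>Kronecker products: the basis vector \<open>e\<^sub>i \<otimes> e\<^sub>j\<close> of \<open>\<complex>\<^sup>c \<otimes> \<complex>\<^sup>d\<close> has number \<open>i * d + j\<close>.\<close>

definition kron :: "complex mat \<Rightarrow> complex mat \<Rightarrow> complex mat" where
  "kron A B = mat (dim_row A * dim_row B) (dim_col A * dim_col B)
     (\<lambda>(i, j). A $$ (i div dim_row B, j div dim_col B) * B $$ (i mod dim_row B, j mod dim_col B))"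

definition tensor :: "complex mat list \<Rightarrow> complex mat" where
  "tensor As = foldr kron As (1\<^sub>m 1)"

definition swap_mat :: "nat \<Rightarrow> complex mat" where
  "swap_mat n = mat (n * n) (n * n)
     (\<lambda>(i, j). if i div n = j mod n \<and> i mod n = j div n then 1 else 0)"

definition tensor_dim :: "lie_module list \<Rightarrow> nat" where
  "tensor_dim Ms = prod_list (map fst Ms)"

text \<open>\<open>A\<close> acting on the tensor factor number \<open>f\<close>, identity on all others.\<close>

definition on_factor :: "lie_module list \<Rightarrow> nat \<Rightarrow> complex mat \<Rightarrow> complex mat" where
  "on_factor Ms f A = tensor ((map (\<lambda>M. 1\<^sub>m (fst M)) Ms)[f := A])"

text \<open>The space \<open>\<Otimes> Ms\<close> on which the Lie algebra acts as on the tensor product of the factors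
  with numbers in \<open>F\<close>, and as zero on the other factors. The Casimir element then acts
  on this module by its action on the tensor product of these factors, tensored with the identity.\<close>

definition tensor_module :: "lie_module list \<Rightarrow> nat set \<Rightarrow> lie_module" where
  "tensor_module Ms F = (tensor_dim Ms,
     \<lambda>u. \<Oplus>\<^bsub>End (tensor_dim Ms)\<^esub>f\<in>F. on_factor Ms f (snd (Ms ! f) u))"

text \<open>In the factor list of \<open>M \<otimes> N \<otimes> V\<^sup>\<otimes>\<^sup>k\<close> the factor number \<open>0\<close> is \<open>M\<close>, \<open>1\<close> is \<open>N\<close>, and \<open>i + 1\<close> is
  the \<open>i\<close>-th copy of \<open>V\<close>.\<close>

definition factors :: "nat \<Rightarrow> nat \<Rightarrow> lie_module \<Rightarrow> lie_module \<Rightarrow> lie_module list" where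
  "factors n k M N = [M, N] @ replicate k (std_module n)"

definition MNV :: "nat \<Rightarrow> nat \<Rightarrow> lie_module \<Rightarrow> lie_module \<Rightarrow> lie_module" where
  "MNV n k M N = tensor_module (factors n k M N) {..<k + 2}"

text \<open>\<open>kappa r B B' Ms F j\<close> is \<open>\<kappa>\<^bsub>X,\<le>j\<^esub>\<close> where \<open>X\<close> is the tensor product of the factors
  in \<open>F \<subseteq> {0, 1}\<close>.\<close>

definition kappa :: "nat \<Rightarrow> (nat \<Rightarrow> complex mat) \<Rightarrow> (nat \<Rightarrow> complex mat) \<Rightarrow>
    lie_module list \<Rightarrow> nat set \<Rightarrow> nat \<Rightarrow> complex mat" where
  "kappa r B B' Ms F j = casimir r B B' (tensor_module Ms (F \<union> (\<lambda>i. i + 1) ` {1..j}))"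

definition gamma_MN :: "nat \<Rightarrow> (nat \<Rightarrow> complex mat) \<Rightarrow> (nat \<Rightarrow> complex mat) \<Rightarrow>
    nat \<Rightarrow> nat \<Rightarrow> lie_module \<Rightarrow> lie_module \<Rightarrow> complex mat" where
  "gamma_MN r B B' n k M N = (\<Oplus>\<^bsub>End (fst (MNV n k M N))\<^esub>i\<in>{..<r}.
     tensor ([snd M (B i), snd N (B' i)] @ replicate k (1\<^sub>m n)))"

definition End_lie :: "complex mat set \<Rightarrow> lie_module \<Rightarrow> (complex, complex mat) module" where
  "End_lie \<gg> U = (End (fst U))
     \<lparr>carrier := {A \<in> carrier_mat (fst U) (fst U). \<forall>u\<in>\<gg>. A * snd U u = snd U u * A}\<rparr>"


section \<open>The formulas for the homomorphism\<close>

definition is_Phi :: "nat \<Rightarrow> (nat \<Rightarrow> complex mat) \<Rightarrow> (nat \<Rightarrow> complex mat) \<Rightarrow>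
    nat \<Rightarrow> nat \<Rightarrow> lie_module \<Rightarrow> lie_module \<Rightarrow> complex \<Rightarrow> complex \<Rightarrow> complex \<Rightarrow> complex \<Rightarrow>
    (gen fpoly set \<Rightarrow> complex mat) \<Rightarrow> bool" where
  "is_Phi r B B' n k M N c\<^sub>x c\<^sub>y c\<^sub>z d \<Phi> \<longleftrightarrow>
    (let \<kappa> = kappa r B B' (factors n k M N);
         \<kappa>\<^sub>V = casimir_scalar r B B' (std_module n);
         id\<^sub>U = 1\<^sub>m (fst (MNV n k M N))
     in
       (\<forall>i\<in>{1..k}. \<Phi> (G_cls k (xx i)) =
          (1/2) \<cdot>\<^sub>m (\<kappa> {0} i - \<kappa> {0} (i - 1)) + ((of_nat i - 1) * d + c\<^sub>x) \<cdot>\<^sub>m id\<^sub>U) \<and>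
       (\<forall>i\<in>{1..k}. \<Phi> (G_cls k (yy i)) =
          (1/2) \<cdot>\<^sub>m (\<kappa> {1} i - \<kappa> {1} (i - 1)) + ((of_nat i - 1) * d + c\<^sub>y) \<cdot>\<^sub>m id\<^sub>U) \<and>
       (\<forall>i\<in>{1..k}. \<Phi> (G_cls k (zz i)) =
          (1/2) \<cdot>\<^sub>m (\<kappa> {0, 1} i - \<kappa> {0, 1} (i - 1) + \<kappa>\<^sub>V \<cdot>\<^sub>m id\<^sub>U)
            + ((of_nat i - 1) * d + c\<^sub>x + c\<^sub>y) \<cdot>\<^sub>m id\<^sub>U) \<and>
       \<Phi> (G_cls k (zz 0)) = gamma_MN r B B' n k M N + c\<^sub>z \<cdot>\<^sub>m id\<^sub>U \<and>
       (\<forall>j\<in>{1..<k}. \<Phi> (G_cls k (tt (ss j))) =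
          tensor ([1\<^sub>m (fst M), 1\<^sub>m (fst N)] @ replicate (j - 1) (1\<^sub>m n) @ [swap_mat n]
            @ replicate (k - j - 1) (1\<^sub>m n))))"

end

theory Submission
  imports Defs "Jordan_Normal_Form.Char_Poly"
begin

text \<open>Extending \<open>sl\<^sub>n\<close>-modules to \<open>gl\<^sub>n\<close> by a suitable scalar action of the identity matrix absorbs the
  constants \<open>c\<^sub>x\<close>, \<open>c\<^sub>y\<close>, \<open>d\<close> and reduces everything to \<open>gl\<^sub>n\<close>. Write \<open>\<gamma>\<^bsub>f,g\<^esub>\<close> for the element \<open>\<gamma>\<close> of \<open>gl\<^sub>n\<close>
  acting on the tensor factors \<open>f\<close> and \<open>g\<close>. Expanding the Casimir elements, \<open>x\<^sub>i\<close> acts as the sum of the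
  \<open>\<gamma>\<^bsub>f,V\<^sub>i\<^esub>\<close> over the factors \<open>f \<in> {M, V\<^sub>1, \<dots>, V\<^bsub>i-1\<^esub>}\<close>, and similarly for \<open>y\<^sub>i\<close> and \<open>z\<^sub>i\<close>. On two copies
  of \<open>V\<close> the element \<open>\<gamma>\<close> is the flip, which gives \<open>t\<^bsub>s\<^sub>i\<^esub> x\<^sub>i = x\<^bsub>i+1\<^esub> t\<^bsub>s\<^sub>i\<^esub> - 1\<close>; the commutation relations
  follow from the invariance of \<open>\<gamma>\<close> under \<open>gl\<^sub>n\<close>.

  For the quadratic relation, the vectors of \<open>M\<close> on which all matrix coefficients of \<open>(\<gamma> - a) (\<gamma> + p)\<close> vanish
  form a submodule of \<open>M\<close>. It contains the highest weight vector \<open>v\<close>, because \<open>E\<^bsub>ij\<^esub> v = 0\<close> for \<open>i \<noteq> j\<close>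
  unless \<open>j \<le> p < i\<close>, so it is all of \<open>M\<close>.\<close>

text \<open>Why \<open>E_ij v = 0\<close> when \<open>j < i\<close> lie on the same side of
  \<open>p\<close>: the highest weight has equal coordinates at \<open>i\<close> and
  \<open>j\<close>, so \<open>v\<close> has weight 0 for the sl_2 triple \<open>E_ji\<close>,
  \<open>E_jj - E_ii\<close>, \<open>E_ij\<close> and is killed by the raising element; in finite
  dimension it is then killed by the lowering element too. The root \<open>-p\<close> counts the
  \<open>p\<close> commutators produced by moving \<open>E_mj\<close> past \<open>E_im\<close> for
  \<open>m \<le> p\<close>. The identity matrix is made to act as \<open>ap\<close> on M,
  \<open>bq\<close> on N and 1 on V, so that the highest weights become the partitions themselves.
  For sl_n this raises \<gamma> on two factors with scalars \<open>s\<close> and \<open>s'\<close>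
  by \<open>s s' / n\<close>: hence \<open>ap/n\<close> in \<open>c_x\<close>, and
  \<open>(i-1) d\<close> for the \<open>i-1\<close> earlier copies of V. The rest of
  \<open>c_x\<close> is minus half the Casimir value of V, \<open>n\<close> or
  \<open>n - 1/n\<close>. Commutation of \<open>z_0 + ... + z_i\<close> with \<open>x_j\<close> and
  \<open>y_j\<close> does not hold term by term: up to a scalar, twice that sum is the Casimir
  element of the first \<open>i + 2\<close> factors minus those of the single factors. The
  factorization is shown for every homomorphism with the prescribed values, which mention
  \<open>t\<close> only at simple transpositions.\<close>

section \<open>Linear endomorphisms of sequences\<close>

text \<open>Square matrices of variable size form no type of class \<^class>\<open>ring_1\<close>. They are embedded into the
  following type, in which noncommutative identities are proved by ring normalization.\<close>

typedef endo = "{f :: (nat \<Rightarrow> complex) \<Rightarrow> nat \<Rightarrow> complex.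
    (\<forall>u v. f (\<lambda>i. u i + v i) = (\<lambda>i. f u i + f v i)) \<and> (\<forall>c u. f (\<lambda>i. c * u i) = (\<lambda>i. c * f u i))}"
  by (rule exI[of _ id]) auto

setup_lifting type_definition_endo

instantiation endo :: ring_1
begin
lift_definition zero_endo :: endo is "\<lambda>v i. 0" by auto
lift_definition one_endo :: endo is "\<lambda>v. v" by auto
lift_definition plus_endo :: "endo \<Rightarrow> endo \<Rightarrow> endo" is "\<lambda>f g v i. f v i + g v i"
  by (auto simp: algebra_simps)
lift_definition uminus_endo :: "endo \<Rightarrow> endo" is "\<lambda>f v i. - f v i" by auto
lift_definition minus_endo :: "endo \<Rightarrow> endo \<Rightarrow> endo" is "\<lambda>f g v i. f v i - g v i"
  by (auto simp: algebra_simps)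
lift_definition times_endo :: "endo \<Rightarrow> endo \<Rightarrow> endo" is "\<lambda>f g v. f (g v)" by auto
instance
proof
  show "(0::endo) \<noteq> 1" by transfer (metis zero_neq_one)
qed (transfer; auto simp: algebra_simps)+
end

text \<open>Scalars become central ring elements, so that scalar multiples are ordinary products and
  identities with parameters stay within \<open>ring_1\<close>.\<close>

lift_definition sc :: "complex \<Rightarrow> endo" is "\<lambda>c v i. c * v i" by (auto simp: algebra_simps)

lemma sc_simps: "sc 0 = 0" "sc 1 = 1" "sc (c + d) = sc c + sc d" "sc (c * d) = sc c * sc d" "sc (- c) = - sc c"
  "sc (c - d) = sc c - sc d"
  by (transfer; auto simp: algebra_simps)+

lemma sc_comm: "X * sc c = sc c * X"
  by transfer auto

lemma sc_comm_left: "X * (sc c * Y) = sc c * (X * Y)"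
  by (metis mult.assoc sc_comm)

lemma sc_of_nat: "sc (of_nat m) = of_nat m"
  by (induction m) (auto simp: sc_simps)

lemma sc_sum: "sc (sum f A) = (\<Sum>i\<in>A. sc (f i))"
  by (induction A rule: infinite_finite_induct) (auto simp: sc_simps)

text \<open>Absence of 2-torsion, the substitute for halving: Casimir computations determine their
  cross terms only doubled.\<close>

lemma endo_double_zero: assumes "X + X = (0::endo)" shows "X = 0"
  using assms by transfer (auto simp: fun_eq_iff)

lemma endo_eqI: "(\<And>v i. Rep_endo X v i = Rep_endo Y v i) \<Longrightarrow> X = Y"
  by transfer (auto simp: fun_eq_iff)

lemma Rep_sum: "Rep_endo (sum F A) v i = (\<Sum>a\<in>A. Rep_endo (F a) v i)"
  by (induction A rule: infinite_finite_induct) (auto simp: zero_endo.rep_eq plus_endo.rep_eq)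

text \<open>A square matrix acts block by block on sequences; unlike letting it act on the first \<open>d\<close>
  coordinates only, this embedding maps the identity matrix to the unit.\<close>

definition emb_fun :: "nat \<Rightarrow> complex mat \<Rightarrow> (nat \<Rightarrow> complex) \<Rightarrow> nat \<Rightarrow> complex" where
  "emb_fun d A v i = (\<Sum>j<d. A $$ (i mod d, j) * v (i div d * d + j))"

lift_definition emb :: "nat \<Rightarrow> complex mat \<Rightarrow> endo" is emb_fun
  by (auto simp: fun_eq_iff emb_fun_def algebra_simps sum.distrib sum_distrib_left)

context fixes d :: nat assumes d: "0 < d"
begin

lemma emb_add: assumes "A \<in> carrier_mat d d" "B \<in> carrier_mat d d"
  shows "emb d (A + B) = emb d A + emb d B"
  using assms d by transfer (auto simp: fun_eq_iff emb_fun_def algebra_simps sum.distrib)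

lemma emb_diff: assumes "A \<in> carrier_mat d d" "B \<in> carrier_mat d d"
  shows "emb d (A - B) = emb d A - emb d B"
  using assms d by transfer (auto simp: fun_eq_iff emb_fun_def algebra_simps sum_subtractf)

lemma emb_smult: assumes "A \<in> carrier_mat d d"
  shows "emb d (c \<cdot>\<^sub>m A) = sc c * emb d A"
  using assms d by transfer (auto simp: fun_eq_iff emb_fun_def algebra_simps sum_distrib_left)

lemma emb_zero: "emb d (0\<^sub>m d d) = 0"
  using d by transfer (auto simp: fun_eq_iff emb_fun_def)

lemma emb_one: "emb d (1\<^sub>m d) = 1"
proof (rule endo_eqI)
  fix v i
  have "emb_fun d (1\<^sub>m d) v i = (\<Sum>j<d. if j = i mod d then v (i div d * d + j) else 0)"
    unfolding emb_fun_def using d by (intro sum.cong) auto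
  also have "\<dots> = v i" using d by simp
  finally show "Rep_endo (emb d (1\<^sub>m d)) v i = Rep_endo 1 v i" by (simp add: emb.rep_eq one_endo.rep_eq)
qed

lemma emb_mult: assumes A: "A \<in> carrier_mat d d" and B: "B \<in> carrier_mat d d"
  shows "emb d (A * B) = emb d A * emb d B"
proof (rule endo_eqI)
  fix v i
  have "emb_fun d (A * B) v i = (\<Sum>j<d. (\<Sum>l<d. A $$ (i mod d, l) * B $$ (l, j)) * v (i div d * d + j))"
    unfolding emb_fun_def using A B d by (intro sum.cong refl) (auto simp: scalar_prod_def lessThan_atLeast0)
  also have "\<dots> = (\<Sum>l<d. A $$ (i mod d, l) * (\<Sum>j<d. B $$ (l, j) * v (i div d * d + j)))"
    unfolding sum_distrib_left sum_distrib_right by (subst sum.swap) (simp add: algebra_simps)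
  also have "\<dots> = emb_fun d A (emb_fun d B v) i"
    unfolding emb_fun_def using d by (intro sum.cong refl) auto
  finally show "Rep_endo (emb d (A * B)) v i = Rep_endo (emb d A * emb d B) v i"
    by (simp add: emb.rep_eq times_endo.rep_eq)
qed

lemma emb_eq_iff: assumes A: "A \<in> carrier_mat d d" and B: "B \<in> carrier_mat d d"
  shows "emb d A = emb d B \<longleftrightarrow> A = B"
proof
  assume e: "emb d A = emb d B"
  \<comment> \<open>The indicator sequence of position \<open>j\<close> lies in block 0 and picks
    out column \<open>j\<close>; hence \<open>emb\<close> is injective on matrices of size
    \<open>d\<close>.\<close>
  have entry: "emb_fun d C (\<lambda>x. if x = j then 1 else 0) i = C $$ (i, j)" if "i < d" "j < d" for i j C
  proof -
    have "emb_fun d C (\<lambda>x. if x = j then 1 else 0) i = (\<Sum>j'<d. if j' = j then C $$ (i, j) else 0)"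
      unfolding emb_fun_def using that by (intro sum.cong) auto
    then show ?thesis using that by simp
  qed
  have "A $$ (i, j) = B $$ (i, j)" if "i < d" "j < d" for i j
    using entry[OF that, of A] entry[OF that, of B] e by (metis emb.rep_eq)
  then show "A = B" using A B by (intro eq_matI) auto
qed auto

text \<open>Translates the carrier-based sum of \<open>End d\<close> into a sum in the type
  \<open>endo\<close>. Membership in the carrier belongs to the same induction because
  \<open>emb_add\<close> needs it at every step.\<close>

lemma emb_finsum: assumes "finite S" "\<And>i. i \<in> S \<Longrightarrow> f i \<in> carrier_mat d d"
  shows "(\<Oplus>\<^bsub>End d\<^esub>i\<in>S. f i) \<in> carrier_mat d d \<and> emb d (\<Oplus>\<^bsub>End d\<^esub>i\<in>S. f i) = (\<Sum>i\<in>S. emb d (f i))"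
proof -
  interpret abelian_group "End d" by (rule abelian_group_mat)
  show ?thesis using assms
  proof (induction S rule: finite_induct)
    case empty
    then show ?case by (simp add: module_mat_simps emb_zero)
  next
    case (insert x S)
    have "(\<Oplus>\<^bsub>End d\<^esub>i\<in>insert x S. f i) = f x + (\<Oplus>\<^bsub>End d\<^esub>i\<in>S. f i)"
      using insert by (subst finsum_insert) (auto simp: module_mat_simps)
    then show ?case using insert by (simp add: emb_add)
  qed
qed

lemmas emb_simps = emb_add emb_diff emb_smult emb_zero emb_one emb_mult

end

section \<open>Tensor products of several matrices\<close>

text \<open>Mixed radix digits, the last tensor factor being the least significant one, as in \<^const>\<open>kron\<close>.\<close>

fun dec :: "nat list \<Rightarrow> nat \<Rightarrow> nat list" where
  "dec [] i = []"
| "dec (d # ds) i = (i div prod_list ds) # dec ds (i mod prod_list ds)"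

lemma length_dec [simp]: "length (dec ds i) = length ds"
  by (induction ds arbitrary: i) auto

lemma dec_less: "i < prod_list ds \<Longrightarrow> f < length ds \<Longrightarrow> dec ds i ! f < ds ! f"
proof (induction ds arbitrary: i f)
  case (Cons d ds)
  then have "0 < prod_list ds" by (cases "prod_list ds") auto
  with Cons show ?case by (cases f) (auto simp: less_mult_imp_div_less)
qed auto

lemma dec_inj: "i < prod_list ds \<Longrightarrow> j < prod_list ds \<Longrightarrow> dec ds i = dec ds j \<Longrightarrow> i = j"
proof (induction ds arbitrary: i j)
  case (Cons d ds)
  then have "0 < prod_list ds" by (cases "prod_list ds") auto
  then have "i mod prod_list ds = j mod prod_list ds" using Cons by auto
  with Cons.prems show ?case by (metis dec.simps(2) div_mult_mod_eq list.inject)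
qed auto

lemma dec_surj:
  "length xs = length ds \<Longrightarrow> (\<And>f. f < length ds \<Longrightarrow> xs ! f < ds ! f) \<Longrightarrow> \<exists>i<prod_list ds. dec ds i = xs"
proof (induction ds arbitrary: xs)
  case (Cons d ds)
  then obtain x ys where xs: "xs = x # ys" by (cases xs) auto
  have ys: "\<And>f. f < length ds \<Longrightarrow> ys ! f < ds ! f" using Cons.prems(2) xs by fastforce
  obtain i where i: "i < prod_list ds" "dec ds i = ys" using Cons.IH[of ys] Cons.prems(1) ys xs by auto
  have x: "x < d" using Cons.prems(2)[of 0] xs by auto
  have "x * prod_list ds + i < Suc x * prod_list ds" using i by simp
  also have "\<dots> \<le> d * prod_list ds" using x by (intro mult_le_mono1) auto
  finally have "x * prod_list ds + i < d * prod_list ds" .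
  moreover have "(x * prod_list ds + i) div prod_list ds = x" using i by (cases "prod_list ds = 0") auto
  moreover have "(x * prod_list ds + i) mod prod_list ds = i" using i by simp
  ultimately show ?case using i(2)
    by (intro exI[of _ "x * prod_list ds + i"]) (simp del: div_mult_self3 add: xs)
qed auto

lemma dec_eq_iff:
  assumes "i < prod_list ds" "j < prod_list ds"
  shows "(\<forall>f<length ds. dec ds i ! f = dec ds j ! f) \<longleftrightarrow> i = j"
  using dec_inj[OF assms] by (metis length_dec nth_equalityI)

lemma sum_mod_div:
  fixes F :: "nat \<Rightarrow> nat \<Rightarrow> 'a::comm_monoid_add"
  shows "(\<Sum>l<c * d. F (l div d) (l mod d)) = (\<Sum>i<c. \<Sum>j<d. F i j)"
proof (cases "d = 0")
  case False
  have "(\<Sum>i<c. \<Sum>j<d. F i j) = (\<Sum>(i, j)\<in>{..<c} \<times> {..<d}. F i j)"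
    by (rule sum.cartesian_product)
  also have "\<dots> = (\<Sum>l<c * d. F (l div d) (l mod d))"
  proof (rule sum.reindex_bij_witness[of _ "\<lambda>l. (l div d, l mod d)" "\<lambda>(i, j). i * d + j"])
    fix x assume "x \<in> {..<c} \<times> {..<d}"
    then obtain i j where x: "x = (i, j)" "i < c" "j < d" by auto
    have "i * d + j < Suc i * d" using x by simp
    also have "\<dots> \<le> c * d" using x by (intro mult_le_mono1) auto
    finally show "(case x of (i, j) \<Rightarrow> i * d + j) \<in> {..<c * d}" by (simp add: x)
  qed (use False in \<open>auto simp: less_mult_imp_div_less\<close>)
  finally show ?thesis by simp
qed auto

lemma kron_carrier:
  "A \<in> carrier_mat a b \<Longrightarrow> B \<in> carrier_mat c d \<Longrightarrow> kron A B \<in> carrier_mat (a * c) (b * d)"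
  by (auto simp: kron_def)

lemma kron_entry:
  "A \<in> carrier_mat a b \<Longrightarrow> B \<in> carrier_mat c d \<Longrightarrow> i < a * c \<Longrightarrow> j < b * d \<Longrightarrow>
    kron A B $$ (i, j) = A $$ (i div c, j div d) * B $$ (i mod c, j mod d)"
  by (auto simp: kron_def)

lemma mult_mat_entry: "A \<in> carrier_mat a b \<Longrightarrow> B \<in> carrier_mat b c \<Longrightarrow> i < a \<Longrightarrow> j < c \<Longrightarrow>
    (A * B) $$ (i, j) = (\<Sum>l<b. A $$ (i, l) * B $$ (l, j))"
  by (auto simp: scalar_prod_def lessThan_atLeast0)

lemma mod_less_of_less_mult: "i < a * c \<Longrightarrow> i mod c < (c::nat)"
  by (cases "c = 0") auto

lemma kron_mult:
  assumes A: "A \<in> carrier_mat a a" and B: "B \<in> carrier_mat b b"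
    and C: "C \<in> carrier_mat a a" and D: "D \<in> carrier_mat b b"
  shows "kron A B * kron C D = kron (A * C) (B * D)"
proof (rule eq_matI)
  have car: "kron A B \<in> carrier_mat (a * b) (a * b)" "kron C D \<in> carrier_mat (a * b) (a * b)"
    "A * C \<in> carrier_mat a a" "B * D \<in> carrier_mat b b"
    using assms kron_carrier by auto
  note car4 = kron_carrier[OF car(3,4)]
  fix i j assume "i < dim_row (kron (A * C) (B * D))" "j < dim_col (kron (A * C) (B * D))"
  then have ij: "i < a * b" "j < a * b" using car4 by auto
  note ijd = less_mult_imp_div_less[OF ij(1)] less_mult_imp_div_less[OF ij(2)]
    mod_less_of_less_mult[OF ij(1)] mod_less_of_less_mult[OF ij(2)]
  have "(kron A B * kron C D) $$ (i, j) = (\<Sum>l<a * b. kron A B $$ (i, l) * kron C D $$ (l, j))"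
    by (rule mult_mat_entry[OF car(1,2) ij])
  also have "\<dots> = (\<Sum>l<a * b. (\<lambda>s t. A $$ (i div b, s) * B $$ (i mod b, t) * (C $$ (s, j div b) * D $$ (t, j mod b))) (l div b) (l mod b))"
    using ij by (intro sum.cong refl) (simp add: kron_entry[OF A B] kron_entry[OF C D])
  also have "\<dots> = (\<Sum>s<a. \<Sum>t<b. A $$ (i div b, s) * B $$ (i mod b, t) * (C $$ (s, j div b) * D $$ (t, j mod b)))"
    by (rule sum_mod_div)
  also have "\<dots> = (\<Sum>s<a. A $$ (i div b, s) * C $$ (s, j div b)) * (\<Sum>t<b. B $$ (i mod b, t) * D $$ (t, j mod b))"
    unfolding sum_product by (simp add: mult_ac)
  also have "\<dots> = kron (A * C) (B * D) $$ (i, j)"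
    unfolding kron_entry[OF car(3,4) ij] mult_mat_entry[OF A C ijd(1,2)] mult_mat_entry[OF B D ijd(3,4)] ..
  finally show "(kron A B * kron C D) $$ (i, j) = kron (A * C) (B * D) $$ (i, j)" .
qed (use assms in \<open>auto simp: kron_def\<close>)

lemma kron_assoc: "kron (kron A B) C = kron A (kron B C)"
proof (rule eq_matI)
  fix i j assume "i < dim_row (kron A (kron B C))" "j < dim_col (kron A (kron B C))"
  then have ij: "i < dim_row A * dim_row B * dim_row C" "j < dim_col A * dim_col B * dim_col C"
    by (auto simp: kron_def mult.assoc)
  have pos: "0 < dim_row B" "0 < dim_row C" "0 < dim_col B" "0 < dim_col C" using ij by (auto intro: Nat.gr0I)
  have m: "i mod (dim_row B * dim_row C) < dim_row B * dim_row C"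
    "j mod (dim_col B * dim_col C) < dim_col B * dim_col C" using pos by auto
  have md: "x mod (b * c) div c = x div c mod b" "x mod (b * c) mod c = x mod c" if "0 < c" for x b c :: nat
    using that by (simp_all add: mod_mult2_eq mult.commute[of b c])
  show "kron (kron A B) C $$ (i, j) = kron A (kron B C) $$ (i, j)"
    using ij m pos less_mult_imp_div_less[OF ij(1)] less_mult_imp_div_less[OF ij(2)]
    by (simp add: kron_def md mult.assoc div_mult2_eq[symmetric] mult.commute[of "dim_row C"] mult.commute[of "dim_col C"])
qed (auto simp: kron_def mult.assoc)

abbreviation sq :: "nat list \<Rightarrow> complex mat list \<Rightarrow> bool" where
  "sq ds As \<equiv> list_all2 (\<lambda>d A. A \<in> carrier_mat d d) ds As"

lemma sqI: "length As = length ds \<Longrightarrow> (\<And>f. f < length ds \<Longrightarrow> As ! f \<in> carrier_mat (ds ! f) (ds ! f)) \<Longrightarrow> sq ds As"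
  by (auto simp: list_all2_conv_all_nth)

lemma tensor_simps: "tensor [] = 1\<^sub>m 1" "tensor (A # As) = kron A (tensor As)"
  by (auto simp: tensor_def)

lemma tensor_carrier: "sq ds As \<Longrightarrow> tensor As \<in> carrier_mat (prod_list ds) (prod_list ds)"
  by (induction ds As rule: list_all2_induct) (auto simp: tensor_simps intro!: kron_carrier)

text \<open>The nested quotients and remainders of iterated Kronecker products are exactly the
  digits computed by \<open>dec\<close>, so entries factor over the slots and permutations can act
  on digits.\<close>

lemma tensor_entry:
  "sq ds As \<Longrightarrow> i < prod_list ds \<Longrightarrow> j < prod_list ds \<Longrightarrow>
    tensor As $$ (i, j) = (\<Prod>f<length ds. As ! f $$ (dec ds i ! f, dec ds j ! f))"
proof (induction ds As arbitrary: i j rule: list_all2_induct)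
  case (Cons d ds A As)
  have m: "i mod prod_list ds < prod_list ds" "j mod prod_list ds < prod_list ds"
    using mod_less_of_less_mult Cons.prems by auto
  show ?case using Cons.prems
    by (simp add: tensor_simps kron_entry[OF Cons.hyps(1) tensor_carrier[OF Cons.hyps(2)]] Cons.IH[OF m]
        prod.lessThan_Suc_shift del: prod.lessThan_Suc)
qed (auto simp: tensor_simps)

lemma tensor_mult: "sq ds As \<Longrightarrow> sq ds Bs \<Longrightarrow> tensor As * tensor Bs = tensor (map2 (*) As Bs)"
proof (induction ds As arbitrary: Bs rule: list_all2_induct)
  case (Cons d ds A As)
  from Cons.prems obtain B Cs where Bs: "Bs = B # Cs" "B \<in> carrier_mat d d" "sq ds Cs"
    by (auto simp: list_all2_Cons1)
  show ?case
    unfolding Bs(1) by (simp add: tensor_simps kron_mult[OF Cons.hyps(1) tensor_carrier[OF Cons.hyps(2)] Bs(2) tensor_carrier[OF Bs(3)]] Cons.IH[OF Bs(3)])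
qed (auto simp: tensor_simps)

text \<open>Two adjacent factors can be read as a single factor of product dimension; this is how
  \<open>swap_mat\<close> fits into a longer tensor product.\<close>

lemma tensor_append_kron: "tensor (As @ A # B # Bs) = tensor (As @ kron A B # Bs)"
  by (induction As) (auto simp: tensor_simps kron_assoc)

section \<open>Operators on one tensor factor and permutations of the factors\<close>

definition onf :: "nat list \<Rightarrow> nat \<Rightarrow> complex mat \<Rightarrow> complex mat" where
  "onf ds f A = tensor ((map 1\<^sub>m ds)[f := A])"

lemma on_factor_onf: "on_factor Ms f A = onf (map fst Ms) f A"
  by (simp add: on_factor_def onf_def comp_def)

text \<open>The matrix carries the content of slot \<open>f\<close> to slot
  \<open>\<sigma> f\<close>. With this direction, composition of permutations goes to the product of
  matrices in the same order.\<close>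

definition perm_mat :: "nat list \<Rightarrow> (nat \<Rightarrow> nat) \<Rightarrow> complex mat" where
  "perm_mat ds \<sigma> = mat (prod_list ds) (prod_list ds)
     (\<lambda>(i, j). if \<forall>f<length ds. dec ds i ! \<sigma> f = dec ds j ! f then 1 else 0)"

definition perm_ok :: "nat list \<Rightarrow> (nat \<Rightarrow> nat) \<Rightarrow> bool" where
  "perm_ok ds \<sigma> \<longleftrightarrow> bij_betw \<sigma> {..<length ds} {..<length ds} \<and> (\<forall>f<length ds. ds ! \<sigma> f = ds ! f)"

context fixes ds :: "nat list"
begin

abbreviation "tdim \<equiv> prod_list ds"

lemma sq_onf: "f < length ds \<Longrightarrow> A \<in> carrier_mat (ds ! f) (ds ! f) \<Longrightarrow> sq ds ((map 1\<^sub>m ds)[f := A])"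
  by (rule sqI) (auto simp: nth_list_update)

lemma onf_carrier:
  "f < length ds \<Longrightarrow> A \<in> carrier_mat (ds ! f) (ds ! f) \<Longrightarrow> onf ds f A \<in> carrier_mat (tdim) (tdim)"
  unfolding onf_def by (rule tensor_carrier[OF sq_onf])

lemma onf_entry:
  assumes "f < length ds" "A \<in> carrier_mat (ds ! f) (ds ! f)" and ij: "i < tdim" "j < tdim"
  shows "onf ds f A $$ (i, j) = A $$ (dec ds i ! f, dec ds j ! f) *
    (if \<forall>g<length ds. g \<noteq> f \<longrightarrow> dec ds i ! g = dec ds j ! g then 1 else 0)"
proof -
  have "onf ds f A $$ (i, j) = (\<Prod>g<length ds. (map 1\<^sub>m ds)[f := A] ! g $$ (dec ds i ! g, dec ds j ! g))"
    unfolding onf_def by (rule tensor_entry[OF sq_onf]) (use assms in auto)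
  also have "\<dots> = A $$ (dec ds i ! f, dec ds j ! f) *
      (\<Prod>g\<in>{..<length ds} - {f}. (map 1\<^sub>m ds)[f := A] ! g $$ (dec ds i ! g, dec ds j ! g))"
    using assms by (subst prod.remove[of _ f]) auto
  also have "(\<Prod>g\<in>{..<length ds} - {f}. (map 1\<^sub>m ds)[f := A] ! g $$ (dec ds i ! g, dec ds j ! g)) =
      (\<Prod>g\<in>{..<length ds} - {f}. if dec ds i ! g = dec ds j ! g then 1 else 0)"
    using dec_less[OF ij(1)] dec_less[OF ij(2)] by (intro prod.cong) auto
  also have "\<dots> = (if \<forall>g<length ds. g \<noteq> f \<longrightarrow> dec ds i ! g = dec ds j ! g then 1 else 0)"
    by (auto intro!: prod.neutral prod_zero)
  finally show ?thesis .
qed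

lemma onf_add:
  assumes "f < length ds" "A \<in> carrier_mat (ds ! f) (ds ! f)" "B \<in> carrier_mat (ds ! f) (ds ! f)"
  shows "onf ds f (A + B) = onf ds f A + onf ds f B"
  using onf_carrier[OF assms(1,2)] onf_carrier[OF assms(1,3)] assms
    onf_carrier[OF assms(1) add_carrier_mat[OF assms(3)], of A] dec_less[of _ ds]
  by (intro eq_matI) (auto simp: onf_entry algebra_simps)

lemma onf_smult:
  assumes "f < length ds" "A \<in> carrier_mat (ds ! f) (ds ! f)"
  shows "onf ds f (c \<cdot>\<^sub>m A) = c \<cdot>\<^sub>m onf ds f A"
  using onf_carrier[OF assms] assms
    onf_carrier[OF assms(1) smult_carrier_mat[OF assms(2)], of c] dec_less[of _ ds]
  by (intro eq_matI) (auto simp: onf_entry algebra_simps)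

lemma onf_one: assumes f: "f < length ds" shows "onf ds f (1\<^sub>m (ds ! f)) = 1\<^sub>m (tdim)"
proof (rule eq_matI)
  fix i j assume "i < dim_row (1\<^sub>m (tdim) :: complex mat)" "j < dim_col (1\<^sub>m (tdim) :: complex mat)"
  then have ij: "i < tdim" "j < tdim" by auto
  have "onf ds f (1\<^sub>m (ds ! f)) $$ (i, j) = (if \<forall>g<length ds. dec ds i ! g = dec ds j ! g then 1 else 0)"
    using f ij dec_less[OF ij(1) f] dec_less[OF ij(2) f] by (simp add: onf_entry) metis
  then show "onf ds f (1\<^sub>m (ds ! f)) $$ (i, j) = 1\<^sub>m (tdim) $$ (i, j)"
    using ij dec_eq_iff[OF ij] by simp
qed (use onf_carrier[OF f, of "1\<^sub>m (ds ! f)"] in auto)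

lemma onf_mult:
  assumes "f < length ds" "A \<in> carrier_mat (ds ! f) (ds ! f)" "B \<in> carrier_mat (ds ! f) (ds ! f)"
  shows "onf ds f A * onf ds f B = onf ds f (A * B)"
  unfolding onf_def tensor_mult[OF sq_onf[OF assms(1,2)] sq_onf[OF assms(1,3)]]
  by (rule arg_cong[of _ _ tensor], rule nth_equalityI) (use assms in \<open>auto simp: nth_list_update\<close>)

lemma onf_mult_other:
  assumes "f < length ds" "A \<in> carrier_mat (ds ! f) (ds ! f)" "g < length ds" "B \<in> carrier_mat (ds ! g) (ds ! g)" "f \<noteq> g"
  shows "onf ds f A * onf ds g B = tensor ((map 1\<^sub>m ds)[f := A, g := B])"
  unfolding onf_def tensor_mult[OF sq_onf[OF assms(1,2)] sq_onf[OF assms(3,4)]]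
  by (rule arg_cong[of _ _ tensor], rule nth_equalityI) (use assms in \<open>auto simp: nth_list_update\<close>)

lemma onf_comm:
  assumes "f < length ds" "A \<in> carrier_mat (ds ! f) (ds ! f)" "g < length ds" "B \<in> carrier_mat (ds ! g) (ds ! g)" "f \<noteq> g"
  shows "onf ds f A * onf ds g B = onf ds g B * onf ds f A"
  using onf_mult_other[OF assms] onf_mult_other[of g B f A] assms by (simp add: list_update_swap)

lemma perm_mat_carrier: "perm_mat ds \<sigma> \<in> carrier_mat (tdim) (tdim)"
  by (simp add: perm_mat_def)

lemma perm_ok_less: "perm_ok ds \<sigma> \<Longrightarrow> f < length ds \<Longrightarrow> \<sigma> f < length ds"
  by (auto simp: perm_ok_def dest: bij_betwE)

lemma dec_perm_right:
  assumes "perm_ok ds \<sigma>" "i < tdim"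
  obtains l where "l < tdim" "\<And>f. f < length ds \<Longrightarrow> dec ds l ! f = dec ds i ! \<sigma> f"
proof -
  have "\<exists>l<tdim. dec ds l = map (\<lambda>f. dec ds i ! \<sigma> f) [0..<length ds]"
    using assms(1) dec_less[OF assms(2) perm_ok_less[OF assms(1)]]
    by (intro dec_surj) (auto simp: perm_ok_def)
  then show ?thesis by (auto intro: that)
qed


lemma dec_perm_left:
  assumes "perm_ok ds \<sigma>" "i < tdim"
  obtains l where "l < tdim" "\<And>f. f < length ds \<Longrightarrow> dec ds l ! \<sigma> f = dec ds i ! f"
proof -
  define \<tau> where "\<tau> = inv_into {..<length ds} \<sigma>"
  have bij: "bij_betw \<sigma> {..<length ds} {..<length ds}" using assms(1) by (simp add: perm_ok_def)
  have r: "\<sigma> (\<tau> f) = f" "\<tau> f < length ds" if "f < length ds" for f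
    using bij_betw_inv_into_right[OF bij] bij_betw_inv_into[OF bij] that
    by (auto simp: \<tau>_def dest: bij_betwE)
  have l: "\<tau> (\<sigma> f) = f" if "f < length ds" for f
    using bij_betw_inv_into_left[OF bij] that by (auto simp: \<tau>_def)
  have "perm_ok ds \<tau>" unfolding perm_ok_def
    using bij_betw_inv_into[OF bij] assms(1) r unfolding \<tau>_def perm_ok_def by metis
  from dec_perm_right[OF this assms(2)] obtain m where
    m: "m < tdim" "\<And>f. f < length ds \<Longrightarrow> dec ds m ! f = dec ds i ! \<tau> f" by blast
  show ?thesis by (rule that[OF m(1)]) (use m(2) perm_ok_less[OF assms(1)] l in auto)
qed

lemma perm_mat_mult_left:
  assumes "perm_ok ds \<sigma>" and A: "A \<in> carrier_mat (tdim) (tdim)"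
    and i: "i < tdim" and j: "j < tdim"
    and l: "l < tdim" "\<And>f. f < length ds \<Longrightarrow> dec ds l ! f = dec ds i ! \<sigma> f"
  shows "(perm_mat ds \<sigma> * A) $$ (i, j) = A $$ (l, j)"
proof -
  have "(perm_mat ds \<sigma> * A) $$ (i, j) = (\<Sum>m<tdim. if m = l then A $$ (m, j) else 0)"
    unfolding mult_mat_entry[OF perm_mat_carrier A i j]
  proof (intro sum.cong refl)
    fix m assume "m \<in> {..<tdim}"
    then have m: "m < tdim" by simp
    have "perm_mat ds \<sigma> $$ (i, m) = (if m = l then 1 else 0)"
      using i m l(2) dec_eq_iff[OF l(1) m] by (auto simp: perm_mat_def)
    then show "perm_mat ds \<sigma> $$ (i, m) * A $$ (m, j) = (if m = l then A $$ (m, j) else 0)" by simp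
  qed
  then show ?thesis using l(1) by simp
qed

text \<open>Column \<open>j\<close> of the permutation matrix has its only 1 in row
  \<open>l\<close>; surjectivity of \<open>\<sigma>\<close> turns the condition on the digits at
  \<open>\<sigma> f\<close> into one on all digits.\<close>

lemma perm_mat_mult_right:
  assumes "perm_ok ds \<sigma>" and A: "A \<in> carrier_mat (tdim) (tdim)"
    and i: "i < tdim" and j: "j < tdim"
    and l: "l < tdim" "\<And>f. f < length ds \<Longrightarrow> dec ds l ! \<sigma> f = dec ds j ! f"
  shows "(A * perm_mat ds \<sigma>) $$ (i, j) = A $$ (i, l)"
proof -
  have surj: "\<exists>f'<length ds. \<sigma> f' = f" if "f < length ds" for f
    using assms(1) that unfolding perm_ok_def bij_betw_def by (metis imageE lessThan_iff)
  have "(A * perm_mat ds \<sigma>) $$ (i, j) = (\<Sum>m<tdim. if m = l then A $$ (i, m) else 0)"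
    unfolding mult_mat_entry[OF A perm_mat_carrier i j]
  proof (intro sum.cong refl)
    fix m assume "m \<in> {..<tdim}"
    then have m: "m < tdim" by simp
    have "(\<forall>f<length ds. dec ds m ! \<sigma> f = dec ds j ! f) \<longleftrightarrow> m = l"
    proof
      assume *: "\<forall>f<length ds. dec ds m ! \<sigma> f = dec ds j ! f"
      have "dec ds m ! f = dec ds l ! f" if "f < length ds" for f
        using surj[OF that] * l(2) by metis
      then show "m = l" using dec_eq_iff[OF m l(1)] by blast
    qed (use l in auto)
    then have "perm_mat ds \<sigma> $$ (m, j) = (if m = l then 1 else 0)"
      using j m by (simp add: perm_mat_def)
    then show "A $$ (i, m) * perm_mat ds \<sigma> $$ (m, j) = (if m = l then A $$ (i, m) else 0)" by simp
  qed
  then show ?thesis using l(1) by simp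
qed

lemma perm_mat_id: "perm_mat ds id = 1\<^sub>m (tdim)"
  by (rule eq_matI) (auto simp: perm_mat_def dec_eq_iff)

lemma perm_mat_comp:
  assumes "perm_ok ds \<sigma>" "perm_ok ds \<tau>"
  shows "perm_mat ds \<sigma> * perm_mat ds \<tau> = perm_mat ds (\<sigma> \<circ> \<tau>)"
proof (rule eq_matI)
  fix i j assume "i < dim_row (perm_mat ds (\<sigma> \<circ> \<tau>))" "j < dim_col (perm_mat ds (\<sigma> \<circ> \<tau>))"
  then have ij: "i < tdim" "j < tdim" by (auto simp: perm_mat_def)
  obtain l where l: "l < tdim" "\<And>f. f < length ds \<Longrightarrow> dec ds l ! f = dec ds i ! \<sigma> f"
    using dec_perm_right[OF assms(1) ij(1)] by blast
  have "(perm_mat ds \<sigma> * perm_mat ds \<tau>) $$ (i, j) = perm_mat ds \<tau> $$ (l, j)"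
    by (rule perm_mat_mult_left[OF assms(1) perm_mat_carrier ij l])
  also have "\<dots> = perm_mat ds (\<sigma> \<circ> \<tau>) $$ (i, j)"
    using ij l perm_ok_less[OF assms(2)] by (simp add: perm_mat_def)
  finally show "(perm_mat ds \<sigma> * perm_mat ds \<tau>) $$ (i, j) = perm_mat ds (\<sigma> \<circ> \<tau>) $$ (i, j)" .
qed (auto simp: perm_mat_def)

lemma perm_tensor:
  assumes "perm_ok ds \<sigma>" and As: "sq ds As" and Bs: "sq ds Bs"
    and AB: "\<And>f. f < length ds \<Longrightarrow> Bs ! \<sigma> f = As ! f"
  shows "perm_mat ds \<sigma> * tensor As = tensor Bs * perm_mat ds \<sigma>"
proof (rule eq_matI)
  fix i j assume "i < dim_row (tensor Bs * perm_mat ds \<sigma>)" "j < dim_col (tensor Bs * perm_mat ds \<sigma>)"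
  then have ij: "i < tdim" "j < tdim" using tensor_carrier[OF Bs] by (auto simp: perm_mat_def)
  obtain l where l: "l < tdim" "\<And>f. f < length ds \<Longrightarrow> dec ds l ! f = dec ds i ! \<sigma> f"
    using dec_perm_right[OF assms(1) ij(1)] by blast
  obtain m where m: "m < tdim" "\<And>f. f < length ds \<Longrightarrow> dec ds m ! \<sigma> f = dec ds j ! f"
    using dec_perm_left[OF assms(1) ij(2)] by blast
  have "tensor Bs $$ (i, m) = (\<Prod>f<length ds. Bs ! f $$ (dec ds i ! f, dec ds m ! f))"
    by (rule tensor_entry[OF Bs ij(1) m(1)])
  \<comment> \<open>Reindexing the product over the slots by \<open>\<sigma>\<close> matches the
    entry for \<open>Bs\<close> with that for \<open>As\<close>.\<close>
  also have "\<dots> = (\<Prod>f<length ds. Bs ! \<sigma> f $$ (dec ds i ! \<sigma> f, dec ds m ! \<sigma> f))"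
    using assms(1) unfolding perm_ok_def by (intro prod.reindex_bij_betw[symmetric]) auto
  also have "\<dots> = tensor As $$ (l, j)"
    unfolding tensor_entry[OF As l(1) ij(2)] by (intro prod.cong) (auto simp: l m AB)
  finally show "(perm_mat ds \<sigma> * tensor As) $$ (i, j) = (tensor Bs * perm_mat ds \<sigma>) $$ (i, j)"
    using perm_mat_mult_left[OF assms(1) tensor_carrier[OF As] ij l]
      perm_mat_mult_right[OF assms(1) tensor_carrier[OF Bs] ij m] by metis
qed (use tensor_carrier[OF As] tensor_carrier[OF Bs] in \<open>auto simp: perm_mat_def\<close>)

lemma perm_onf:
  assumes ok: "perm_ok ds \<sigma>" and f: "f < length ds" and A: "A \<in> carrier_mat (ds ! f) (ds ! f)"
  shows "perm_mat ds \<sigma> * onf ds f A = onf ds (\<sigma> f) A * perm_mat ds \<sigma>"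
  unfolding onf_def
proof (rule perm_tensor[OF ok sq_onf[OF f A] sq_onf])
  show "\<sigma> f < length ds" "A \<in> carrier_mat (ds ! \<sigma> f) (ds ! \<sigma> f)"
    using ok f A perm_ok_less by (auto simp: perm_ok_def)
  fix g assume g: "g < length ds"
  have "\<sigma> g = \<sigma> f \<longleftrightarrow> g = f" using ok f g by (auto simp: perm_ok_def bij_betw_def inj_on_def)
  then show "(map 1\<^sub>m ds)[\<sigma> f := A] ! \<sigma> g = (map 1\<^sub>m ds)[f := A] ! g"
    using ok f g perm_ok_less[OF ok] by (auto simp: nth_list_update perm_ok_def)
qed

end

definition Eu :: "nat \<Rightarrow> nat \<Rightarrow> nat \<Rightarrow> complex mat" where
  "Eu n a b = mat n n (\<lambda>(i, j). if i = a \<and> j = b then 1 else 0)"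

lemma Eu_carrier [simp]: "Eu n a b \<in> carrier_mat n n" "dim_row (Eu n a b) = n" "dim_col (Eu n a b) = n"
  by (auto simp: Eu_def)

text \<open>An entrywise identity suffices, so that no carrier-based sum of matrices has to be
  formed.\<close>

lemma emb_sum_entries:
  assumes "0 < d" "A \<in> carrier_mat d d" "\<And>s. s \<in> S \<Longrightarrow> F s \<in> carrier_mat d d"
    and "\<And>i j. i < d \<Longrightarrow> j < d \<Longrightarrow> A $$ (i, j) = (\<Sum>s\<in>S. F s $$ (i, j))"
  shows "emb d A = (\<Sum>s\<in>S. emb d (F s))"
proof (rule endo_eqI)
  fix v i
  have "emb_fun d A v i = (\<Sum>j<d. (\<Sum>s\<in>S. F s $$ (i mod d, j)) * v (i div d * d + j))"
    unfolding emb_fun_def using assms by (intro sum.cong) auto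
  also have "\<dots> = (\<Sum>s\<in>S. emb_fun d (F s) v i)"
    unfolding emb_fun_def sum_distrib_right by (rule sum.swap)
  finally show "Rep_endo (emb d A) v i = Rep_endo (\<Sum>s\<in>S. emb d (F s)) v i"
    by (simp add: Rep_sum emb.rep_eq)
qed

text \<open>The flip of two equal factors is the sum of all \<open>E_ab \<otimes> E_ba\<close>, that
  is, \<gamma> of the trace form; this identifies transpositions with Casimir terms.\<close>

lemma perm_transpose:
  assumes D: "0 < prod_list ds" and f: "f < length ds" "ds ! f = n" and g: "g < length ds" "ds ! g = n" and fg: "f \<noteq> g"
  shows "emb (prod_list ds) (perm_mat ds (transpose f g)) =
    (\<Sum>a<n. \<Sum>b<n. emb (prod_list ds) (onf ds f (Eu n a b)) * emb (prod_list ds) (onf ds g (Eu n b a)))"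
proof -
  define F where "F s = (map 1\<^sub>m ds)[f := Eu n (fst s) (snd s), g := Eu n (snd s) (fst s)]" for s
  have sqF: "sq ds (F s)" for s
    unfolding F_def by (rule sqI) (use f g in \<open>auto simp: nth_list_update\<close>)
  have "emb (prod_list ds) (perm_mat ds (transpose f g)) =
      (\<Sum>s\<in>{..<n} \<times> {..<n}. emb (prod_list ds) (tensor (F s)))"
  proof (rule emb_sum_entries[OF D perm_mat_carrier tensor_carrier[OF sqF]])
    fix i j assume ij: "i < prod_list ds" "j < prod_list ds"
    let ?I = "\<lambda>f. dec ds i ! f" and ?J = "\<lambda>f. dec ds j ! f"
    let ?b = "\<forall>h<length ds. h \<noteq> f \<and> h \<noteq> g \<longrightarrow> ?I h = ?J h"
    have b: "?I f < n" "?I g < n" "?J f < n" "?J g < n" using dec_less[of _ ds] ij f g by metis+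
    \<comment> \<open>Only one pair \<open>(a, b)\<close> contributes, the one read off from the row
      digits at \<open>f\<close> and \<open>g\<close>.\<close>
    have "tensor (F s) $$ (i, j) = (if s = (?I f, ?I g) then if ?b \<and> ?J f = ?I g \<and> ?J g = ?I f then 1 else 0 else 0)"
      for s
    proof -
      have "tensor (F s) $$ (i, j) = (\<Prod>h<length ds. F s ! h $$ (?I h, ?J h))"
        by (rule tensor_entry[OF sqF ij])
      also have "\<dots> = F s ! f $$ (?I f, ?J f) * (F s ! g $$ (?I g, ?J g) *
          (\<Prod>h\<in>{..<length ds} - {f} - {g}. F s ! h $$ (?I h, ?J h)))"
        using f g fg by (subst prod.remove[of _ f], simp, simp, subst prod.remove[of _ g]) auto
      also have "(\<Prod>h\<in>{..<length ds} - {f} - {g}. F s ! h $$ (?I h, ?J h)) =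
          (\<Prod>h\<in>{..<length ds} - {f} - {g}. if ?I h = ?J h then 1 else 0)"
        using dec_less[OF ij(1)] dec_less[OF ij(2)] by (intro prod.cong) (auto simp: F_def)
      also have "\<dots> = (if ?b then 1 else 0)" by (auto intro!: prod.neutral prod_zero)
      finally show ?thesis using f g fg b by (cases s) (auto simp: F_def Eu_def)
    qed
    moreover have "(\<forall>h<length ds. dec ds i ! transpose f g h = ?J h) \<longleftrightarrow> ?b \<and> ?J f = ?I g \<and> ?J g = ?I f"
      using f g fg by (auto simp: transpose_def)
    ultimately show "perm_mat ds (transpose f g) $$ (i, j) = (\<Sum>s\<in>{..<n} \<times> {..<n}. tensor (F s) $$ (i, j))"
      using ij b by (simp add: perm_mat_def)
  qed
  also have "\<dots> = (\<Sum>s\<in>{..<n} \<times> {..<n}. emb (prod_list ds) (onf ds f (Eu n (fst s) (snd s))) *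
      emb (prod_list ds) (onf ds g (Eu n (snd s) (fst s))))"
  proof (intro sum.cong refl)
    fix s :: "nat \<times> nat"
    have "onf ds f (Eu n (fst s) (snd s)) * onf ds g (Eu n (snd s) (fst s)) = tensor (F s)"
      unfolding F_def by (rule onf_mult_other) (use f g fg in auto)
    then show "emb (prod_list ds) (tensor (F s)) = emb (prod_list ds) (onf ds f (Eu n (fst s) (snd s))) *
      emb (prod_list ds) (onf ds g (Eu n (snd s) (fst s)))"
      using emb_mult[OF D onf_carrier[OF f(1)] onf_carrier[OF g(1)], of "Eu n (fst s) (snd s)" "Eu n (snd s) (fst s)"]
        f g by simp
  qed
  finally show ?thesis by (simp add: sum.cartesian_product case_prod_unfold)
qed

section \<open>Families of elements satisfying the relations of matrix units\<close>

abbreviation cm :: "endo \<Rightarrow> endo \<Rightarrow> bool" where "cm X Y \<equiv> X * Y = Y * X"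

lemma cm_sym: "cm X Y \<Longrightarrow> cm Y X" by simp

lemma cm_mult: assumes "cm X Y" "cm X Z" shows "cm X (Y * Z)"
proof -
  have "X * (Y * Z) = Y * (X * Z)" unfolding mult.assoc[symmetric] assms(1) ..
  then show ?thesis unfolding assms(2) by (simp add: mult.assoc)
qed

lemma cm_add: "cm X Y \<Longrightarrow> cm X Z \<Longrightarrow> cm X (Y + Z)"
  by (simp add: algebra_simps)

lemma cm_diff: "cm X Y \<Longrightarrow> cm X Z \<Longrightarrow> cm X (Y - Z)"
  by (simp add: algebra_simps)

lemma cm_sum: "(\<And>i. i \<in> A \<Longrightarrow> cm X (f i)) \<Longrightarrow> cm X (sum f A)"
  by (simp add: sum_distrib_left sum_distrib_right)

lemma cm_sc: "cm X (sc c)" by (rule sc_comm)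

text \<open>\<open>D\<close> acts by commutators on the family \<open>e\<close> as \<open>gl\<^sub>n\<close> acts on the matrix units; \<open>cg n e e'\<close> is the
  element \<open>\<gamma>\<close> of the trace form of \<open>gl\<^sub>n\<close>, with the two tensor factors acting by \<open>e\<close> and \<open>e'\<close>.\<close>

definition adj :: "nat \<Rightarrow> (nat \<Rightarrow> nat \<Rightarrow> endo) \<Rightarrow> (nat \<Rightarrow> nat \<Rightarrow> endo) \<Rightarrow> bool" where
  "adj n D e \<longleftrightarrow> (\<forall>s<n. \<forall>t<n. \<forall>i<n. \<forall>j<n.
     D s t * e i j - e i j * D s t = (if t = i then e s j else 0) - (if s = j then e i t else 0))"

lemma adjD: "adj n D e \<Longrightarrow> s < n \<Longrightarrow> t < n \<Longrightarrow> i < n \<Longrightarrow> j < n \<Longrightarrow>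
    D s t * e i j = e i j * D s t + ((if t = i then e s j else 0) - (if s = j then e i t else 0))"
  unfolding adj_def by (simp add: algebra_simps)

definition cg :: "nat \<Rightarrow> (nat \<Rightarrow> nat \<Rightarrow> endo) \<Rightarrow> (nat \<Rightarrow> nat \<Rightarrow> endo) \<Rightarrow> endo" where
  "cg n e e' = (\<Sum>i<n. \<Sum>j<n. e i j * e' j i)"

lemma sum_if_mult:
  fixes f :: "nat \<Rightarrow> endo"
  assumes "t < n"
  shows "(\<Sum>i<n. (if t = i then f i else 0) * g i) = f t * g t" "(\<Sum>i<n. g i * (if t = i then f i else 0)) = g t * f t"
    "(\<Sum>i<n. (if i = t then f i else 0) * g i) = f t * g t" "(\<Sum>i<n. g i * (if i = t then f i else 0)) = g t * f t"
proof -
  have "(\<Sum>i<n. (if t = i then f i else 0) * g i) = (\<Sum>i<n. if t = i then f i * g i else 0)"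
    by (intro sum.cong) auto
  then show 1: "(\<Sum>i<n. (if t = i then f i else 0) * g i) = f t * g t" using assms by simp
  have "(\<Sum>i<n. g i * (if t = i then f i else 0)) = (\<Sum>i<n. if t = i then g i * f i else 0)"
    by (intro sum.cong) auto
  then show 2: "(\<Sum>i<n. g i * (if t = i then f i else 0)) = g t * f t" using assms by simp
  show "(\<Sum>i<n. (if i = t then f i else 0) * g i) = f t * g t" using 1 unfolding eq_commute[of t] .
  show "(\<Sum>i<n. g i * (if i = t then f i else 0)) = g t * f t" using 2 unfolding eq_commute[of t] .
qed

text \<open>The Leibniz rule gives four sums. Once their Kronecker deltas are collapsed, the outer
  two cancel and so do the inner two.\<close>

lemma cg_invariant:
  assumes D: "adj n D e" "adj n D e'" and st: "s < n" "t < n"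
  shows "cm (D s t) (cg n e e')"
proof -
  have "D s t * cg n e e' - cg n e e' * D s t =
      (\<Sum>i<n. \<Sum>j<n. D s t * (e i j * e' j i) - e i j * e' j i * D s t)"
    by (simp add: cg_def sum_distrib_left sum_distrib_right sum_subtractf)
  also have "\<dots> = (\<Sum>i<n. \<Sum>j<n. ((if t = i then e s j else 0) - (if s = j then e i t else 0)) * e' j i
      + e i j * ((if t = j then e' s i else 0) - (if s = i then e' j t else 0)))"
  proof (intro sum.cong refl)
    fix i j assume "i \<in> {..<n}" "j \<in> {..<n}"
    then have ij: "i < n" "j < n" by auto
    have "D s t * (e i j * e' j i) = e i j * (D s t * e' j i) +
        ((if t = i then e s j else 0) - (if s = j then e i t else 0)) * e' j i"
      unfolding mult.assoc[symmetric] adjD[OF D(1) st ij] distrib_right ..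
    then show "D s t * (e i j * e' j i) - e i j * e' j i * D s t =
        ((if t = i then e s j else 0) - (if s = j then e i t else 0)) * e' j i
        + e i j * ((if t = j then e' s i else 0) - (if s = i then e' j t else 0))"
      unfolding adjD[OF D(2) st ij(2,1)] by (simp add: algebra_simps)
  qed
  also have "\<dots> = (\<Sum>j<n. \<Sum>i<n. (if t = i then e s j else 0) * e' j i) - (\<Sum>i<n. \<Sum>j<n. (if s = j then e i t else 0) * e' j i)
      + (\<Sum>i<n. \<Sum>j<n. e i j * (if t = j then e' s i else 0)) - (\<Sum>j<n. \<Sum>i<n. e i j * (if s = i then e' j t else 0))"
    unfolding left_diff_distrib right_diff_distrib sum.distrib sum_subtractf
    by (subst (3 6) sum.swap) (simp add: algebra_simps)
  also have "\<dots> = 0"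
    using st by (simp add: sum_if_mult)
  finally show ?thesis by simp
qed

lemma cm_cg: "(\<And>i j. i < n \<Longrightarrow> j < n \<Longrightarrow> cm X (e i j)) \<Longrightarrow> (\<And>i j. i < n \<Longrightarrow> j < n \<Longrightarrow> cm X (e' i j)) \<Longrightarrow>
    cm X (cg n e e')"
  unfolding cg_def by (intro cm_sum cm_mult) auto

lemma cg_sum_left: "cg n (\<lambda>i j. \<Sum>f\<in>F. e f i j) e' = (\<Sum>f\<in>F. cg n (e f) e')"
  unfolding cg_def sum_distrib_right by (subst sum.swap, rule sum.cong, rule refl, subst sum.swap, rule refl)
    
lemma cg_add_left: "cg n (\<lambda>i j. e i j + d i j) e' = cg n e e' + cg n d e'"
  by (simp add: cg_def distrib_right sum.distrib)

lemma cg_add_right: "cg n e' (\<lambda>i j. e i j + d i j) = cg n e' e + cg n e' d"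
  by (simp add: cg_def distrib_left sum.distrib)

lemma cg_flip: assumes "\<And>i j k l. i < n \<Longrightarrow> j < n \<Longrightarrow> k < n \<Longrightarrow> l < n \<Longrightarrow> cm (e i j) (e' k l)"
  shows "cg n e e' = cg n e' e"
proof -
  have "cg n e e' = (\<Sum>i<n. \<Sum>j<n. e' j i * e i j)"
    unfolding cg_def using assms by (intro sum.cong refl) auto
  then show ?thesis unfolding cg_def by (subst (asm) sum.swap)
qed

text \<open>\<open>adj n X X\<close> is the list of commutation relations of gl_n, so the locale
  describes \<open>m\<close> mutually commuting actions of gl_n, one for each tensor factor.\<close>

locale gl_family =
  fixes n m :: nat and e :: "nat \<Rightarrow> nat \<Rightarrow> nat \<Rightarrow> endo"
  assumes rel: "f < m \<Longrightarrow> adj n (e f) (e f)"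
    and comm: "f < m \<Longrightarrow> g < m \<Longrightarrow> f \<noteq> g \<Longrightarrow> i < n \<Longrightarrow> j < n \<Longrightarrow> k < n \<Longrightarrow> l < n \<Longrightarrow> cm (e f i j) (e g k l)"
begin

text \<open>The action of gl_n on the tensor product of the factors in \<open>F\<close>.\<close>

definition De :: "nat set \<Rightarrow> nat \<Rightarrow> nat \<Rightarrow> endo" where
  "De F i j = (\<Sum>f\<in>F. e f i j)"

abbreviation Ga :: "nat set \<Rightarrow> nat \<Rightarrow> endo" where
  "Ga F g \<equiv> cg n (De F) (e g)"

lemma Ga_sum: "Ga F g = (\<Sum>f\<in>F. cg n (e f) (e g))"
  unfolding De_def by (rule cg_sum_left)

lemma De_comm:
  assumes "F \<subseteq> {..<m}" "f < m" "f \<notin> F" "i < n" "j < n" "k < n" "l < n"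
  shows "cm (e f i j) (De F k l)"
  unfolding De_def by (rule cm_sum) (use assms in \<open>auto intro!: comm\<close>)

text \<open>All summands of \<open>De F\<close> other than the one for \<open>f\<close> commute with
  \<open>e f\<close>, so only the relations of gl_n on that factor remain.\<close>

lemma De_adj: assumes F: "F \<subseteq> {..<m}" and f: "f \<in> F" shows "adj n (De F) (e f)"
  unfolding adj_def
proof (intro allI impI)
  fix s t i j assume l: "s < n" "t < n" "i < n" "j < n"
  have fin: "finite F" using F finite_subset by blast
  have 1: "De F s t = e f s t + De (F - {f}) s t"
    unfolding De_def using fin f by (rule sum.remove)
  have 2: "cm (e f i j) (De (F - {f}) s t)"
    by (rule De_comm) (use F f l in auto)
  show "De F s t * e f i j - e f i j * De F s t = (if t = i then e f s j else 0) - (if s = j then e f i t else 0)"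
  proof -
    have "De F s t * e f i j - e f i j * De F s t = e f s t * e f i j - e f i j * e f s t"
      unfolding 1 distrib_left distrib_right 2 by simp
    also have "\<dots> = (if t = i then e f s j else 0) - (if s = j then e f i t else 0)"
      using rel[of f] F f l by (auto simp only: adj_def subset_iff lessThan_iff)
    finally show ?thesis .
  qed
qed

text \<open>If \<open>F\<close> contains both factors, this is the invariance of \<gamma>; if it
  contains neither, the operators act on disjoint factors.\<close>

lemma cg_De_comm:
  assumes F: "F \<subseteq> {..<m}" and fg: "f < m" "g < m" "f \<in> F \<longleftrightarrow> g \<in> F" and st: "s < n" "t < n"
  shows "cm (cg n (e f) (e g)) (De F s t)"
proof (cases "f \<in> F")
  case True
  then show ?thesis using cg_invariant[OF De_adj[OF F True] De_adj[OF F, where f = g] st] fg by simp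
next
  case False
  show ?thesis by (rule cm_sym[OF cm_cg]; rule cm_sym[OF De_comm]) (use False F fg st in auto)
qed

lemma cg_e_comm:
  assumes "f < m" "g < m" "h < m" "h = f \<longleftrightarrow> h = g" "s < n" "t < n"
  shows "cm (cg n (e f) (e g)) (e h s t)"
  using cg_De_comm[where F = "{h}" and f = f and g = g and s = s and t = t] assms by (auto simp: De_def)

text \<open>For \<open>F = {f, g}\<close> this is the infinitesimal pure braid relation
  \<open>[\<gamma>_fg, \<gamma>_fh + \<gamma>_gh] = 0\<close>.\<close>

lemma cg_Ga_comm:
  assumes "F \<subseteq> {..<m}" "f \<in> F" "g \<in> F" "h < m" "h \<notin> F"
  shows "cm (cg n (e f) (e g)) (Ga F h)"
  by (rule cm_cg; (rule cg_De_comm | rule cg_e_comm)) (use assms in auto)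

text \<open>The mechanism of Jucys-Murphy elements: every term of the shorter one acts on factors
  over which the longer one is summed, and commutes with it by invariance.\<close>

lemma Ga_Ga_comm:
  assumes "F' \<subseteq> {..<m}" "F \<subseteq> F'" "g \<in> F'" "h < m" "h \<notin> F'"
  shows "cm (Ga F g) (Ga F' h)"
  unfolding Ga_sum[of F] by (rule cm_sym, rule cm_sum, rule cm_sym, rule cg_Ga_comm) (use assms in auto)

lemma Ga_De_comm:
  assumes "F' \<subseteq> {..<m}" "F \<subseteq> F'" "g \<in> F'" "s < n" "t < n"
  shows "cm (Ga F g) (De F' s t)"
  unfolding Ga_sum[of F] by (rule cm_sym, rule cm_sum, rule cm_sym, rule cg_De_comm) (use assms in auto)

lemma De_insert: "finite F \<Longrightarrow> g \<notin> F \<Longrightarrow> De (insert g F) i j = De F i j + e g i j"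
  by (simp add: De_def add.commute)

text \<open>Expansion of the Casimir element as a square; the two mixed terms agree by
  \<open>cg_flip\<close>. Their doubling is kept as a sum, the shape that
  \<open>endo_double_zero\<close> handles.\<close>

lemma cas_insert:
  assumes "F \<subseteq> {..<m}" "g < m" "g \<notin> F"
  shows "cg n (De (insert g F)) (De (insert g F)) = cg n (De F) (De F) + (Ga F g + Ga F g) + cg n (e g) (e g)"
proof -
  have "finite F" using assms(1) finite_subset by blast
  then have "De (insert g F) = (\<lambda>i j. De F i j + e g i j)" using assms(3) De_insert by (intro ext) auto
  moreover have "cg n (e g) (De F) = Ga F g"
    by (rule cg_flip) (rule De_comm, use assms in auto)
  ultimately show ?thesis by (simp add: cg_add_left cg_add_right)
qed

lemma cas_sum:
  assumes "i < m"
  shows "cg n (De {0..i}) (De {0..i}) =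
    (\<Sum>l<i. Ga {0..l} (Suc l)) + (\<Sum>l<i. Ga {0..l} (Suc l)) + (\<Sum>f\<le>i. cg n (e f) (e f))"
  using assms
proof (induction i)
  case 0
  have "De {0..0} = e 0" by (intro ext) (simp add: De_def)
  then show ?case by (simp add: cg_def)
next
  case (Suc i)
  have "{0..Suc i} = insert (Suc i) {0..i}" by auto
  moreover have "cg n (De (insert (Suc i) {0..i})) (De (insert (Suc i) {0..i})) =
      cg n (De {0..i}) (De {0..i}) + (Ga {0..i} (Suc i) + Ga {0..i} (Suc i)) + cg n (e (Suc i)) (e (Suc i))"
    using Suc.prems by (intro cas_insert) auto
  ultimately show ?case using Suc by (simp add: algebra_simps)
qed

text \<open>Single terms of the chain need not commute with \<gamma> on \<open>f\<close> and
  \<open>g\<close>, but twice the whole chain is a Casimir element minus Casimir elements of single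
  factors, and all of these do.\<close>

lemma chain_sum_comm:
  assumes i: "i < m" and fg: "f \<le> i" "g \<le> i"
  shows "cm (\<Sum>l<i. Ga {0..l} (Suc l)) (cg n (e f) (e g))"
proof -
  let ?S = "\<Sum>l<i. Ga {0..l} (Suc l)" and ?C = "\<Sum>f\<le>i. cg n (e f) (e f)" and ?c = "cg n (e f) (e g)"
  have "cm ?c (cg n (De {0..i}) (De {0..i}))"
    by (rule cm_cg; rule cg_De_comm) (use assms in auto)
  then have "cm ?c (?S + ?S + ?C)" unfolding cas_sum[OF i] .
  moreover have "cm ?c ?C"
    by (rule cm_sum, rule cm_sym, rule cm_cg; rule cg_e_comm) (use assms in auto)
  ultimately have "(?S * ?c - ?c * ?S) + (?S * ?c - ?c * ?S) = 0"
    by (simp add: algebra_simps)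
  from endo_double_zero[OF this] show ?thesis by simp
qed

lemma T_cg:
  assumes T: "\<And>f i j. f < m \<Longrightarrow> i < n \<Longrightarrow> j < n \<Longrightarrow> T * e f i j = e (\<sigma> f) i j * T" and "f < m" "g < m"
  shows "T * cg n (e f) (e g) = cg n (e (\<sigma> f)) (e (\<sigma> g)) * T"
  unfolding cg_def sum_distrib_left sum_distrib_right
proof (intro sum.cong refl)
  fix i j assume "i \<in> {..<n}" "j \<in> {..<n}"
  then show "T * (e f i j * e g j i) = e (\<sigma> f) i j * e (\<sigma> g) j i * T"
    using T assms(2,3) by (simp add: mult.assoc[symmetric]) (simp add: mult.assoc)
qed

lemma T_Ga:
  assumes T: "\<And>f i j. f < m \<Longrightarrow> i < n \<Longrightarrow> j < n \<Longrightarrow> T * e f i j = e (\<sigma> f) i j * T"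
    and "F \<subseteq> {..<m}" "g < m" "inj_on \<sigma> F"
  shows "T * Ga F g = Ga (\<sigma> ` F) (\<sigma> g) * T"
proof -
  have "T * Ga F g = (\<Sum>f\<in>F. cg n (e (\<sigma> f)) (e (\<sigma> g))) * T"
    unfolding Ga_sum sum_distrib_left sum_distrib_right
    by (intro sum.cong refl T_cg[OF T]) (use assms in auto)
  then show ?thesis unfolding Ga_sum using assms(4) by (simp add: sum.reindex)
qed

end

section \<open>The quadratic relation\<close>

lemma sc_perm: "sc a * sc b = sc b * sc a" "sc a * (sc b * X) = sc b * (sc a * X)"
  by (rule sc_comm, rule sc_comm_left)

text \<open>The coefficients of \<open>(\<gamma> - a) (\<gamma> + p)\<close> on \<open>M \<otimes> V\<close> with respect to the matrix units of \<open>V\<close>. They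
  transform by the adjoint action, so their common kernel is a submodule of \<open>M\<close>.\<close>

definition char_mat :: "nat \<Rightarrow> complex \<Rightarrow> complex \<Rightarrow> (nat \<Rightarrow> nat \<Rightarrow> endo) \<Rightarrow> nat \<Rightarrow> nat \<Rightarrow> endo" where
  "char_mat n a p e i j = (\<Sum>m<n. e m j * e i m) + sc (p - a) * e i j - (if i = j then sc (a * p) else 0)"

text \<open>In the quadratic term the contributions at the contracted index \<open>m\<close> cancel,
  as in a product of matrices, so only the outer indices transform.\<close>

lemma char_mat_adj: assumes e: "adj n e e" shows "adj n e (char_mat n a p e)"
  unfolding adj_def
proof (intro allI impI)
  fix s t i j assume l: "s < n" "t < n" "i < n" "j < n"
  let ?R = "\<lambda>i j. \<Sum>m<n. e m j * e i m"
  have "e s t * ?R i j - ?R i j * e s t = (\<Sum>m<n. e s t * e m j * e i m - e m j * e i m * e s t)"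
    by (simp add: sum_distrib_left sum_distrib_right sum_subtractf mult.assoc)
  also have "\<dots> = (\<Sum>m<n. ((if t = m then e s j else 0) - (if s = j then e m t else 0)) * e i m
      + e m j * ((if t = i then e s m else 0) - (if s = m then e i t else 0)))"
  proof (intro sum.cong refl)
    fix m assume "m \<in> {..<n}"
    then have m: "m < n" by simp
    have "e s t * e m j * e i m = e m j * (e s t * e i m) +
        ((if t = m then e s j else 0) - (if s = j then e m t else 0)) * e i m"
      unfolding adjD[OF e l(1,2) m l(4)] distrib_right mult.assoc ..
    then show "e s t * e m j * e i m - e m j * e i m * e s t =
        ((if t = m then e s j else 0) - (if s = j then e m t else 0)) * e i m
        + e m j * ((if t = i then e s m else 0) - (if s = m then e i t else 0))"
      unfolding adjD[OF e l(1,2) l(3) m] by (simp add: algebra_simps)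
  qed
  also have "\<dots> = (\<Sum>m<n. (if t = m then e s j else 0) * e i m) - (\<Sum>m<n. (if s = j then e m t else 0) * e i m)
      + (\<Sum>m<n. e m j * (if t = i then e s m else 0)) - (\<Sum>m<n. e m j * (if s = m then e i t else 0))"
    unfolding left_diff_distrib right_diff_distrib sum.distrib sum_subtractf by simp
  also have "\<dots> = e s j * e i t - (if s = j then ?R i t else 0) + (if t = i then ?R s j else 0) - e s j * e i t"
    using l by (simp add: sum_if_mult)
  finally have 1: "e s t * ?R i j - ?R i j * e s t = (if t = i then ?R s j else 0) - (if s = j then ?R i t else 0)"
    by simp
  have 2: "e s t * (sc (p - a) * e i j) - sc (p - a) * e i j * e s t =
      sc (p - a) * ((if t = i then e s j else 0) - (if s = j then e i t else 0))"
    unfolding sc_comm_left adjD[OF e l] distrib_left by (simp add: mult.assoc)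
  have "e s t * char_mat n a p e i j - char_mat n a p e i j * e s t =
      (e s t * ?R i j - ?R i j * e s t) + (e s t * (sc (p - a) * e i j) - sc (p - a) * e i j * e s t)"
    unfolding char_mat_def distrib_left distrib_right left_diff_distrib right_diff_distrib
    by (simp add: sc_comm[of "e s t"])
  then show "e s t * char_mat n a p e i j - char_mat n a p e i j * e s t =
      (if t = i then char_mat n a p e s j else 0) - (if s = j then char_mat n a p e i t else 0)"
    unfolding 1 2 char_mat_def by (auto simp: algebra_simps)
qed

text \<open>\<open>P\<close> stands for the highest weight vector. For \<open>i < p\<close> the
  entries \<open>e i j\<close> act on it as \<open>a\<close> times a row of the identity matrix, and
  \<open>a^2 + (p - a) a - a p = 0\<close>; for \<open>i \<ge> p\<close> the number of indices
  \<open>m < p\<close> brings in \<open>p\<close>.\<close>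

lemma char_mat_highest:
  fixes P :: endo
  assumes e: "adj n e e" and p: "p \<le> n"
    and raise: "\<And>i j. i < j \<Longrightarrow> j < n \<Longrightarrow> e i j * P = 0"
    and wt: "\<And>i. i < n \<Longrightarrow> e i i * P = (if i < p then sc a * P else 0)"
    and lower: "\<And>i j. j < i \<Longrightarrow> i < n \<Longrightarrow> i < p \<or> p \<le> j \<Longrightarrow> e i j * P = 0"
    and ij: "i < n" "j < n"
  shows "char_mat n a (of_nat p) e i j * P = 0"
proof -
  have small: "e i j * P = (if i = j then sc a * P else 0)" if "i < n" "j < n" "i < p" for i j
    using raise[of i j] wt[of i] lower[of j i] that by (cases i j rule: linorder_cases) auto
  have big: "e i j * P = 0" if "i < n" "j < n" "\<not> i < p" "\<not> j < p" for i j
    using raise[of i j] wt[of i] lower[of j i] that by (cases i j rule: linorder_cases) auto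
  have sumP: "char_mat n a (of_nat p) e i j * P = (\<Sum>m<n. e m j * (e i m * P)) + sc (of_nat p - a) * (e i j * P)
      - (if i = j then sc (a * of_nat p) * P else 0)"
    unfolding char_mat_def distrib_right left_diff_distrib sum_distrib_right by (simp add: mult.assoc)
  show ?thesis
  proof (cases "i < p")
    case True
    have "(\<Sum>m<n. e m j * (e i m * P)) = (\<Sum>m<n. if m = i then e i j * (sc a * P) else 0)"
      using small[OF ij(1)] True by (intro sum.cong) auto
    also have "\<dots> = sc a * (e i j * P)" using ij by (simp add: sc_comm_left[of "e i j"])
    finally show ?thesis unfolding sumP small[OF ij True]
      by (simp add: sc_simps algebra_simps sc_perm)
  next
    case False
    have "e m j * (e i m * P) = (if m < p then (if m = j then sc a * (e i m * P) else 0)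
        + (if i = j then sc a * P else 0) - e i j * P else 0)" if m: "m < n" for m
    proof (cases "m < p")
      case True
      \<comment> \<open>Exchanging the factors lets \<open>e m j\<close> with \<open>m < p\<close>
        meet \<open>P\<close> first, where its action is known. Each exchange leaves one
        \<open>- e i j\<close>, and there are \<open>p\<close> of them.\<close>
      have "e m j * (e i m * P) = (e i m * e m j + (if j = i then e m m else 0) - e i j) * P"
        unfolding mult.assoc[symmetric] adjD[OF e m ij(2) ij(1) m] by (simp add: algebra_simps)
      also have "\<dots> = e i m * (e m j * P) + (if j = i then e m m * P else 0) - e i j * P"
        by (simp add: algebra_simps)
      finally show ?thesis
        unfolding small[OF m ij(2) True] small[OF m m True] using True False by (auto simp: sc_comm_left[of "e i m"] sc_comm_left[of "e i j"])
    next
      case m': False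
      then show ?thesis using big[OF ij(1) m False m'] by simp
    qed
    then have "(\<Sum>m<n. e m j * (e i m * P)) = (\<Sum>m<n. if m < p then (if m = j then sc a * (e i m * P) else 0)
        + (if i = j then sc a * P else 0) - e i j * P else 0)"
      by (intro sum.cong) auto
    also have "\<dots> = (\<Sum>m<p. (if m = j then sc a * (e i m * P) else 0)
        + (if i = j then sc a * P else 0) - e i j * P)"
      using p by (subst sum.inter_filter[symmetric], simp, intro sum.cong) auto
    also have "\<dots> = (if j < p then sc a * (e i j * P) else 0) + sc (of_nat p) * (if i = j then sc a * P else 0)
        - sc (of_nat p) * (e i j * P)"
      by (simp add: sum.distrib sum_subtractf sc_of_nat)
    finally show ?thesis unfolding sumP using big[OF ij False] False
      by (auto simp: sc_simps algebra_simps sc_perm)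
  qed
qed

text \<open>The matrix units \<open>u\<close> contract the inner indices, so the coefficient of
  \<open>u j k\<close> in the square of \<gamma> is the sum over \<open>i\<close> of
  \<open>e i j * e k i\<close>. This explains the order of the factors in
  \<open>char_mat\<close>.\<close>

lemma char_mat_quadratic:
  assumes Q: "\<And>i j. i < n \<Longrightarrow> j < n \<Longrightarrow> char_mat n a p e i j = 0"
    and cm: "\<And>i j k l. i < n \<Longrightarrow> j < n \<Longrightarrow> k < n \<Longrightarrow> l < n \<Longrightarrow> cm (e i j) (u k l)"
    and u: "\<And>i j k l. i < n \<Longrightarrow> j < n \<Longrightarrow> k < n \<Longrightarrow> l < n \<Longrightarrow> u i j * u k l = (if j = k then u i l else 0)"
    and u1: "(\<Sum>i<n. u i i) = 1"
  shows "(cg n e u - sc a) * (cg n e u + sc p) = 0"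
proof -
  have prod: "e i j * u j i * cg n e u = (\<Sum>k<n. e i j * e k i * u j k)" if ij: "i < n" "j < n" for i j
  proof -
    have "e i j * u j i * cg n e u = (\<Sum>k<n. \<Sum>l<n. e i j * e k l * (if i = l then u j k else 0))"
      unfolding cg_def sum_distrib_left
    proof (intro sum.cong refl)
      fix k l assume "k \<in> {..<n}" "l \<in> {..<n}"
      then have kl: "k < n" "l < n" by auto
      have "e i j * u j i * (e k l * u l k) = e i j * (u j i * e k l) * u l k" by (simp add: mult.assoc)
      also have "\<dots> = e i j * e k l * (u j i * u l k)" unfolding cm[OF kl ij(2,1), symmetric] by (simp add: mult.assoc)
      finally show "e i j * u j i * (e k l * u l k) = e i j * e k l * (if i = l then u j k else 0)"
        unfolding u[OF ij(2,1) kl(2,1)] .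
    qed
    then show ?thesis using ij by (simp add: sum_if_mult)
  qed
  have "cg n e u * cg n e u = (\<Sum>i<n. \<Sum>j<n. \<Sum>k<n. e i j * e k i * u j k)"
    by (subst cg_def) (simp add: sum_distrib_right prod)
  also have "\<dots> = (\<Sum>j<n. \<Sum>i<n. \<Sum>k<n. e i j * e k i * u j k)" by (rule sum.swap)
  also have "\<dots> = (\<Sum>j<n. \<Sum>k<n. \<Sum>i<n. e i j * e k i * u j k)" by (intro sum.cong refl sum.swap)
  also have "\<dots> = (\<Sum>k<n. \<Sum>j<n. (\<Sum>i<n. e i j * e k i) * u j k)" by (subst sum.swap) (simp add: sum_distrib_right)
  finally have sq: "cg n e u * cg n e u = \<dots>" .
  have "0 = (\<Sum>k<n. \<Sum>j<n. char_mat n a p e k j * u j k)" using Q by simp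
  also have "\<dots> = (\<Sum>k<n. \<Sum>j<n. (\<Sum>i<n. e i j * e k i) * u j k + sc (p - a) * (e k j * u j k)
      - (if k = j then sc (a * p) else 0) * u j k)"
    by (simp add: char_mat_def algebra_simps)
  also have "\<dots> = cg n e u * cg n e u + sc (p - a) * cg n e u - (\<Sum>k<n. sc (a * p) * u k k)"
    unfolding sq by (simp add: cg_def sum.distrib sum_subtractf sum_distrib_left sum_if_mult)
  also have "\<dots> = cg n e u * cg n e u + sc (p - a) * cg n e u - sc (a * p)"
    by (simp add: sum_distrib_left[symmetric] u1)
  finally have 0: "cg n e u * cg n e u + sc (p - a) * cg n e u - sc (a * p) = 0" by simp
  have "(cg n e u - sc a) * (cg n e u + sc p) = cg n e u * cg n e u + cg n e u * sc p - sc a * cg n e u - sc a * sc p"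
    by (simp add: algebra_simps)
  also have "\<dots> = cg n e u * cg n e u + sc (p - a) * cg n e u - sc (a * p)"
    unfolding sc_comm[of "cg n e u"] sc_simps by (simp add: algebra_simps)
  finally show ?thesis unfolding 0 .
qed

text \<open>The case of highest weight \<open>\<mu> = 0\<close> in the classical formulas
  \<open>H F^m v = (\<mu> - 2m) F^m v\<close> and
  \<open>E F^(m+1) v = (m+1)(\<mu> - m) F^m v\<close>.\<close>

lemma sl2_string:
  fixes E H F P :: endo
  assumes rel: "E * F - F * E = H" "H * F - F * H = - (F + F)" and P: "E * P = 0" "H * P = 0"
  shows "H * (F ^ m * P) = sc (- 2 * of_nat m) * (F ^ m * P) \<and>
    E * (F ^ Suc m * P) = sc (- of_nat m * of_nat (Suc m)) * (F ^ m * P)"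
proof (induction m)
  case 0
  have "E * (F * P) = (E * F - F * E) * P + F * (E * P)" by (simp add: algebra_simps)
  then show ?case unfolding rel P by (simp add: sc_simps P)
next
  case (Suc m)
  define w where "w = F ^ m * P"
  define v where "v = F * w"
  have v: "F ^ Suc m * P = v" by (simp add: v_def w_def mult.assoc)
  have Hw: "H * w = sc (- 2 * of_nat m) * w" and Ev: "E * v = sc (- of_nat m * of_nat (Suc m)) * w"
    using Suc unfolding v w_def by auto
  have "H * v = (H * F - F * H) * w + F * (H * w)" by (simp add: algebra_simps v_def)
  also have "\<dots> = sc (- 2 * of_nat m - 2) * v"
    unfolding rel Hw sc_comm_left[of F] by (simp add: v_def sc_simps algebra_simps sc_of_nat[of 2, simplified] mult_2)
  also have "- 2 * of_nat m - 2 = - 2 * (of_nat (Suc m) :: complex)" by simp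
  finally have Hv: "H * v = sc (- 2 * of_nat (Suc m)) * v" .
  have "E * (F * v) = (E * F - F * E) * v + F * (E * v)" by (simp add: algebra_simps)
  also have "\<dots> = sc (- 2 * of_nat (Suc m)) * v + sc (- of_nat m * of_nat (Suc m)) * v"
    unfolding rel Hv Ev sc_comm_left[of F] v_def[symmetric] ..
  also have "\<dots> = sc (- 2 * of_nat (Suc m) + - of_nat m * of_nat (Suc m)) * v"
    unfolding sc_simps(3) by (simp only: distrib_right)
  also have "- 2 * of_nat (Suc m) + - of_nat m * of_nat (Suc m) = - of_nat (Suc m) * (of_nat (Suc (Suc m)) :: complex)"
    by (simp add: algebra_simps)
  finally have "E * (F * v) = sc (- of_nat (Suc m) * of_nat (Suc (Suc m))) * v" .
  moreover have "F ^ Suc (Suc m) * P = F * v" unfolding v[symmetric] by (simp add: mult.assoc)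
  ultimately show ?case unfolding v using Hv by simp
qed

section \<open>Lie algebra modules\<close>

lemma lie_alg_carrier: "u \<in> lie_alg ty n \<Longrightarrow> u \<in> carrier_mat n n"
  by (cases ty) auto

lemma trace_add: "A \<in> carrier_mat n n \<Longrightarrow> B \<in> carrier_mat n n \<Longrightarrow> trace (A + B) = trace A + trace B"
  by (simp add: trace_def sum.distrib)

lemma trace_diff: "A \<in> carrier_mat n n \<Longrightarrow> B \<in> carrier_mat n n \<Longrightarrow> trace (A - B) = trace A - trace B"
  by (simp add: trace_def sum_subtractf)

lemma trace_smult: "A \<in> carrier_mat n n \<Longrightarrow> trace (c \<cdot>\<^sub>m A) = c * trace A"
  by (simp add: trace_def sum_distrib_left)

lemma trace_one: "trace (1\<^sub>m n) = of_nat n"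
  by (simp add: trace_def)

lemma trace_mult: "A \<in> carrier_mat n n \<Longrightarrow> B \<in> carrier_mat n n \<Longrightarrow>
    trace (A * B) = (\<Sum>i<n. \<Sum>j<n. A $$ (i, j) * B $$ (j, i))"
  by (simp add: trace_def scalar_prod_def lessThan_atLeast0)

lemma trace_comm: "A \<in> carrier_mat n n \<Longrightarrow> B \<in> carrier_mat n n \<Longrightarrow> trace (A * B) = trace (B * A)"
  by (simp add: trace_mult mult.commute) (rule sum.swap)

lemma trace_Eu_mult: "i < n \<Longrightarrow> j < n \<Longrightarrow> B \<in> carrier_mat n n \<Longrightarrow> trace (Eu n i j * B) = B $$ (j, i)"
proof -
  assume ij: "i < n" "j < n" and B: "B \<in> carrier_mat n n"
  have "trace (Eu n i j * B) = (\<Sum>k<n. \<Sum>l<n. if k = i then if l = j then B $$ (l, k) else 0 else 0)"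
    unfolding trace_mult[OF Eu_carrier(1) B] by (intro sum.cong) (auto simp: Eu_def)
  also have "\<dots> = (\<Sum>k<n. if k = i then B $$ (j, k) else 0)" using ij by (intro sum.cong) auto
  finally show ?thesis using ij by simp
qed

lemma trace_Eu: "i < n \<Longrightarrow> j < n \<Longrightarrow> trace (Eu n i j) = (if i = j then 1 else 0)"
  by (auto simp: trace_def Eu_def)

lemma Eu_mult: assumes "i < n" "j < n" "k < n" "l < n"
  shows "Eu n i j * Eu n k l = (if j = k then Eu n i l else 0\<^sub>m n n)"
proof (rule eq_matI)
  fix s t assume "s < dim_row (if j = k then Eu n i l else 0\<^sub>m n n)" "t < dim_col (if j = k then Eu n i l else 0\<^sub>m n n)"
  then have st: "s < n" "t < n" by (auto split: if_splits)
  have "(Eu n i j * Eu n k l) $$ (s, t) = (\<Sum>m<n. if m = j then if s = i \<and> j = k \<and> t = l then 1 else 0 else 0)"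
    unfolding mult_mat_entry[OF Eu_carrier(1) Eu_carrier(1) st] by (intro sum.cong) (use st in \<open>auto simp: Eu_def\<close>)
  then show "(Eu n i j * Eu n k l) $$ (s, t) = (if j = k then Eu n i l else 0\<^sub>m n n) $$ (s, t)"
    using st assms by (auto simp: Eu_def)
qed auto

definition linmap :: "lie_type \<Rightarrow> nat \<Rightarrow> (complex mat \<Rightarrow> endo) \<Rightarrow> bool" where
  "linmap ty n L \<longleftrightarrow> (\<forall>u\<in>lie_alg ty n. \<forall>v\<in>lie_alg ty n. L (u + v) = L u + L v) \<and>
     (\<forall>c. \<forall>u\<in>lie_alg ty n. L (c \<cdot>\<^sub>m u) = sc c * L u)"

lemma linmap_expand:
  assumes L: "linmap GL n L" and u: "u \<in> carrier_mat n n"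
  shows "L u = (\<Sum>i<n. \<Sum>j<n. sc (u $$ (i, j)) * L (Eu n i j))"
proof -
  \<comment> \<open>\<open>R S\<close> keeps the entries of \<open>u\<close> at the positions in
    \<open>S\<close>; growing \<open>S\<close> by one position at a time splits \<open>u\<close>
    into multiples of matrix units.\<close>
  define R where "R S = mat n n (\<lambda>s. if s \<in> S then u $$ s else 0)" for S
  have add: "L (x + y) = L x + L y" if "x \<in> carrier_mat n n" "y \<in> carrier_mat n n" for x y
    using L that by (auto simp: linmap_def)
  have smult: "L (c \<cdot>\<^sub>m x) = sc c * L x" if "x \<in> carrier_mat n n" for c x
    using L that by (auto simp: linmap_def)
  have "L (R S) = (\<Sum>s\<in>S. sc (u $$ s) * L (Eu n (fst s) (snd s)))" if "finite S" "S \<subseteq> {..<n} \<times> {..<n}" for S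
    using that
  proof (induction S rule: finite_induct)
    case empty
    have "R {} = 0 \<cdot>\<^sub>m R {}" by (rule eq_matI) (auto simp: R_def)
    then have "L (R {}) = 0" using smult[of "R {}" 0] by (simp add: sc_simps R_def)
    then show ?case by simp
  next
    case (insert s S)
    have "R (insert s S) = u $$ s \<cdot>\<^sub>m Eu n (fst s) (snd s) + R S"
      using insert by (intro eq_matI) (auto simp: R_def Eu_def)
    then show ?case using insert add[of "u $$ s \<cdot>\<^sub>m Eu n (fst s) (snd s)" "R S"]
      by (simp add: smult R_def)
  qed
  from this[of "{..<n} \<times> {..<n}"] have "L (R ({..<n} \<times> {..<n})) = (\<Sum>i<n. \<Sum>j<n. sc (u $$ (i, j)) * L (Eu n i j))"
    by (simp add: sum.cartesian_product case_prod_unfold)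
  moreover have "R ({..<n} \<times> {..<n}) = u" using u by (intro eq_matI) (auto simp: R_def)
  ultimately show ?thesis by simp
qed

text \<open>For \<open>SL\<close>, the projection of gl_n onto sl_n along the scalar matrices, which
  makes all matrix units usable although the diagonal ones have nonzero trace. For \<open>GL\<close>
  it is the identity, so both types share the later arguments.\<close>

definition pr :: "lie_type \<Rightarrow> nat \<Rightarrow> complex mat \<Rightarrow> complex mat" where
  "pr ty n u = (if ty = SL then u - (trace u / of_nat n) \<cdot>\<^sub>m 1\<^sub>m n else u)"

section \<open>The trace form, dual bases, and the extension from sl_n to gl_n\<close>

context fixes n :: nat assumes n: "0 < n"
begin

lemma pr_lie: "u \<in> carrier_mat n n \<Longrightarrow> pr ty n u \<in> lie_alg ty n"
  using n by (cases ty) (auto simp: pr_def trace_diff[of _ n] trace_smult[of _ n] trace_one)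

lemma pr_id: "u \<in> lie_alg ty n \<Longrightarrow> pr ty n u = u"
  by (cases ty) (auto simp: pr_def intro!: eq_matI)

lemma pr_traceless: "u \<in> carrier_mat n n \<Longrightarrow> trace u = 0 \<Longrightarrow> pr ty n u = u"
  by (auto simp: pr_def intro!: eq_matI)

lemma pr_add: "u \<in> carrier_mat n n \<Longrightarrow> v \<in> carrier_mat n n \<Longrightarrow> pr ty n (u + v) = pr ty n u + pr ty n v"
  by (auto simp: pr_def trace_add[of _ n] intro!: eq_matI simp: algebra_simps add_divide_distrib)

lemma pr_smult: "u \<in> carrier_mat n n \<Longrightarrow> pr ty n (c \<cdot>\<^sub>m u) = c \<cdot>\<^sub>m pr ty n u"
  by (auto simp: pr_def trace_smult[of _ n] intro!: eq_matI simp: algebra_simps)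

lemma linmap_pr: "linmap ty n L \<Longrightarrow> linmap GL n (\<lambda>u. L (pr ty n u))"
  unfolding linmap_def using pr_lie by (auto simp: pr_add pr_smult)

lemma linmap_pr_expand:
  assumes "linmap ty n L" "u \<in> carrier_mat n n"
  shows "L (pr ty n u) = (\<Sum>i<n. \<Sum>j<n. sc (u $$ (i, j)) * L (pr ty n (Eu n i j)))"
  by (rule linmap_expand[OF linmap_pr[OF assms(1)] assms(2)])

lemma zero_lie: "0\<^sub>m n n \<in> lie_alg ty n"
  by (cases ty) (auto simp: trace_def)

lemma linmap_zero: assumes "linmap ty n L" shows "L (0\<^sub>m n n) = 0"
proof -
  have "L (0 \<cdot>\<^sub>m 0\<^sub>m n n) = sc 0 * L (0\<^sub>m n n)" using assms zero_lie unfolding linmap_def by blast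
  moreover have "0 \<cdot>\<^sub>m 0\<^sub>m n n = (0\<^sub>m n n :: complex mat)" by auto
  ultimately show ?thesis by (simp add: sc_simps)
qed

lemma lie_add: "u \<in> lie_alg ty n \<Longrightarrow> v \<in> lie_alg ty n \<Longrightarrow> u + v \<in> lie_alg ty n"
  by (cases ty) (auto simp: trace_add[of _ n])

lemma lie_smult: "u \<in> lie_alg ty n \<Longrightarrow> c \<cdot>\<^sub>m u \<in> lie_alg ty n"
  by (cases ty) (auto simp: trace_smult[of _ n])

lemma linmap_finsum:
  assumes L: "linmap ty n L" and "finite S" "\<And>i. i \<in> S \<Longrightarrow> f i \<in> lie_alg ty n"
  shows "(\<Oplus>\<^bsub>End n\<^esub>i\<in>S. c i \<cdot>\<^sub>m f i) \<in> lie_alg ty n \<and> L (\<Oplus>\<^bsub>End n\<^esub>i\<in>S. c i \<cdot>\<^sub>m f i) = (\<Sum>i\<in>S. sc (c i) * L (f i))"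
proof -
  interpret abelian_group "End n" by (rule abelian_group_mat)
  show ?thesis using assms(2,3)
  proof (induction S rule: finite_induct)
    case empty
    then show ?case by (simp add: module_mat_simps zero_lie linmap_zero[OF L])
  next
    case (insert x S)
    have car: "c i \<cdot>\<^sub>m f i \<in> carrier_mat n n" if "i \<in> insert x S" for i
      by (rule smult_carrier_mat[OF lie_alg_carrier[OF insert.prems[OF that]]])
    have "(\<Oplus>\<^bsub>End n\<^esub>i\<in>insert x S. c i \<cdot>\<^sub>m f i) = c x \<cdot>\<^sub>m f x + (\<Oplus>\<^bsub>End n\<^esub>i\<in>S. c i \<cdot>\<^sub>m f i)"
      using insert car by (subst finsum_insert) (auto simp: module_mat_simps)
    moreover have "f x \<in> lie_alg ty n" "(\<Oplus>\<^bsub>End n\<^esub>i\<in>S. c i \<cdot>\<^sub>m f i) \<in> lie_alg ty n"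
      and "L (\<Oplus>\<^bsub>End n\<^esub>i\<in>S. c i \<cdot>\<^sub>m f i) = (\<Sum>i\<in>S. sc (c i) * L (f i))"
      using insert by auto
    ultimately show ?case using insert(1,2) L by (simp add: lie_add lie_smult linmap_def)
  qed
qed

lemma sc_inj: "sc c = sc d \<Longrightarrow> c = d"
proof -
  assume "sc c = sc d"
  then have "Rep_endo (sc c) (\<lambda>_. 1) 0 = Rep_endo (sc d) (\<lambda>_. 1) 0" by simp
  then show ?thesis by (simp add: sc.rep_eq)
qed

text \<open>Trace pairings are viewed as \<open>endo\<close>-valued maps so that
  \<open>linmap_finsum\<close> can read off the coefficients of a linear combination.\<close>

lemma linmap_trace: assumes "B \<in> carrier_mat n n" shows "linmap ty n (\<lambda>u. sc (trace (u * B)))"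
  unfolding linmap_def
proof (intro conjI ballI allI)
  fix u v c assume "u \<in> lie_alg ty n" 
  note u = lie_alg_carrier[OF this]
  have "c \<cdot>\<^sub>m u * B = c \<cdot>\<^sub>m (u * B)" using u assms by auto
  then show "sc (trace (c \<cdot>\<^sub>m u * B)) = sc c * sc (trace (u * B))"
    using trace_smult[OF mult_carrier_mat[OF u assms]] by (simp add: sc_simps)
  assume "v \<in> lie_alg ty n"
  note v = lie_alg_carrier[OF this]
  have "(u + v) * B = u * B + v * B" using u v assms by (rule add_mult_distrib_mat)
  then show "sc (trace ((u + v) * B)) = sc (trace (u * B)) + sc (trace (v * B))"
    using trace_add[OF mult_carrier_mat[OF u assms] mult_carrier_mat[OF v assms]] by (simp add: sc_simps)
qed

lemma dual_expand:
  assumes B: "dual_bases ty n r B B'" and L: "linmap ty n L" and u: "u \<in> lie_alg ty n"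
  shows "L u = (\<Sum>m<r. sc (trace (u * B' m)) * L (B m))"
proof -
  obtain c where c: "u = (\<Oplus>\<^bsub>End n\<^esub>i\<in>{..<r}. c i \<cdot>\<^sub>m B i)" using B u unfolding dual_bases_def by blast
  have Bl: "i \<in> {..<r} \<Longrightarrow> B i \<in> lie_alg ty n" for i using B unfolding dual_bases_def by auto
  have "c j = trace (u * B' j)" if j: "j < r" for j
  proof -
    have B'j: "B' j \<in> carrier_mat n n" using B j lie_alg_carrier unfolding dual_bases_def by blast
    have "sc (trace (u * B' j)) = (\<Sum>i<r. sc (c i) * sc (trace (B i * B' j)))"
      unfolding c by (rule linmap_finsum[OF linmap_trace[OF B'j] finite_lessThan Bl, THEN conjunct2])
    also have "\<dots> = (\<Sum>i<r. if i = j then sc (c i) else 0)"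
      using B j unfolding dual_bases_def by (intro sum.cong) (auto simp: sc_simps)
    finally show ?thesis using j sc_inj by simp
  qed
  moreover have "L u = (\<Sum>i<r. sc (c i) * L (B i))"
    unfolding c by (rule linmap_finsum[OF L finite_lessThan Bl, THEN conjunct2])
  ultimately show ?thesis by simp
qed

text \<open>Independence of \<gamma> from the choice of dual bases. Expanding \<open>E_ij\<close> in
  \<open>B\<close> by trace pairings and reassembling \<open>B'\<close> from its entries exchanges
  one sum for the other.\<close>

lemma dual_sum:
  assumes B: "dual_bases ty n r B B'" and L: "linmap ty n L" "linmap ty n L'"
  shows "(\<Sum>m<r. L (B m) * L' (B' m)) = cg n (\<lambda>i j. L (pr ty n (Eu n i j))) (\<lambda>i j. L' (pr ty n (Eu n i j)))"
proof -
  let ?F = "\<lambda>i j m. L (B m) * (sc (B' m $$ (j, i)) * L' (pr ty n (Eu n j i)))"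
  have B': "B' m \<in> lie_alg ty n" "B' m \<in> carrier_mat n n" if "m < r" for m
    using B that lie_alg_carrier unfolding dual_bases_def by blast+
  \<comment> \<open>For \<open>SL\<close> the correction term of \<open>pr\<close> pairs to zero
    with \<open>B' m\<close>, which is traceless.\<close>
  have tr: "trace (pr ty n (Eu n i j) * B' m) = B' m $$ (j, i)" if "i < n" "j < n" "m < r" for i j m
  proof (cases ty)
    case SL
    have "pr ty n (Eu n i j) * B' m = Eu n i j * B' m - (trace (Eu n i j) / of_nat n) \<cdot>\<^sub>m B' m"
      using B'[OF that(3)] SL by (simp add: pr_def minus_mult_distrib_mat[of _ n n] mult_smult_assoc_mat[of _ n n _ n])
    then show ?thesis using B'[OF that(3)] SL that
      mult_carrier_mat[of "Eu n i j" n n "B' m" n]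
      by (simp add: trace_diff[of _ n] trace_smult[of _ n] trace_Eu_mult)
  qed (use that B' in \<open>auto simp: pr_def trace_Eu_mult\<close>)
  have "cg n (\<lambda>i j. L (pr ty n (Eu n i j))) (\<lambda>i j. L' (pr ty n (Eu n i j))) =
      (\<Sum>i<n. \<Sum>j<n. \<Sum>m<r. ?F i j m)"
    unfolding cg_def
  proof (intro sum.cong refl)
    fix i j assume "i \<in> {..<n}" "j \<in> {..<n}"
    then have ij: "i < n" "j < n" by auto
    have "L (pr ty n (Eu n i j)) = (\<Sum>m<r. sc (trace (pr ty n (Eu n i j) * B' m)) * L (B m))"
      by (rule dual_expand[OF B L(1) pr_lie]) simp
    also have "\<dots> = (\<Sum>m<r. L (B m) * sc (B' m $$ (j, i)))" using tr[OF ij] by (simp add: sc_comm[of "L _"])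
    finally show "L (pr ty n (Eu n i j)) * L' (pr ty n (Eu n j i)) =
        (\<Sum>m<r. ?F i j m)"
      by (simp add: sum_distrib_right mult.assoc)
  qed
  also have "\<dots> = (\<Sum>i<n. \<Sum>m<r. \<Sum>j<n. ?F i j m)"
    by (rule sum.cong[OF refl], rule sum.swap)
  also have "\<dots> = (\<Sum>m<r. \<Sum>i<n. \<Sum>j<n. ?F i j m)"
    by (rule sum.swap)
  also have "\<dots> = (\<Sum>m<r. L (B m) * L' (pr ty n (B' m)))"
  proof (intro sum.cong refl)
    fix m assume "m \<in> {..<r}"
    then have m: "m < r" by simp
    show "(\<Sum>i<n. \<Sum>j<n. ?F i j m) = L (B m) * L' (pr ty n (B' m))"
      unfolding linmap_pr_expand[OF L(2) B'(2)[OF m]] sum_distrib_left by (rule sum.swap)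
  qed
  also have "\<dots> = (\<Sum>m<r. L (B m) * L' (B' m))" using B' pr_id by simp
  finally show ?thesis by simp
qed

definition lierep :: "lie_type \<Rightarrow> (complex mat \<Rightarrow> endo) \<Rightarrow> bool" where
  "lierep ty L \<longleftrightarrow> linmap ty n L \<and>
     (\<forall>u\<in>lie_alg ty n. \<forall>v\<in>lie_alg ty n. L (u * v - v * u) = L u * L v - L v * L u)"

text \<open>A representation of \<open>sl\<^sub>n\<close> is extended to \<open>gl\<^sub>n\<close> by letting the identity matrix act as the scalar \<open>s\<close>;
  this is what absorbs the shifts \<open>c\<^sub>x\<close>, \<open>c\<^sub>y\<close> and \<open>d\<close>.\<close>

definition ge :: "lie_type \<Rightarrow> (complex mat \<Rightarrow> endo) \<Rightarrow> complex \<Rightarrow> nat \<Rightarrow> nat \<Rightarrow> endo" where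
  "ge ty L s i j = L (pr ty n (Eu n i j)) + sc (if ty = SL \<and> i = j then s / of_nat n else 0)"

lemma linmap_diff: assumes L: "linmap ty n L" and u: "u \<in> lie_alg ty n" and v: "v \<in> lie_alg ty n"
  shows "L (u - v) = L u - L v"
proof -
  have "u - v = u + (- 1) \<cdot>\<^sub>m v" using lie_alg_carrier[OF u] lie_alg_carrier[OF v] by (intro eq_matI) auto
  then have "L (u - v) = L u + sc (- 1) * L v" using L u v lie_smult by (simp add: linmap_def)
  then show ?thesis by (simp add: sc_simps)
qed

lemma pr_comm: assumes u: "u \<in> carrier_mat n n" and v: "v \<in> carrier_mat n n"
  shows "pr ty n u * pr ty n v - pr ty n v * pr ty n u = u * v - v * u"
proof (cases ty)
  case SL
  define a b where "a = trace u / of_nat n" and "b = trace v / of_nat n"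
  have 1: "(u - a \<cdot>\<^sub>m 1\<^sub>m n) * (v - b \<cdot>\<^sub>m 1\<^sub>m n) = u * v - b \<cdot>\<^sub>m u - (a \<cdot>\<^sub>m v - a \<cdot>\<^sub>m (b \<cdot>\<^sub>m 1\<^sub>m n))"
    if "u \<in> carrier_mat n n" "v \<in> carrier_mat n n" for u v :: "complex mat" and a b
  proof -
    have c: "a \<cdot>\<^sub>m 1\<^sub>m n \<in> carrier_mat n n" "b \<cdot>\<^sub>m 1\<^sub>m n \<in> carrier_mat n n" "v - b \<cdot>\<^sub>m 1\<^sub>m n \<in> carrier_mat n n" by auto
    have "(u - a \<cdot>\<^sub>m 1\<^sub>m n) * (v - b \<cdot>\<^sub>m 1\<^sub>m n) = u * (v - b \<cdot>\<^sub>m 1\<^sub>m n) - a \<cdot>\<^sub>m 1\<^sub>m n * (v - b \<cdot>\<^sub>m 1\<^sub>m n)"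
      by (rule minus_mult_distrib_mat[OF that(1) c(1,3)])
    also have "u * (v - b \<cdot>\<^sub>m 1\<^sub>m n) = u * v - b \<cdot>\<^sub>m u"
      unfolding mult_minus_distrib_mat[OF that c(2)] mult_smult_distrib[OF that(1) one_carrier_mat] right_mult_one_mat[OF that(1)] ..
    also have "a \<cdot>\<^sub>m 1\<^sub>m n * (v - b \<cdot>\<^sub>m 1\<^sub>m n) = a \<cdot>\<^sub>m v - a \<cdot>\<^sub>m (b \<cdot>\<^sub>m 1\<^sub>m n)"
      unfolding mult_smult_assoc_mat[OF one_carrier_mat c(3)] left_mult_one_mat[OF c(3)]
      using that(2) by (intro eq_matI) (auto simp: algebra_simps)
    finally show ?thesis .
  qed
  show ?thesis unfolding pr_def SL using u v
    by (simp add: a_def[symmetric] b_def[symmetric] 1) (intro eq_matI, auto)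
qed (simp add: pr_def)

lemma ge_adj: assumes L: "lierep ty L" shows "adj n (ge ty L s) (ge ty L s)"
  unfolding adj_def
proof (intro allI impI)
  fix i j k l assume l: "i < n" "j < n" "k < n" "l < n"
  have lin: "linmap ty n L" using L by (simp add: lierep_def)
  let ?E = "Eu n i j" and ?F = "Eu n k l"
  let ?X = "L (pr ty n ?E)" and ?Y = "L (pr ty n ?F)"
  have "ge ty L s i j * ge ty L s k l - ge ty L s k l * ge ty L s i j = ?X * ?Y - ?Y * ?X"
    unfolding ge_def by (simp add: algebra_simps sc_comm[of ?X] sc_comm[of ?Y] sc_perm)
  also have "\<dots> = L (pr ty n ?E * pr ty n ?F - pr ty n ?F * pr ty n ?E)"
    using L pr_lie[of ?E] pr_lie[of ?F] by (simp add: lierep_def)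
  also have "pr ty n ?E * pr ty n ?F - pr ty n ?F * pr ty n ?E = ?E * ?F - ?F * ?E" by (rule pr_comm) auto
  also have "\<dots> = pr ty n (?E * ?F - ?F * ?E)"
    using trace_diff[of "?E * ?F" n "?F * ?E"] trace_comm[of ?E n ?F] mult_carrier_mat[of ?E n n ?F n] mult_carrier_mat[of ?F n n ?E n]
    by (intro pr_traceless[symmetric]) auto
  also have "?E * ?F - ?F * ?E = (if j = k then Eu n i l else 0\<^sub>m n n) - (if i = l then Eu n k j else 0\<^sub>m n n)"
    using l by (cases "i = l") (auto simp: Eu_mult)
  also have "L (pr ty n \<dots>) = L (pr ty n (if j = k then Eu n i l else 0\<^sub>m n n)) - L (pr ty n (if i = l then Eu n k j else 0\<^sub>m n n))"
    by (rule linmap_diff[OF linmap_pr[OF lin]]) auto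
  \<comment> \<open>For \<open>j = k\<close> and \<open>i = l\<close> the scalar shifts of the two
    terms cancel; in all other cases there are none.\<close>
  also have "\<dots> = (if j = k then ge ty L s i l else 0) - (if i = l then ge ty L s k j else 0)"
    using linmap_zero[OF linmap_pr[OF lin]] by (auto simp: ge_def sc_simps(1))
  finally show "ge ty L s i j * ge ty L s k l - ge ty L s k l * ge ty L s i j =
    (if j = k then ge ty L s i l else 0) - (if i = l then ge ty L s k j else 0)" .
qed

lemma sum_diag: assumes L: "linmap ty n L" and ty: "ty = SL" shows "(\<Sum>i<n. L (pr ty n (Eu n i i))) = 0"
proof -
  have "0 = L (pr ty n (1\<^sub>m n))"
  proof -
    have "pr ty n (1\<^sub>m n) = 0\<^sub>m n n" using ty n by (intro eq_matI) (auto simp: pr_def trace_one)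
    then show ?thesis using linmap_zero[OF L] by simp
  qed
  also have "\<dots> = (\<Sum>i<n. \<Sum>j<n. if j = i then L (pr ty n (Eu n i i)) else 0)"
    unfolding linmap_pr_expand[OF L one_carrier_mat] by (intro sum.cong) (auto simp: sc_simps)
  also have "\<dots> = (\<Sum>i<n. L (pr ty n (Eu n i i)))" by simp
  finally show ?thesis by simp
qed

text \<open>Splitting off the identity matrix, \<gamma> of gl_n is \<gamma> of sl_n plus
  \<open>1/n\<close> times identity tensor identity; the cross terms are sums over the diagonal and
  vanish by \<open>sum_diag\<close>. This is how \<open>1/n\<close> enters the constants.\<close>

lemma cg_ge:
  assumes L: "linmap ty n L" "linmap ty n L'"
  shows "cg n (ge ty L s) (ge ty L' s') = cg n (\<lambda>i j. L (pr ty n (Eu n i j))) (\<lambda>i j. L' (pr ty n (Eu n i j))) +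
    (if ty = SL then sc (s * s' / of_nat n) else 0)"
proof (cases "ty = SL")
  case True
  have "ge ty L s i j * ge ty L' s' j i = L (pr ty n (Eu n i j)) * L' (pr ty n (Eu n j i)) +
      (if i = j then L (pr ty n (Eu n i i)) * sc (s' / of_nat n) + sc (s / of_nat n) * L' (pr ty n (Eu n i i))
        + sc (s / of_nat n) * sc (s' / of_nat n) else 0)" for i j
    using True by (cases "i = j") (simp_all add: ge_def algebra_simps sc_simps(1))
  then have "cg n (ge ty L s) (ge ty L' s') = cg n (\<lambda>i j. L (pr ty n (Eu n i j))) (\<lambda>i j. L' (pr ty n (Eu n i j))) +
      (\<Sum>i<n. L (pr ty n (Eu n i i)) * sc (s' / of_nat n) + sc (s / of_nat n) * L' (pr ty n (Eu n i i))
        + sc (s / of_nat n) * sc (s' / of_nat n))"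
    unfolding cg_def by (simp add: sum.distrib)
  also have "(\<Sum>i<n. L (pr ty n (Eu n i i)) * sc (s' / of_nat n) + sc (s / of_nat n) * L' (pr ty n (Eu n i i))
        + sc (s / of_nat n) * sc (s' / of_nat n)) = of_nat n * (sc (s / of_nat n) * sc (s' / of_nat n))"
    using sum_diag[OF L(1) True] sum_diag[OF L(2) True]
    by (simp add: sum.distrib sum_distrib_left[symmetric] sum_distrib_right[symmetric])
  also have "\<dots> = sc (s * s' / of_nat n)"
    unfolding sc_of_nat[symmetric] sc_simps(4)[symmetric] using n by simp
  finally show ?thesis using True by simp
qed (simp add: ge_def cg_def sc_simps(1))

lemma cm_ge_imp_cm:
  assumes L: "linmap ty n L" and u: "u \<in> lie_alg ty n"
    and cm: "\<And>i j. i < n \<Longrightarrow> j < n \<Longrightarrow> cm X (ge ty L s i j)"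
  shows "cm X (L u)"
proof -
  have "cm X (L (pr ty n (Eu n i j)))" if "i < n" "j < n" for i j
  proof -
    have "L (pr ty n (Eu n i j)) = ge ty L s i j - sc (if ty = SL \<and> i = j then s / of_nat n else 0)"
      by (simp add: ge_def)
    then show ?thesis using cm_diff[OF cm[OF that] cm_sc] by metis
  qed
  then have "cm X (L (pr ty n u))"
    unfolding linmap_pr_expand[OF L lie_alg_carrier[OF u]] by (intro cm_sum cm_mult cm_sc) auto
  then show ?thesis using pr_id[OF u] by simp
qed

end

section \<open>The modules of rectangular highest weight\<close>

lemma lierep_emb:
  assumes d: "0 < d" and n: "0 < n" and M: "is_lie_module (lie_alg ty n) (d, \<rho>)"
  shows "lierep n ty (\<lambda>u. emb d (\<rho> u))"
  using M unfolding lierep_def[OF n] linmap_def is_lie_module_def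
  by (auto simp: emb_add[OF d] emb_smult[OF d] emb_diff[OF d mult_carrier_mat[of _ d d _ d] mult_carrier_mat[of _ d d _ d]] emb_mult[OF d])

text \<open>A vector \<open>w\<close> is represented by the rank one matrix with first column \<open>w\<close>, so that applying a matrix to
  \<open>w\<close> becomes multiplication.\<close>

definition colm :: "nat \<Rightarrow> complex vec \<Rightarrow> endo" where
  "colm d w = emb d (mat d d (\<lambda>(i, j). if j = 0 then w $ i else 0))"

context fixes d :: nat assumes d: "0 < d"
begin

lemma colm_eq_iff: assumes "w \<in> carrier_vec d" "w' \<in> carrier_vec d"
  shows "colm d w = colm d w' \<longleftrightarrow> w = w'"
proof
  assume "colm d w = colm d w'"
  then have "mat d d (\<lambda>(i, j). if j = 0 then w $ i else 0) = mat d d (\<lambda>(i, j). if j = 0 then w' $ i else 0)"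
    unfolding colm_def by (subst (asm) emb_eq_iff[OF d]) auto
  then have "mat d d (\<lambda>(i, j). if j = 0 then w $ i else 0) $$ (i, 0) = mat d d (\<lambda>(i, j). if j = 0 then w' $ i else 0) $$ (i, 0)" for i
    by simp
  then have "w $ i = w' $ i" if "i < d" for i using that d by (metis (mono_tags, lifting) case_prod_conv index_mat(1))
  then show "w = w'" using assms by (intro eq_vecI) auto
qed simp

lemma colm_mult: assumes A: "A \<in> carrier_mat d d" and w: "w \<in> carrier_vec d"
  shows "emb d A * colm d w = colm d (A *\<^sub>v w)"
proof -
  have "A * mat d d (\<lambda>(i, j). if j = 0 then w $ i else 0) = mat d d (\<lambda>(i, j). if j = 0 then (A *\<^sub>v w) $ i else 0)"
    using A w d by (intro eq_matI) (auto simp: scalar_prod_def)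
  then show ?thesis unfolding colm_def by (subst emb_mult[OF d A, symmetric]) auto
qed

lemma colm_smult: assumes w: "w \<in> carrier_vec d" shows "colm d (c \<cdot>\<^sub>v w) = sc c * colm d w"
proof -
  have "mat d d (\<lambda>(i, j). if j = 0 then (c \<cdot>\<^sub>v w) $ i else 0) = c \<cdot>\<^sub>m mat d d (\<lambda>(i, j). if j = 0 then w $ i else 0)"
    using w by (intro eq_matI) auto
  then show ?thesis unfolding colm_def by (subst emb_smult[OF d, symmetric]) auto
qed

lemma colm_add: assumes w: "w \<in> carrier_vec d" "w' \<in> carrier_vec d" shows "colm d (w + w') = colm d w + colm d w'"
proof -
  have "mat d d (\<lambda>(i, j). if j = 0 then (w + w') $ i else 0) =
      mat d d (\<lambda>(i, j). if j = 0 then w $ i else 0) + mat d d (\<lambda>(i, j). if j = 0 then w' $ i else 0)"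
    using w by (intro eq_matI) auto
  then show ?thesis unfolding colm_def by (subst emb_add[OF d, symmetric]) auto
qed

lemma colm_zero: "colm d (0\<^sub>v d) = 0"
proof -
  have "mat d d (\<lambda>(i, j). if j = 0 then (0\<^sub>v d) $ i else 0) = (0\<^sub>m d d :: complex mat)"
    by (intro eq_matI) auto
  then show ?thesis unfolding colm_def by (simp add: emb_zero[OF d])
qed

text \<open>The identity is a sum of basis columns times basis rows, so it suffices that
  \<open>X\<close> kills all columns.\<close>

lemma zero_of_colm:
  assumes "\<And>w. w \<in> carrier_vec d \<Longrightarrow> X * colm d w = 0" shows "X = 0"
proof -
  have "emb d (1\<^sub>m d) = (\<Sum>k<d. emb d (Eu d k 0 * Eu d 0 k))"
  proof (rule emb_sum_entries[OF d])
    fix i j assume ij: "i < d" "j < d"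
    have "(\<Sum>k<d. (Eu d k 0 * Eu d 0 k) $$ (i, j)) = (\<Sum>k<d. if k = i then if i = j then 1 else 0 else 0)"
      using d ij by (intro sum.cong refl) (auto simp: Eu_mult, auto simp: Eu_def)
    then show "1\<^sub>m d $$ (i, j) = (\<Sum>k<d. (Eu d k 0 * Eu d 0 k) $$ (i, j))" using ij by simp
  qed auto
  also have "\<dots> = (\<Sum>k<d. colm d (unit_vec d k) * emb d (Eu d 0 k))"
  proof (intro sum.cong refl)
    fix k assume "k \<in> {..<d}"
    then have "Eu d k 0 = mat d d (\<lambda>(i, j). if j = 0 then unit_vec d k $ i else 0)"
      by (intro eq_matI) (auto simp: Eu_def)
    then show "emb d (Eu d k 0 * Eu d 0 k) = colm d (unit_vec d k) * emb d (Eu d 0 k)"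
      unfolding colm_def by (simp add: emb_mult[OF d])
  qed
  finally have 1: "1 = (\<Sum>k<d. colm d (unit_vec d k) * emb d (Eu d 0 k))" by (simp add: emb_one[OF d])
  have "X = X * 1" by simp
  also have "\<dots> = (\<Sum>k<d. X * colm d (unit_vec d k) * emb d (Eu d 0 k))"
    unfolding 1 by (simp add: sum_distrib_left mult.assoc)
  also have "\<dots> = 0" using assms by (intro sum.neutral) auto
  finally show ?thesis .
qed

lemma finite_eigenvalue: "A \<in> carrier_mat d d \<Longrightarrow> finite {k. eigenvalue (A :: complex mat) k}"
proof -
  assume A: "A \<in> carrier_mat d d"
  then have "char_poly A \<noteq> 0" using degree_monic_char_poly[OF A] by auto
  then show ?thesis unfolding eigenvalue_root_char_poly[OF A] by (rule poly_roots_finite)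
qed

text \<open>Otherwise the vectors \<open>F\<^sup>m w\<close> with \<open>m \<ge> 1\<close> would be eigenvectors of \<open>H\<close> for infinitely many eigenvalues.\<close>

lemma sl2_weight_zero:
  fixes E :: endo
  assumes F: "F \<in> carrier_mat d d" and H: "H \<in> carrier_mat d d" and w: "w \<in> carrier_vec d"
    and rel: "E * emb d F - emb d F * E = emb d H" "emb d H * emb d F - emb d F * emb d H = - (emb d F + emb d F)"
    and P: "E * colm d w = 0" "emb d H * colm d w = 0"
  shows "emb d F * colm d w = 0"
proof (rule ccontr)
  assume ne: "emb d F * colm d w \<noteq> 0"
  note str = sl2_string[OF rel P]
  \<comment> \<open>\<open>E\<close> sends \<open>F^(m+2) w\<close> to \<open>-(m+1)(m+2)\<close>
    times \<open>F^(m+1) w\<close>, so the string never stops once \<open>F w\<close> is nonzero.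
    The induction starts at exponent 1 because \<open>E\<close> kills \<open>F w\<close>.\<close>
  have nz: "emb d F ^ Suc m * colm d w \<noteq> 0" for m
  proof (induction m)
    case 0
    then show ?case using ne by simp
  next
    case (Suc m)
    show ?case
    proof
      assume "emb d F ^ Suc (Suc m) * colm d w = 0"
      then have 0: "sc (- of_nat (Suc m) * of_nat (Suc (Suc m))) * (emb d F ^ Suc m * colm d w) = 0"
        using str[of "Suc m"] by (metis mult_zero_right)
      let ?c = "- of_nat (Suc m) * of_nat (Suc (Suc m)) :: complex"
      have c: "?c \<noteq> 0" by (simp del: of_nat_Suc)
      have "emb d F ^ Suc m * colm d w = sc (1 / ?c) * (sc ?c * (emb d F ^ Suc m * colm d w))"
        unfolding mult.assoc[symmetric] sc_simps(4)[symmetric] using c by (simp add: sc_simps(2))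
      then show False using Suc unfolding 0 by simp
    qed
  qed
  define v where "v m = ((\<lambda>u. F *\<^sub>v u) ^^ m) w" for m
  have v: "v m \<in> carrier_vec d \<and> emb d F ^ m * colm d w = colm d (v m)" for m
  proof (induction m)
    case (Suc m)
    then have "emb d F ^ Suc m * colm d w = emb d F * colm d (v m)" by (simp add: mult.assoc)
    then show ?case using colm_mult[OF F] Suc F by (simp add: v_def)
  qed (simp add: v_def w)
  have "eigenvalue H (- 2 * of_nat (Suc m))" for m
  proof -
    have "colm d (H *\<^sub>v v (Suc m)) = colm d ((- 2 * of_nat (Suc m)) \<cdot>\<^sub>v v (Suc m))"
      using str[of "Suc m"] v[of "Suc m"] colm_mult[OF H, of "v (Suc m)"] colm_smult[of "v (Suc m)"] by metis
    then have "H *\<^sub>v v (Suc m) = (- 2 * of_nat (Suc m)) \<cdot>\<^sub>v v (Suc m)"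
      using v[of "Suc m"] H by (subst (asm) colm_eq_iff) auto
    moreover have "v (Suc m) \<noteq> 0\<^sub>v d" using nz[of m] v[of "Suc m"] colm_zero by metis
    ultimately show ?thesis using v[of "Suc m"] H unfolding eigenvalue_def eigenvector_def
      by (intro exI[of _ "v (Suc m)"]) auto
  qed
  then have "range (\<lambda>m. - 2 * of_nat (Suc m) :: complex) \<subseteq> {k. eigenvalue H k}" by blast
  then have "finite (range (\<lambda>m. - 2 * of_nat (Suc m) :: complex))"
    using finite_eigenvalue[OF H] finite_subset by blast
  moreover have "inj (\<lambda>m. - 2 * of_nat (Suc m) :: complex)" by (auto simp: inj_on_def simp del: of_nat_Suc)
  ultimately show False using finite_imageD by fastforce
qed

end

lemma sum_rect: "p \<le> n \<Longrightarrow> (\<Sum>j<n. rect a p j) = a * p"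
proof -
  assume "p \<le> n"
  then have "(\<Sum>j<n. rect a p j) = (\<Sum>j<p. a)"
    unfolding rect_def by (subst sum.inter_filter[symmetric], simp, intro sum.cong) auto
  then show ?thesis by simp
qed

lemma char_mat_L:
  assumes M: "is_L ty n (rect a p) (d, \<rho>)" and n: "0 < n" and pn: "p \<le> n" and ij: "i < n" "j < n"
  shows "char_mat n (of_nat a) (of_nat p) (ge n ty (\<lambda>u. emb d (\<rho> u)) (of_nat (a * p))) i j = 0"
proof -
  define L where "L u = emb d (\<rho> u)" for u
  define e where "e = ge n ty L (of_nat (a * p))"
  define Q where "Q = char_mat n (of_nat a) (of_nat p) e"
  have irr: "irreducible_module (lie_alg ty n) (d, \<rho>)"
    and hw: "has_highest_weight n (lie_alg ty n) (partition_weight ty n (rect a p)) (d, \<rho>)"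
    using M by (auto simp: is_L_def)
  have d: "0 < d" and lm: "is_lie_module (lie_alg ty n) (d, \<rho>)"
    and simple: "\<And>W. VectorSpace.subspace class_ring W (module_vec TYPE(complex) d) \<Longrightarrow>
      (\<And>u w. u \<in> lie_alg ty n \<Longrightarrow> w \<in> W \<Longrightarrow> \<rho> u *\<^sub>v w \<in> W) \<Longrightarrow> W = {0\<^sub>v d} \<or> W = carrier_vec d"
    using irr by (auto simp: irreducible_module_def)
  have \<rho>: "\<rho> u \<in> carrier_mat d d" if "u \<in> lie_alg ty n" for u using lm that by (auto simp: is_lie_module_def)
  have L: "lierep n ty L" unfolding L_def by (rule lierep_emb[OF d n lm])
  have lin: "linmap ty n L" using L by (simp add: lierep_def[OF n])
  have adj: "adj n e e" unfolding e_def by (rule ge_adj[OF n L])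
  have prE: "pr ty n (Eu n i j) \<in> lie_alg ty n" for i j by (rule pr_lie[OF n]) simp
  obtain v where v: "v \<in> carrier_vec d" "v \<noteq> 0\<^sub>v d"
    and raise: "\<And>u. u \<in> lie_alg ty n \<Longrightarrow> (\<forall>i<n. \<forall>j\<le>i. u $$ (i, j) = 0) \<Longrightarrow> \<rho> u *\<^sub>v v = 0\<^sub>v d"
    and wt: "\<And>h. h \<in> lie_alg ty n \<Longrightarrow> diagonal_mat h \<Longrightarrow>
      \<rho> h *\<^sub>v v = (\<Sum>i<n. partition_weight ty n (rect a p) i * h $$ (i, i)) \<cdot>\<^sub>v v"
    using hw by (auto simp: has_highest_weight_def)
  have R: "e i j * colm d v = 0" if "i < j" "j < n" for i j
  proof -
    have "pr ty n (Eu n i j) = Eu n i j" using that by (intro pr_traceless[OF n]) (auto simp: trace_Eu)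
    moreover have "\<rho> (Eu n i j) *\<^sub>v v = 0\<^sub>v d"
      by (rule raise) (use prE[of i j] \<open>pr ty n (Eu n i j) = _\<close> that in \<open>auto simp: Eu_def\<close>)
    ultimately show ?thesis using that prE[of i j] colm_mult[OF d \<rho> v(1), of "Eu n i j"] colm_zero[OF d]
      by (simp add: e_def ge_def[OF n] L_def sc_simps)
  qed
  \<comment> \<open>For \<open>SL\<close> the weight is the partition shifted by
    \<open>ap/n\<close>, and the scalar added by \<open>ge\<close> shifts it back, so the diagonal
    units act by the parts themselves.\<close>
  have W: "e i i * colm d v = sc (of_nat (rect a p i)) * colm d v" if i: "i < n" for i
  proof -
    let ?h = "pr ty n (Eu n i i)"
    have diag: "diagonal_mat ?h" by (auto simp: diagonal_mat_def pr_def Eu_def)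
    have "(\<Sum>l<n. partition_weight ty n (rect a p) l * ?h $$ (l, l)) + (if ty = SL then of_nat (a * p) / of_nat n else 0)
        = of_nat (rect a p i)"
    proof (cases ty)
      case GL
      have "(\<Sum>l<n. of_nat (rect a p l) * Eu n i i $$ (l, l)) = (\<Sum>l<n. if l = i then of_nat (rect a p i) else (0::complex))"
        by (intro sum.cong) (auto simp: Eu_def)
      then show ?thesis using i GL by (simp add: pr_def)
    next
      case SL
      have sr: "(\<Sum>l<n. of_nat (rect a p l)) = (of_nat (a * p) :: complex)"
        using sum_rect[OF pn, of a] by (metis of_nat_sum)
      have "(\<Sum>l<n. (of_nat (rect a p l) - of_nat (a * p) / of_nat n) * ?h $$ (l, l)) =
          (\<Sum>l<n. (if l = i then of_nat (rect a p l) - of_nat (a * p) / of_nat n else 0)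
            - (of_nat (rect a p l) - of_nat (a * p) / of_nat n) / of_nat n)"
        using i SL by (intro sum.cong) (auto simp: pr_def trace_Eu, auto simp: Eu_def algebra_simps diff_divide_distrib)
      also have "\<dots> = of_nat (rect a p i) - of_nat (a * p) / of_nat n
          - (\<Sum>l<n. of_nat (rect a p l) - of_nat (a * p) / of_nat n) / (of_nat n :: complex)"
        unfolding sum_divide_distrib sum_subtractf[of "\<lambda>l. if l = i then _ l else _"] using i by simp
      also have "(\<Sum>l<n. of_nat (rect a p l) - of_nat (a * p) / of_nat n) = (0 :: complex)"
        using n by (simp only: sum_subtractf sr) simp
      finally show ?thesis using SL by (simp add: sum_rect[OF pn])
    qed
    then have "sc (of_nat (rect a p i)) * colm d v = L ?h * colm d v
        + sc (if ty = SL then of_nat (a * p) / of_nat n else 0) * colm d v"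
      using wt[OF prE diag] colm_mult[OF d \<rho>[OF prE] v(1), of i i] colm_smult[OF d v(1)]
      unfolding L_def by (metis distrib_right sc_simps(3))
    then show ?thesis by (simp add: e_def ge_def[OF n] distrib_right)
  qed
  \<comment> \<open>An sl_2 triple with raising element \<open>e j i\<close>;
    \<open>e j j - e i i\<close> kills \<open>v\<close> because the parts at \<open>i\<close> and
    \<open>j\<close> are both \<open>a\<close> or both 0.\<close>
  have low: "e i j * colm d v = 0" if ij: "j < i" "i < n" "i < p \<or> p \<le> j" for i j
  proof -
    let ?H = "\<rho> (pr ty n (Eu n j j)) - \<rho> (pr ty n (Eu n i i))"
    have H: "?H \<in> carrier_mat d d" by (rule minus_carrier_mat[OF \<rho>[OF prE]])
    have eH: "e j j - e i i = emb d ?H"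
      using emb_diff[OF d \<rho>[OF prE] \<rho>[OF prE]] by (simp add: e_def ge_def[OF n] L_def)
    have eF: "e i j = emb d (\<rho> (pr ty n (Eu n i j)))" using ij by (simp add: e_def ge_def[OF n] L_def sc_simps)
    have rel1: "e j i * e i j - e i j * e j i = e j j - e i i"
      using adjD[OF adj, of j i i j] ij by simp
    have rel2: "(e j j - e i i) * e i j - e i j * (e j j - e i i) = - (e i j + e i j)"
      using adjD[OF adj, of j j i j] adjD[OF adj, of i i i j] ij by (simp add: left_diff_distrib right_diff_distrib)
    have z: "(e j j - e i i) * colm d v = 0"
      unfolding left_diff_distrib W[OF ij(2)] W[OF less_trans[OF ij(1,2)]] using ij by (auto simp: rect_def)
    have "emb d (\<rho> (pr ty n (Eu n i j))) * colm d v = 0"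
    proof (rule sl2_weight_zero[OF d \<rho>[OF prE] H v(1), where E = "e j i"])
    qed (simp_all only: eF[symmetric] eH[symmetric] rel1 rel2 z R[OF ij(1,2)])
    then show ?thesis unfolding eF .
  qed
  define K where "K = {w \<in> carrier_vec d. \<forall>i<n. \<forall>j<n. Q i j * colm d w = 0}"
  have sub: "VectorSpace.subspace class_ring K (module_vec TYPE(complex) d)"
  proof -
    interpret vec_space "TYPE(complex)" d .
    show ?thesis
      by (unfold_locales)
        (auto simp: K_def module_vec_simps class_ring_simps colm_add[OF d] colm_smult[OF d] colm_zero[OF d] distrib_left sc_comm_left[of "Q i j" for i j])
  qed
  have Qadj: "adj n e Q" unfolding Q_def by (rule char_mat_adj[OF adj])
  have "\<rho> u *\<^sub>v w \<in> K" if u: "u \<in> lie_alg ty n" and w: "w \<in> K" for u w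
  proof -
    have w': "w \<in> carrier_vec d" "\<And>i j. i < n \<Longrightarrow> j < n \<Longrightarrow> Q i j * colm d w = 0" using w by (auto simp: K_def)
    \<comment> \<open>\<open>Q i j\<close> can be moved past \<open>e s t\<close> at the cost of
      other entries of \<open>Q\<close>, and all of them kill \<open>w\<close>.\<close>
    have Qe: "Q i j * (e s t * colm d w) = 0" if l: "i < n" "j < n" "s < n" "t < n" for i j s t
    proof -
      have "Q i j * e s t = e s t * Q i j - ((if t = i then Q s j else 0) - (if s = j then Q i t else 0))"
        using adjD[OF Qadj l(3,4,1,2)] by simp
      then have "Q i j * (e s t * colm d w) =
          (e s t * Q i j - ((if t = i then Q s j else 0) - (if s = j then Q i t else 0))) * colm d w"
        by (metis mult.assoc)
      also have "\<dots> = 0" using w'(2) l by (auto simp: left_diff_distrib mult.assoc)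
      finally show ?thesis .
    qed
    have QL: "Q i j * (L (pr ty n (Eu n s t)) * colm d w) = 0" if l: "i < n" "j < n" "s < n" "t < n" for i j s t
    proof -
      have "L (pr ty n (Eu n s t)) * colm d w = e s t * colm d w - sc (if ty = SL \<and> s = t then of_nat (a * p) / of_nat n else 0) * colm d w"
        by (simp add: e_def ge_def[OF n] algebra_simps)
      then show ?thesis using Qe[OF l] w'(2)[OF l(1,2)] by (simp add: right_diff_distrib sc_comm_left[of "Q i j"])
    qed
    have "Q i j * (L u * colm d w) = 0" if "i < n" "j < n" for i j
    proof -
      have "L u = (\<Sum>s<n. \<Sum>t<n. sc (u $$ (s, t)) * L (pr ty n (Eu n s t)))"
        using linmap_pr_expand[OF n lin lie_alg_carrier[OF u]] pr_id[OF n u] by simp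
      then have "Q i j * (L u * colm d w) = (\<Sum>s<n. \<Sum>t<n. sc (u $$ (s, t)) * (Q i j * (L (pr ty n (Eu n s t)) * colm d w)))"
        by (simp add: sum_distrib_left sum_distrib_right mult.assoc sc_comm_left[of "Q i j"])
      then show ?thesis using QL that by simp
    qed
    then show ?thesis using \<rho>[OF u] w' colm_mult[OF d \<rho>[OF u] w'(1)] by (simp add: K_def L_def)
  qed
  from simple[OF sub this] have "K = {0\<^sub>v d} \<or> K = carrier_vec d" .
  moreover have "v \<in> K"
  proof -
    have "Q i j * colm d v = 0" if "i < n" "j < n" for i j
      unfolding Q_def
    proof (rule char_mat_highest[OF adj pn R _ low that])
      show "e i i * colm d v = (if i < p then sc (of_nat a) * colm d v else 0)" if "i < n" for i
        using W[OF that] by (simp add: rect_def sc_simps)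
    qed
    then show ?thesis using v by (simp add: K_def)
  qed
  ultimately have "K = carrier_vec d" using v by blast
  then have "Q i j * colm d w = 0" if "w \<in> carrier_vec d" for w using that ij by (auto simp: K_def)
  from zero_of_colm[OF d this] show ?thesis unfolding Q_def e_def L_def .
qed

section \<open>The relations of the braid algebra and the Hecke algebra\<close>

text \<open>The \<open>i\<close>-th copy of \<open>V\<close> is the tensor factor with number \<open>i + 1\<close>.\<close>

definition up :: "(nat \<Rightarrow> nat) \<Rightarrow> nat \<Rightarrow> nat" where
  "up w f = (case f of 0 \<Rightarrow> 0 | Suc i \<Rightarrow> Suc (w i))"

lemma up_simps: "up w 0 = 0" "up w (Suc i) = Suc (w i)"
  by (auto simp: up_def)

lemma up_id: "up id = id"
  by (auto simp: up_def fun_eq_iff split: nat.split)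

lemma up_comp: "up (w \<circ> w') = up w \<circ> up w'"
  by (auto simp: up_def fun_eq_iff split: nat.split)

lemma up_transpose: "up (transpose i j) = transpose (Suc i) (Suc j)"
  by (auto simp: up_def fun_eq_iff transpose_def split: nat.split)

text \<open>The factors on which \<open>kappa\<close> with index \<open>j\<close> acts, the first
  \<open>j\<close> copies of V having the numbers 2 to \<open>j + 1\<close>.\<close>

definition Fs :: "nat set \<Rightarrow> nat \<Rightarrow> nat set" where
  "Fs A j = A \<union> {2..Suc j}"

lemma up_ss: "up (ss i) = transpose (Suc i) (Suc (Suc i))"
  by (simp add: up_transpose)

lemma Fs_Suc: "1 \<le> j \<Longrightarrow> Fs A j = insert (Suc j) (Fs A (j - 1))"
  by (auto simp: Fs_def)

text \<open>The properties of the permutation action from which all relations except the quadratic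
  ones follow without further reference to matrices. \<open>z\<close> is the constant added in
  \<open>z_0\<close>.\<close>

locale swap_family = gl_family n "k + 2" e for n k e +
  fixes T :: "(nat \<Rightarrow> nat) \<Rightarrow> endo" and z :: complex
  assumes T_e: "w permutes {1..k} \<Longrightarrow> f < k + 2 \<Longrightarrow> i < n \<Longrightarrow> j < n \<Longrightarrow> T w * e f i j = e (up w f) i j * T w"
    and T_id: "T id = 1"
    and T_mult: "w permutes {1..k} \<Longrightarrow> w' permutes {1..k} \<Longrightarrow> T w * T w' = T (w \<circ> w')"
    and T_transpose: "i \<in> {1..k} \<Longrightarrow> j \<in> {1..k} \<Longrightarrow> i \<noteq> j \<Longrightarrow> T (transpose i j) = cg n (e (Suc i)) (e (Suc j))"
begin

text \<open>The elements \<open>x\<^sub>i\<close>, \<open>y\<^sub>i\<close> and \<open>z\<^sub>i\<close> with \<open>i \<ge> 1\<close> act by \<open>W {0} i\<close>, \<open>W {1} i\<close> and \<open>W {0, 1} i\<close>.\<close>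

definition W :: "nat set \<Rightarrow> nat \<Rightarrow> endo" where
  "W A i = Ga (Fs A (i - 1)) (Suc i)"

definition Z :: "nat \<Rightarrow> endo" where
  "Z i = (if i = 0 then cg n (e 0) (e 1) + sc z else W {0, 1} i)"

lemma tr_permutes: "i \<in> {1..<k} \<Longrightarrow> ss i permutes {1..k}" "i \<in> {1..k} \<Longrightarrow> j \<in> {1..k} \<Longrightarrow> transpose i j permutes {1..k}"
  by (auto intro: permutes_swap_id)

lemma T_square: assumes "i \<in> {1..k}" "j \<in> {1..k}" shows "T (transpose i j) * T (transpose i j) = 1"
  using T_mult[OF tr_permutes(2)[OF assms] tr_permutes(2)[OF assms]] by (simp add: T_id)

lemma W_comm:
  assumes "A \<subseteq> {0, 1}" "i \<in> {1..k}" "j \<in> {1..k}" shows "cm (W A i) (W A j)"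
proof -
  have "cm (W A i) (W A j)" if "i < j" "1 \<le> i" "j \<le> k" for i j
    unfolding W_def by (rule Ga_Ga_comm) (use assms(1) that in \<open>auto simp: Fs_def\<close>)
  then show ?thesis using assms by (cases i j rule: linorder_cases) auto
qed

text \<open>Conjugation carries the factor \<open>i + 1\<close> to \<open>i + 2\<close> and
  preserves the set of earlier ones. Compared with \<open>W A (i + 1)\<close>, the term of the two
  exchanged copies is missing; it equals \<open>T (ss i)\<close>, whose square gives the 1.\<close>

lemma T_W:
  assumes A: "A \<subseteq> {0, 1}" and i: "i \<in> {1..<k}"
  shows "T (ss i) * W A i = W A (i + 1) * T (ss i) - 1"
proof -
  let ?T = "T (ss i)" and ?F = "Fs A (i - 1)"
  have Fim: "up (ss i) ` ?F = ?F"
    unfolding up_ss using A i by (intro image_cong[THEN trans, OF refl _ image_ident]) (auto simp: Fs_def transpose_def)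
  have "?T * W A i = Ga (up (ss i) ` ?F) (up (ss i) (Suc i)) * ?T"
    unfolding W_def by (rule T_Ga[OF T_e[OF tr_permutes(1)[OF i]]]) (use A i in \<open>auto simp: Fs_def up_transpose intro: inj_on_subset[OF inj_transpose]\<close>)
  also have "\<dots> = Ga ?F (Suc (Suc i)) * ?T" unfolding Fim by (simp add: up_transpose)
  finally have 1: "?T * W A i = Ga ?F (Suc (Suc i)) * ?T" .
  have fin: "finite ?F" using A finite_subset by (auto simp: Fs_def)
  have "W A (i + 1) = Ga (insert (Suc i) ?F) (Suc (Suc i))" using i Fs_Suc[of i A] by (simp add: W_def)
  also have "\<dots> = cg n (e (Suc i)) (e (Suc (Suc i))) + Ga ?F (Suc (Suc i))"
    unfolding Ga_sum using fin A i by (subst sum.insert) (auto simp: Fs_def)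
  also have "cg n (e (Suc i)) (e (Suc (Suc i))) = ?T" using T_transpose[of i "i + 1"] i by simp
  finally have "W A (i + 1) = ?T + Ga ?F (Suc (Suc i))" .
  then show ?thesis unfolding 1 using T_square[of i "i + 1"] i by (simp add: algebra_simps)
qed

text \<open>The result does not depend on \<open>A\<close>, whence the agreement of the x- and
  y-expressions; it also shows that \<open>m_{i,i+1}\<close> acts as \<open>s_i\<close>.\<close>

lemma W_conj:
  assumes "A \<subseteq> {0, 1}" "i \<in> {1..<k}"
  shows "W A (i + 1) - T (ss i) * W A i * T (ss i) = T (ss i)"
  unfolding T_W[OF assms] using T_square[of i "i + 1"] assms(2) by (simp add: algebra_simps)

lemma T_W_sum:
  assumes A: "A \<subseteq> {0, 1}" and i: "i \<in> {1..<k}"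
  shows "cm (T (ss i)) (W A i + W A (i + 1))"
proof -
  let ?T = "T (ss i)"
  have TT: "?T * ?T = 1" using T_square[of i "i + 1"] i by simp
  \<comment> \<open>Multiplying \<open>T_W\<close> by the involution on both sides gives the
    mirrored relation; the two constants 1 then cancel in the sum.\<close>
  have "W A i * ?T = ?T * (?T * W A i) * ?T" unfolding mult.assoc[symmetric] TT by simp
  also have "\<dots> = ?T * W A (i + 1) * (?T * ?T) - ?T * ?T" unfolding T_W[OF assms]
    by (simp add: right_diff_distrib left_diff_distrib mult.assoc)
  finally have "W A i * ?T = ?T * W A (i + 1) - 1" unfolding TT by simp
  then show ?thesis using T_W[OF assms] by (simp add: distrib_left distrib_right)
qed

lemma T_W_comm:
  assumes A: "A \<subseteq> {0, 1}" and i: "i \<in> {1..<k}" and j: "j \<in> {1..k} - {i, i + 1}"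
  shows "cm (T (ss i)) (W A j)"
proof -
  have Fim: "up (ss i) ` Fs A (j - 1) = Fs A (j - 1)"
  \<comment> \<open>For \<open>j < i\<close> both exchanged factors lie outside the set, whose
    elements are fixed; for \<open>j > i + 1\<close> both lie inside.\<close>
  proof (cases "j < i")
    case True
    then show ?thesis unfolding up_ss using A i j
      by (intro image_cong[THEN trans, OF refl _ image_ident]) (auto simp: Fs_def transpose_def)
  next
    case False
    then show ?thesis unfolding up_ss using i j by (subst transpose_image_eq) (auto simp: Fs_def)
  qed
  have "T (ss i) * W A j = Ga (up (ss i) ` Fs A (j - 1)) (up (ss i) (Suc j)) * T (ss i)"
    unfolding W_def by (rule T_Ga[OF T_e[OF tr_permutes(1)[OF i]]]) (use A i j in \<open>auto simp: Fs_def up_transpose intro: inj_on_subset[OF inj_transpose]\<close>)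
  then show ?thesis unfolding Fim W_def using j by (simp add: up_transpose transpose_def)
qed

lemma T_Z_comm:
  assumes i: "i \<in> {1..<k}" and j: "j \<in> {0..k} - {i, i + 1}"
  shows "cm (T (ss i)) (Z j)"
proof (cases "j = 0")
  case True
  have "cm (T (ss i)) (cg n (e 0) (e 1))"
    using T_cg[OF T_e[OF tr_permutes(1)[OF i]], of 0 1] i by (simp add: up_transpose transpose_def)
  then have "cm (T (ss i)) (cg n (e 0) (e 1) + sc z)" by (rule cm_add[OF _ cm_sc])
  then show ?thesis using True by (simp add: Z_def)
next
  case False
  then show ?thesis using T_W_comm[of "{0, 1}" i j] i j by (simp add: Z_def)
qed

text \<open>In the order M, N, V_1, V_2, ... all \<open>z_i\<close>, including \<open>z_0\<close>,
  form one chain of Jucys-Murphy type elements.\<close>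

lemma Z_chain: "Z i = Ga {0..i} (Suc i) + (if i = 0 then sc z else 0)"
proof (cases "i = 0")
  case True
  have "De {0..0} = e 0" by (intro ext) (simp add: De_def)
  with True show ?thesis by (simp add: Z_def)
next
  case False
  then have "Fs {0, 1} (i - 1) = {0..i}" by (auto simp: Fs_def)
  with False show ?thesis by (simp add: Z_def W_def)
qed

lemma Z_comm: assumes "i \<in> {0..k}" "j \<in> {0..k}" shows "cm (Z i) (Z j)"
proof -
  have "cm (Z i) (Z j)" if "i < j" "j \<le> k" for i j
  proof -
    have "cm (Ga {0..i} (Suc i)) (Ga {0..j} (Suc j))" by (rule Ga_Ga_comm) (use that in auto)
    then show ?thesis using that unfolding Z_chain
      by (simp add: distrib_left distrib_right sc_comm[of "Ga {0..j} (Suc j)"])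
  qed
  then show ?thesis using assms by (cases i j rule: linorder_cases) auto
qed

lemma Z_sum_comm:
  assumes A: "A \<subseteq> {0, 1}" and i: "i \<in> {1..k}" and j: "j \<in> {1..i}"
  shows "cm (\<Sum>l\<in>{0..i}. Z l) (W A j)"
proof -
  have "(\<Sum>l\<in>{0..i}. Z l) = (\<Sum>l<Suc i. Ga {0..l} (Suc l)) + sc z"
    unfolding Z_chain sum.distrib by (simp add: atLeast0AtMost lessThan_Suc_atMost)
  moreover have "cm (\<Sum>l<Suc i. Ga {0..l} (Suc l)) (W A j)"
    unfolding W_def Ga_sum[of _ "Suc j"] by (rule cm_sum, rule chain_sum_comm) (use A i j in \<open>auto simp: Fs_def\<close>)
  ultimately show ?thesis by (simp add: distrib_left distrib_right sc_comm[of "W A j"])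
qed

lemma T_conj:
  assumes "i \<in> {1..k}" "j \<in> {1..k}" "l \<in> {1..k}" "i \<noteq> l" "j \<noteq> l" "i \<noteq> j"
  shows "T (transpose i j) * T (transpose j l) * T (transpose i j) = T (transpose i l)"
proof -
  have "transpose i j \<circ> transpose j l \<circ> transpose i j = transpose i l"
    using assms by (auto simp: fun_eq_iff transpose_def)
  moreover have "transpose i j permutes {1..k}" "transpose j l permutes {1..k}"
    by (rule tr_permutes(2); use assms in auto)+
  ultimately show ?thesis by (simp add: T_mult permutes_compose)
qed

lemma T_braid:
  assumes "1 \<le> i" "i + 2 \<le> k"
  shows "T (ss i) * T (ss (i + 1)) * T (ss i) * T (ss (i + 1)) * T (ss i) = T (ss (i + 1))"
proof -
  have "ss i \<circ> ss (i + 1) \<circ> ss i \<circ> ss (i + 1) \<circ> ss i = ss (i + 1)"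
    by (auto simp: fun_eq_iff transpose_def)
  moreover have "ss i permutes {1..k}" "ss (i + 1) permutes {1..k}" by (rule tr_permutes(2); use assms in auto)+
  ultimately show ?thesis by (simp add: T_mult permutes_compose)
qed

lemma W_braid:
  assumes A: "A \<subseteq> {0, 1}" and i: "1 \<le> i" "i + 2 \<le> k"
  shows "T (ss i) * T (ss (i + 1)) * (W A (i + 1) - T (ss i) * W A i * T (ss i)) * T (ss (i + 1)) * T (ss i) =
    W A (i + 2) - T (ss (i + 1)) * W A (i + 1) * T (ss (i + 1))"
proof -
  have b: "i \<in> {1..<k}" "i + 1 \<in> {1..<k}" "i + 1 + 1 = i + 2" using i by auto
  have "W A (i + 2) - T (ss (i + 1)) * W A (i + 1) * T (ss (i + 1)) = T (ss (i + 1))"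
    using W_conj[OF A b(2)] unfolding b(3) .
  then show ?thesis unfolding W_conj[OF A b(1)] T_braid[OF i] ..
qed

text \<open>In \<open>x_i + y_i\<close> the terms with the earlier copies of V occur twice;
  \<open>m_i\<close>, the sum of the corresponding transpositions, removes one of each.\<close>

lemma Z_eq:
  assumes i: "i \<in> {1..k}"
  shows "Z i = W {0} i + W {1} i - (\<Sum>j\<in>{1..<i}. T (transpose j i))"
proof -
  have "(\<Sum>j\<in>{1..<i}. T (transpose j i)) = (\<Sum>j\<in>{1..<i}. cg n (e (Suc j)) (e (Suc i)))"
    using i by (intro sum.cong refl T_transpose) auto
  also have "\<dots> = (\<Sum>f\<in>Suc ` {1..<i}. cg n (e f) (e (Suc i)))" by (subst sum.reindex) auto
  also have "Suc ` {1..<i} = {2..Suc (i - 1)}"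
    using i by (auto simp: image_iff Bex_def)
  finally have 1: "(\<Sum>j\<in>{1..<i}. T (transpose j i)) = Ga {2..Suc (i - 1)} (Suc i)" unfolding Ga_sum .
  have W: "W A i = (\<Sum>f\<in>A. cg n (e f) (e (Suc i))) + Ga {2..Suc (i - 1)} (Suc i)" if "A \<subseteq> {0, 1}" for A
    unfolding W_def Fs_def Ga_sum using that finite_subset[OF that] by (intro sum.union_disjoint) auto
  show ?thesis using i W[of "{0, 1}"] W[of "{0}"] W[of "{1}"] 1 by (simp add: Z_def)
qed

end

section \<open>The operators on the tensor space\<close>

text \<open>On the factors V the action comes from the associative matrix algebra; this supplies the
  Casimir value and the products of matrix units, which the Lie relations alone do not
  determine.\<close>

definition mat_hom :: "nat \<Rightarrow> (complex mat \<Rightarrow> endo) \<Rightarrow> bool" where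
  "mat_hom n \<iota> \<longleftrightarrow> linmap GL n \<iota> \<and> \<iota> (1\<^sub>m n) = 1 \<and>
     (\<forall>A\<in>carrier_mat n n. \<forall>B\<in>carrier_mat n n. \<iota> (A * B) = \<iota> A * \<iota> B)"

lemma mat_hom_emb: assumes n: "0 < n" shows "mat_hom n (emb n)"
  by (auto simp: mat_hom_def linmap_def emb_simps[OF n])

lemma mat_hom_onf:
  assumes f: "f < length ds" "ds ! f = n" and D: "0 < prod_list ds"
  shows "mat_hom n (\<lambda>A. emb (prod_list ds) (onf ds f A))"
proof -
  have car: "onf ds f A \<in> carrier_mat (prod_list ds) (prod_list ds)" if "A \<in> carrier_mat n n" for A
    using onf_carrier[OF f(1)] that f by simp
  show ?thesis
    using onf_add[OF f(1)] onf_smult[OF f(1)] onf_mult[OF f(1)] onf_one[OF f(1)] unfolding f(2)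
    by (auto simp: mat_hom_def linmap_def emb_simps[OF D] car simp flip: emb_mult[OF D])
qed

lemma mat_hom_one: assumes n: "0 < n" and \<iota>: "mat_hom n \<iota>" shows "(\<Sum>i<n. \<iota> (Eu n i i)) = 1"
proof -
  have "\<iota> (1\<^sub>m n) = (\<Sum>i<n. \<Sum>j<n. sc (1\<^sub>m n $$ (i, j)) * \<iota> (Eu n i j))"
    by (rule linmap_expand) (use \<iota> in \<open>auto simp: mat_hom_def\<close>)
  also have "\<dots> = (\<Sum>i<n. \<Sum>j<n. if j = i then \<iota> (Eu n i i) else 0)"
    by (intro sum.cong refl) (auto simp: sc_simps)
  finally show ?thesis using \<iota> by (simp add: mat_hom_def)
qed

lemma linmap_GL_imp: "linmap GL n L \<Longrightarrow> linmap ty n L"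
  using lie_alg_carrier unfolding linmap_def by auto

text \<open>The identity matrix already acts as 1 on V, so the extension with scalar 1 gives back
  the matrix units.\<close>

lemma ge_mat_hom: assumes n: "0 < n" and \<iota>: "mat_hom n \<iota>" and ij: "i < n" "j < n"
  shows "ge n ty \<iota> 1 i j = \<iota> (Eu n i j)"
proof (cases ty)
  case SL
  define c where "c = trace (Eu n i j) / of_nat n"
  have "pr ty n (Eu n i j) = Eu n i j - c \<cdot>\<^sub>m 1\<^sub>m n" using SL by (simp add: pr_def c_def)
  then have "\<iota> (pr ty n (Eu n i j)) = \<iota> (Eu n i j) - \<iota> (c \<cdot>\<^sub>m 1\<^sub>m n)"
    using linmap_diff[OF n, of GL \<iota> "Eu n i j" "c \<cdot>\<^sub>m 1\<^sub>m n"] \<iota> by (simp add: mat_hom_def)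
  also have "\<iota> (c \<cdot>\<^sub>m 1\<^sub>m n) = sc c" using \<iota> by (simp add: mat_hom_def linmap_def)
  finally show ?thesis using SL ij by (simp add: ge_def[OF n] c_def trace_Eu sc_simps)
qed (simp add: ge_def[OF n] pr_def sc_simps)

lemma cg_cong: "(\<And>i j. i < n \<Longrightarrow> j < n \<Longrightarrow> e i j = e' i j) \<Longrightarrow> (\<And>i j. i < n \<Longrightarrow> j < n \<Longrightarrow> u i j = u' i j) \<Longrightarrow>
    cg n e u = cg n e' u'"
  by (simp add: cg_def)

lemma cg_mat_hom: assumes n: "0 < n" and \<iota>: "mat_hom n \<iota>"
  shows "cg n (\<lambda>i j. \<iota> (Eu n i j)) (\<lambda>i j. \<iota> (Eu n i j)) = sc (of_nat n)"
proof -
  have "\<iota> (Eu n i j) * \<iota> (Eu n j i) = \<iota> (Eu n i i)" if "i < n" "j < n" for i j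
    using \<iota> that Eu_mult[of i n j j i] by (simp add: mat_hom_def) (metis Eu_carrier(1))
  then have "cg n (\<lambda>i j. \<iota> (Eu n i j)) (\<lambda>i j. \<iota> (Eu n i j)) = (\<Sum>i<n. \<Sum>j<n. \<iota> (Eu n i i))"
    unfolding cg_def by (intro sum.cong) auto
  then show ?thesis using mat_hom_one[OF assms] by (simp add: sc_of_nat flip: sum_distrib_left)
qed

text \<open>Linearity in one slot, whose dimension may be that of several factors taken
  together.\<close>

lemma tensor_slot:
  assumes D: "0 < prod_list (ds @ d # ds')" and As: "sq ds As" "sq ds' Bs"
    and C: "C \<in> carrier_mat d d" "\<And>s. s \<in> S \<Longrightarrow> F s \<in> carrier_mat d d"
    and CF: "\<And>i j. i < d \<Longrightarrow> j < d \<Longrightarrow> C $$ (i, j) = (\<Sum>s\<in>S. F s $$ (i, j))"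
  shows "emb (prod_list (ds @ d # ds')) (tensor (As @ C # Bs)) =
    (\<Sum>s\<in>S. emb (prod_list (ds @ d # ds')) (tensor (As @ F s # Bs)))"
proof (rule emb_sum_entries[OF D])
  let ?ds = "ds @ d # ds'"
  have sq: "sq ?ds (As @ X # Bs)" if "X \<in> carrier_mat d d" for X
    using As that by (auto intro: list_all2_appendI)
  have len: "length As = length ds" using As list_all2_lengthD by metis
  show "tensor (As @ C # Bs) \<in> carrier_mat (prod_list ?ds) (prod_list ?ds)" by (rule tensor_carrier[OF sq[OF C(1)]])
  show "tensor (As @ F s # Bs) \<in> carrier_mat (prod_list ?ds) (prod_list ?ds)" if "s \<in> S" for s
    by (rule tensor_carrier[OF sq[OF C(2)[OF that]]])
  fix i j assume ij: "i < prod_list ?ds" "j < prod_list ?ds"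
  let ?l = "length ds"
  define c where "c = (\<Prod>f\<in>{..<length ?ds} - {?l}. (As @ C # Bs) ! f $$ (dec ?ds i ! f, dec ?ds j ! f))"
  have t: "tensor (As @ X # Bs) $$ (i, j) = X $$ (dec ?ds i ! ?l, dec ?ds j ! ?l) * c" if X: "X \<in> carrier_mat d d" for X
  proof -
    have "tensor (As @ X # Bs) $$ (i, j) = (\<Prod>f<length ?ds. (As @ X # Bs) ! f $$ (dec ?ds i ! f, dec ?ds j ! f))"
      by (rule tensor_entry[OF sq[OF X] ij])
    also have "\<dots> = (As @ X # Bs) ! ?l $$ (dec ?ds i ! ?l, dec ?ds j ! ?l) *
        (\<Prod>f\<in>{..<length ?ds} - {?l}. (As @ X # Bs) ! f $$ (dec ?ds i ! f, dec ?ds j ! f))"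
      by (rule prod.remove) auto
    also have "(\<Prod>f\<in>{..<length ?ds} - {?l}. (As @ X # Bs) ! f $$ (dec ?ds i ! f, dec ?ds j ! f)) = c"
      unfolding c_def by (intro prod.cong refl) (auto simp: nth_append nth_Cons' len)
    finally show ?thesis by (simp add: len[symmetric])
  qed
  have "dec ?ds i ! ?l < d" "dec ?ds j ! ?l < d"
    using dec_less[OF ij(1), of ?l] dec_less[OF ij(2), of ?l] by auto
  then show "tensor (As @ C # Bs) $$ (i, j) = (\<Sum>s\<in>S. tensor (As @ F s # Bs) $$ (i, j))"
    using t[OF C(1)] t[OF C(2)] CF by (simp add: sum_distrib_right)
qed

section \<open>The data of the theorem and the action of the generators\<close>

locale hecke_data =
  fixes ty :: lie_type and k n a b p q r :: nat
    and M N :: lie_module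
    and B B' :: "nat \<Rightarrow> complex mat"
    and c\<^sub>x c\<^sub>y c\<^sub>z d :: complex
  assumes k: "1 \<le> k" and q: "0 < q"
    and params: "(ty = GL \<and> p + q \<le> n \<and>
            c\<^sub>x = - (1/2) * of_nat n \<and> c\<^sub>y = - (1/2) * of_nat n \<and> d = 0) \<or>
         (ty = SL \<and> p + q \<le> n - 1 \<and>
            c\<^sub>x = of_nat (a * p) / of_nat n - (1/2) * (of_nat n - 1 / of_nat n) \<and>
            c\<^sub>y = of_nat (b * q) / of_nat n - (1/2) * (of_nat n - 1 / of_nat n) \<and>
            d = 1 / of_nat n)"
    and M: "is_L ty n (rect a p) M" and N: "is_L ty n (rect b q) N"
    and B: "dual_bases ty n r B B'"
begin

definition "Ms = factors n k M N"
definition "ds = map fst Ms"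
definition "D = prod_list ds"

lemma n: "0 < n" and pn: "p \<le> n" and qn: "q \<le> n"
  using params q by auto

lemma len [simp]: "length Ms = k + 2" "length ds = k + 2"
  by (auto simp: Ms_def ds_def factors_def)

lemma Ms_nth: "Ms ! 0 = M" "Ms ! 1 = N" "2 \<le> f \<Longrightarrow> f < k + 2 \<Longrightarrow> Ms ! f = std_module n"
  by (auto simp: Ms_def factors_def nth_Cons')

lemma ds_nth: "f < k + 2 \<Longrightarrow> ds ! f = fst (Ms ! f)" "2 \<le> f \<Longrightarrow> f < k + 2 \<Longrightarrow> ds ! f = n"
  using Ms_nth(3)[of f] by (simp_all add: ds_def std_module_def)

lemma ds_eq: "ds = fst M # fst N # replicate k n"
  by (simp add: ds_def Ms_def factors_def std_module_def)

lemma tensor_dim: "tensor_dim Ms = D"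
  by (simp add: tensor_dim_def D_def ds_def)

lemma fst_MNV: "fst (MNV n k M N) = D"
  by (simp add: MNV_def tensor_module_def Ms_def[symmetric] tensor_dim)

lemma irreducible: "irreducible_module (lie_alg ty n) M" "irreducible_module (lie_alg ty n) N"
  using M N by (auto simp: is_L_def)

lemma D: "0 < D"
proof -
  have "0 < fst M" "0 < fst N" using irreducible by (auto simp: irreducible_module_def)
  then have "0 \<notin> set ds" using n by (auto simp: ds_eq)
  then show ?thesis unfolding D_def by (intro Nat.gr0I) (metis prod_list_zero_iff)
qed

lemma Ms_module: "f < k + 2 \<Longrightarrow> is_lie_module (lie_alg ty n) (Ms ! f)"
proof -
  assume f: "f < k + 2"
  have std: "is_lie_module (lie_alg ty n) (std_module n)"
    using lie_alg_carrier by (auto simp: is_lie_module_def std_module_def)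
  consider "f = 0" | "f = 1" | "2 \<le> f" by linarith
  then show ?thesis using irreducible std Ms_nth f by cases (auto simp: irreducible_module_def)
qed

lemma rho_carrier: "f < k + 2 \<Longrightarrow> u \<in> lie_alg ty n \<Longrightarrow> snd (Ms ! f) u \<in> carrier_mat (ds ! f) (ds ! f)"
  using Ms_module[of f] ds_nth(1)[of f] by (cases "Ms ! f") (auto simp: is_lie_module_def)

definition L :: "nat \<Rightarrow> complex mat \<Rightarrow> endo" where
  "L f u = emb D (onf ds f (snd (Ms ! f) u))"

text \<open>The scalars by which the identity matrix acts when the tensor factors are extended to \<open>gl\<^sub>n\<close>; they
  play no role for \<open>ty = GL\<close>.\<close>

definition s :: "nat \<Rightarrow> complex" where
  "s f = (if f = 0 then of_nat (a * p) else if f = 1 then of_nat (b * q) else 1)"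

definition e :: "nat \<Rightarrow> nat \<Rightarrow> nat \<Rightarrow> endo" where
  "e f = ge n ty (L f) (s f)"

lemma onfD: "f < k + 2 \<Longrightarrow> A \<in> carrier_mat (ds ! f) (ds ! f) \<Longrightarrow> onf ds f A \<in> carrier_mat D D"
  unfolding D_def by (rule onf_carrier) auto

lemma hom_onf: "f < k + 2 \<Longrightarrow> mat_hom (ds ! f) (\<lambda>A. emb D (onf ds f A))"
  using mat_hom_onf[of f ds "ds ! f"] D by (auto simp: D_def)

lemma lierep_L: assumes f: "f < k + 2" shows "lierep n ty (L f)"
proof -
  let ?i = "\<lambda>A. emb D (onf ds f A)" and ?\<rho> = "snd (Ms ! f)"
  have hom: "mat_hom (ds ! f) ?i" by (rule hom_onf[OF f])
  have df: "0 < ds ! f" using D f unfolding D_def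
    by (metis gr0I len(2) nth_mem prod_list_zero_iff neq0_conv)
  have diff: "?i (A - C) = ?i A - ?i C" if "A \<in> carrier_mat (ds ! f) (ds ! f)" "C \<in> carrier_mat (ds ! f) (ds ! f)" for A C
    using linmap_diff[OF df, of GL ?i A C] hom that by (simp add: mat_hom_def)
  have "is_lie_module (lie_alg ty n) (ds ! f, ?\<rho>)" using Ms_module[OF f] ds_nth(1)[OF f] by (simp add: prod.collapse)
  then have car: "?\<rho> u \<in> carrier_mat (ds ! f) (ds ! f)" and rho: "?\<rho> (u + v) = ?\<rho> u + ?\<rho> v" "?\<rho> (c \<cdot>\<^sub>m u) = c \<cdot>\<^sub>m ?\<rho> u"
      "?\<rho> (u * v - v * u) = ?\<rho> u * ?\<rho> v - ?\<rho> v * ?\<rho> u" if "u \<in> lie_alg ty n" "v \<in> lie_alg ty n" for u v c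
    using that by (auto simp: is_lie_module_def)
  have i: "?i (X + Y) = ?i X + ?i Y" "?i (c \<cdot>\<^sub>m X) = sc c * ?i X" "?i (X * Y) = ?i X * ?i Y"
    if "X \<in> carrier_mat (ds ! f) (ds ! f)" "Y \<in> carrier_mat (ds ! f) (ds ! f)" for X Y c
    using hom that by (auto simp: mat_hom_def linmap_def)
  show ?thesis unfolding lierep_def[OF n] linmap_def L_def
    by (intro conjI ballI allI)
      (simp_all add: rho(1,3) rho(2)[OF _ zero_lie[OF n]] i car car[OF _ zero_lie[OF n]] i(2)[OF _ zero_carrier_mat] diff mult_carrier_mat[OF car car])
qed

lemma linmap_L: "f < k + 2 \<Longrightarrow> linmap ty n (L f)"
  using lierep_L lierep_def[OF n] by blast

lemma L_comm:
  assumes "f < k + 2" "g < k + 2" "f \<noteq> g" "u \<in> lie_alg ty n" "v \<in> lie_alg ty n"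
  shows "cm (L f u) (L g v)"
proof -
  have "onf ds f (snd (Ms ! f) u) * onf ds g (snd (Ms ! g) v) = onf ds g (snd (Ms ! g) v) * onf ds f (snd (Ms ! f) u)"
    by (rule onf_comm) (use assms rho_carrier in auto)
  then show ?thesis unfolding L_def using assms
    by (simp add: emb_mult[OF D onfD onfD, symmetric] rho_carrier)
qed

sublocale gl_family n "k + 2" e
proof
  show "adj n (e f) (e f)" if "f < k + 2" for f
    unfolding e_def by (rule ge_adj[OF n lierep_L[OF that]])
  show "cm (e f i j) (e g k' l)" if "f < k + 2" "g < k + 2" "f \<noteq> g" for f g i j k' l
  proof -
    have "cm (L f (pr ty n (Eu n i j))) (L g (pr ty n (Eu n k' l)))"
      by (rule L_comm[OF that pr_lie[OF n] pr_lie[OF n]]) auto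
    then show ?thesis unfolding e_def ge_def[OF n]
      by (rule cm_add[OF cm_sym[OF cm_add[OF cm_sym cm_sc]] cm_sc])
  qed
qed

lemma De_eq: "De F i j = ge n ty (\<lambda>u. \<Sum>f\<in>F. L f u) (sum s F) i j"
  unfolding De_def e_def ge_def[OF n] sum.distrib sc_sum[symmetric]
  by (cases "ty = SL \<and> i = j") (auto simp: sum_divide_distrib)

lemma linmap_sum: "F \<subseteq> {..<k + 2} \<Longrightarrow> linmap ty n (\<lambda>u. \<Sum>f\<in>F. L f u)"
proof -
  assume F: "F \<subseteq> {..<k + 2}"
  have "L f (u + v) = L f u + L f v" "L f (c \<cdot>\<^sub>m u) = sc c * L f u"
    if "f \<in> F" "u \<in> lie_alg ty n" "v \<in> lie_alg ty n" for f u v c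
    using linmap_L[of f] F that unfolding linmap_def by (metis lessThan_iff subsetD)+
  then show ?thesis unfolding linmap_def sum_distrib_left sum.distrib[symmetric]
    by (intro conjI ballI allI sum.cong refl)
qed

lemma emb_module:
  assumes F: "F \<subseteq> {..<k + 2}" and u: "u \<in> lie_alg ty n"
  shows "snd (tensor_module Ms F) u \<in> carrier_mat D D" "emb D (snd (tensor_module Ms F) u) = (\<Sum>f\<in>F. L f u)"
proof -
  have fin: "finite F" using F finite_subset by blast
  have 1: "snd (tensor_module Ms F) u = (\<Oplus>\<^bsub>End D\<^esub>f\<in>F. onf ds f (snd (Ms ! f) u))"
    by (simp add: tensor_module_def tensor_dim on_factor_onf ds_def)
  have car: "onf ds f (snd (Ms ! f) u) \<in> carrier_mat D D" if "f \<in> F" for f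
    using onfD[OF _ rho_carrier[OF _ u]] F that by auto
  show "snd (tensor_module Ms F) u \<in> carrier_mat D D" "emb D (snd (tensor_module Ms F) u) = (\<Sum>f\<in>F. L f u)"
    using emb_finsum[OF D fin car] unfolding 1 L_def by auto
qed

lemma Bl: "m < r \<Longrightarrow> B m \<in> lie_alg ty n" "m < r \<Longrightarrow> B' m \<in> lie_alg ty n"
  using B by (auto simp: dual_bases_def)

text \<open>By \<open>De_eq\<close> the shifts of the factors add up, so \<open>cg_ge\<close>
  applies with the total shift; for \<open>SL\<close> the Casimir elements of gl_n and sl_n differ
  by its square over \<open>n\<close>.\<close>

lemma emb_casimir:
  assumes F: "F \<subseteq> {..<k + 2}"
  shows "casimir r B B' (tensor_module Ms F) \<in> carrier_mat D D"
    "emb D (casimir r B B' (tensor_module Ms F)) =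
      cg n (De F) (De F) - sc (if ty = SL then sum s F * sum s F / of_nat n else 0)"
proof -
  let ?\<rho> = "snd (tensor_module Ms F)" and ?L = "\<lambda>u. \<Sum>f\<in>F. L f u"
  have fst: "fst (tensor_module Ms F) = D" by (simp add: tensor_module_def tensor_dim)
  have car: "?\<rho> (B m) * ?\<rho> (B' m) \<in> carrier_mat D D" if "m \<in> {..<r}" for m
    using that mult_carrier_mat[OF emb_module(1)[OF F] emb_module(1)[OF F]] Bl by auto
  note fs = emb_finsum[OF D finite_lessThan car]
  show "casimir r B B' (tensor_module Ms F) \<in> carrier_mat D D"
    using fs by (simp add: casimir_def fst)
  have "emb D (casimir r B B' (tensor_module Ms F)) = (\<Sum>m<r. emb D (?\<rho> (B m) * ?\<rho> (B' m)))"
    using fs by (simp add: casimir_def fst)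
  also have "\<dots> = (\<Sum>m<r. ?L (B m) * ?L (B' m))"
    using Bl by (intro sum.cong refl) (simp add: emb_mult[OF D] emb_module[OF F])
  also have "\<dots> = cg n (\<lambda>i j. ?L (pr ty n (Eu n i j))) (\<lambda>i j. ?L (pr ty n (Eu n i j)))"
    by (rule dual_sum[OF n B linmap_sum[OF F] linmap_sum[OF F]])
  also have "\<dots> = cg n (De F) (De F) - sc (if ty = SL then sum s F * sum s F / of_nat n else 0)"
    using cg_ge[OF n linmap_sum[OF F] linmap_sum[OF F], of "\<Sum>f\<in>F. s f" "\<Sum>f\<in>F. s f"]
    unfolding De_eq[abs_def] by (simp add: sc_simps)
  finally show "emb D (casimir r B B' (tensor_module Ms F)) =
      cg n (De F) (De F) - sc (if ty = SL then sum s F * sum s F / of_nat n else 0)" .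
qed

lemma e_std:
  assumes "2 \<le> f" "f < k + 2"
  assumes ij: "i < n" "j < n"
  shows "e f i j = emb D (onf ds f (Eu n i j))"
proof -
  have "L f = (\<lambda>A. emb D (onf ds f A))" using Ms_nth(3)[OF assms(1,2)] by (auto simp: L_def std_module_def)
  moreover have "s f = 1" using assms by (simp add: s_def)
  ultimately show ?thesis
    using ge_mat_hom[OF n, of "\<lambda>A. emb D (onf ds f A)"] hom_onf[OF assms(2)] ds_nth(2)[OF assms(1,2)] ij by (simp add: e_def)
qed

lemma hom_std: "2 \<le> f \<Longrightarrow> f < k + 2 \<Longrightarrow> mat_hom n (\<lambda>A. emb D (onf ds f A))"
  using hom_onf[of f] ds_nth(2)[of f] by simp

lemma cas_std: "2 \<le> f \<Longrightarrow> f < k + 2 \<Longrightarrow> cg n (e f) (e f) = sc (of_nat n)"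
  using cg_mat_hom[OF n hom_std[of f]] cg_cong[of n "e f" _ "e f", OF e_std[of f] e_std[of f]] by simp

lemma casimir_V: "casimir_scalar r B B' (std_module n) = (of_nat n - (if ty = SL then 1 / of_nat n else 0))"
proof -
  let ?c = "of_nat n - (if ty = SL then 1 / of_nat n else 0) :: complex"
  have lin: "linmap ty n (emb n)" by (rule linmap_GL_imp) (use mat_hom_emb[OF n] in \<open>simp add: mat_hom_def\<close>)
  have car: "B m * B' m \<in> carrier_mat n n" if "m \<in> {..<r}" for m
    using that mult_carrier_mat[OF lie_alg_carrier[OF Bl(1)] lie_alg_carrier[OF Bl(2)]] by simp
  note fs = emb_finsum[OF n finite_lessThan car]
  have "emb n (casimir r B B' (std_module n)) = (\<Sum>m<r. emb n (B m) * emb n (B' m))"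
    using fs by (simp add: casimir_def std_module_def emb_mult[OF n lie_alg_carrier[OF Bl(1)] lie_alg_carrier[OF Bl(2)]])
  also have "\<dots> = cg n (\<lambda>i j. emb n (pr ty n (Eu n i j))) (\<lambda>i j. emb n (pr ty n (Eu n i j)))"
    by (rule dual_sum[OF n B lin lin])
  also have "\<dots> = cg n (ge n ty (emb n) 1) (ge n ty (emb n) 1) - sc (if ty = SL then 1 / of_nat n else 0)"
    using cg_ge[OF n lin lin, of 1 1] by (simp add: sc_simps)
  also have "cg n (ge n ty (emb n) 1) (ge n ty (emb n) 1) = sc (of_nat n)"
    unfolding cg_mat_hom[OF n mat_hom_emb[OF n], symmetric]
    by (rule cg_cong; rule ge_mat_hom[OF n mat_hom_emb[OF n]])
  finally have "emb n (casimir r B B' (std_module n)) = emb n (?c \<cdot>\<^sub>m 1\<^sub>m n)"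
    by (simp add: emb_smult[OF n] emb_one[OF n] sc_simps)
  then have eq: "casimir r B B' (std_module n) = ?c \<cdot>\<^sub>m 1\<^sub>m n"
    using fs by (subst (asm) emb_eq_iff[OF n]) (auto simp: casimir_def std_module_def)
  show ?thesis unfolding casimir_scalar_def
  proof (rule the_equality)
    show "casimir r B B' (std_module n) = ?c \<cdot>\<^sub>m 1\<^sub>m (fst (std_module n))" using eq by (simp add: std_module_def)
    fix c assume "casimir r B B' (std_module n) = c \<cdot>\<^sub>m 1\<^sub>m (fst (std_module n))"
    then have "(?c \<cdot>\<^sub>m 1\<^sub>m n) $$ (0, 0) = (c \<cdot>\<^sub>m 1\<^sub>m n) $$ (0, 0)" using eq by (simp add: std_module_def)
    then show "c = ?c" using n by simp
  qed
qed

end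

text \<open>Irreducibility gave the identity inside \<open>emb d\<close>, but it is needed on one
  factor of a larger space. Since it involves only ring operations and scalars, it passes to any
  homomorphic image of the matrix algebra.\<close>

lemma char_mat_hom:
  assumes M: "is_L ty n (rect a p) (d, \<rho>)" and n: "0 < n" and pn: "p \<le> n" and \<iota>: "mat_hom d \<iota>"
    and ij: "i < n" "j < n"
  shows "char_mat n (of_nat a) (of_nat p) (ge n ty (\<lambda>u. \<iota> (\<rho> u)) (of_nat (a * p))) i j = 0"
proof -
  have irr: "irreducible_module (lie_alg ty n) (d, \<rho>)" using M by (simp add: is_L_def)
  then have d: "0 < d" and \<rho>: "\<And>u. u \<in> lie_alg ty n \<Longrightarrow> \<rho> u \<in> carrier_mat d d"
    by (auto simp: irreducible_module_def is_lie_module_def)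
  define R where "R X Y \<longleftrightarrow> (\<exists>A\<in>carrier_mat d d. X = emb d A \<and> Y = \<iota> A)" for X Y
  have lin: "linmap GL d \<iota>" using \<iota> by (simp add: mat_hom_def)
  have \<iota>_add: "\<iota> (A + A') = \<iota> A + \<iota> A'" if "A \<in> carrier_mat d d" "A' \<in> carrier_mat d d" for A A'
    using lin that by (simp add: linmap_def)
  have \<iota>_mult: "\<iota> (A * A') = \<iota> A * \<iota> A'" if "A \<in> carrier_mat d d" "A' \<in> carrier_mat d d" for A A'
    using \<iota> that by (simp add: mat_hom_def)
  have Rsc: "R (sc c) (sc c)" for c unfolding R_def
    by (rule bexI[of _ "c \<cdot>\<^sub>m 1\<^sub>m d"]) (use \<iota> in \<open>auto simp: mat_hom_def linmap_def emb_smult[OF d] emb_one[OF d]\<close>)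
  have Rop: "R (X + X') (Y + Y') \<and> R (X * X') (Y * Y')" if xy: "R X Y" "R X' Y'" for X X' Y Y'
  proof -
    obtain A A' where A: "A \<in> carrier_mat d d" "A' \<in> carrier_mat d d" "X = emb d A" "Y = \<iota> A" "X' = emb d A'" "Y' = \<iota> A'"
      using xy unfolding R_def by blast
    show ?thesis unfolding R_def A(3-) emb_add[OF d A(1,2), symmetric] emb_mult[OF d A(1,2), symmetric]
        \<iota>_add[OF A(1,2), symmetric] \<iota>_mult[OF A(1,2), symmetric]
      using mult_carrier_mat[OF A(1,2)] add_carrier_mat[OF A(2), of A] by blast
  qed
  note Radd = Rop[THEN conjunct1] and Rmult = Rop[THEN conjunct2]
  have Rsum: "R (sum f S) (sum g S)" if "\<And>s. s \<in> S \<Longrightarrow> R (f s) (g s)" "finite S" for f g and S :: "nat set"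
    using that(2,1) by (induction S rule: finite_induct) (use Rsc[of 0] Radd in \<open>auto simp: sc_simps\<close>)
  let ?e = "ge n ty (\<lambda>u. emb d (\<rho> u)) (of_nat (a * p))" and ?f = "ge n ty (\<lambda>u. \<iota> (\<rho> u)) (of_nat (a * p))"
  have Re: "R (?e i j) (?f i j)" for i j
  proof -
    have "R (emb d (\<rho> (pr ty n (Eu n i j)))) (\<iota> (\<rho> (pr ty n (Eu n i j))))"
      unfolding R_def using \<rho>[OF pr_lie[OF n, of "Eu n i j"]] by auto
    then show ?thesis unfolding ge_def[OF n] by (intro Radd Rsc)
  qed
  \<comment> \<open>Subtraction is rewritten as addition of a scalar, because closure of
    \<open>R\<close> was shown only for sums, products and scalars.\<close>
  have char: "char_mat n x y e i j = (\<Sum>m<n. e m j * e i m) + sc (y - x) * e i j + sc (if i = j then - (x * y) else 0)" for x y e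
    by (simp add: char_mat_def sc_simps)
  have "R (char_mat n (of_nat a) (of_nat p) ?e i j) (char_mat n (of_nat a) (of_nat p) ?f i j)"
    unfolding char by (intro Radd Rmult Rsum Rsc Re finite_lessThan)
  then have "R 0 (char_mat n (of_nat a) (of_nat p) ?f i j)" unfolding char_mat_L[OF M n pn ij] .
  then obtain A where A: "A \<in> carrier_mat d d" "emb d A = 0" "char_mat n (of_nat a) (of_nat p) ?f i j = \<iota> A"
    unfolding R_def by metis
  have "A = 0\<^sub>m d d" using A(2) emb_eq_iff[OF d A(1), of "0\<^sub>m d d"] by (simp add: emb_zero[OF d])
  then show ?thesis using linmap_zero[OF d lin] A(3) by simp
qed

context hecke_data
begin

definition T :: "(nat \<Rightarrow> nat) \<Rightarrow> endo" where
  "T w = emb D (perm_mat ds (up w))"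

lemma up_less: assumes w: "w permutes {1..k}" and f: "f < k + 2" shows "up w f < k + 2"
proof (cases f)
  case (Suc i)
  have "w i \<le> k"
  proof (cases "i = 0")
    case True
    then show ?thesis using permutes_not_in[OF w, of 0] by simp
  next
    case False
    then have "w i \<in> {1..k}" using permutes_in_image[OF w, of i] f Suc by simp
    then show ?thesis by simp
  qed
  then show ?thesis using Suc by (simp add: up_simps)
qed (simp add: up_simps)

lemma up_Ms: assumes w: "w permutes {1..k}" and f: "f < k + 2" shows "Ms ! up w f = Ms ! f" "s (up w f) = s f"
proof -
  \<comment> \<open>\<open>w\<close> fixes 0, so \<open>up w\<close> fixes 1, the number of the
    factor N.\<close>
  have w0: "w 0 = 0" using w by (auto intro: permutes_not_in)
  consider "f = 0" | "f = 1" | i where "f = Suc i" "i \<in> {1..k}" using f by (cases f) fastforce+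
  then have "f \<in> {0, 1} \<and> up w f = f \<or> 2 \<le> f \<and> 2 \<le> up w f"
  proof cases
    case (3 i)
    then have "w i \<in> {1..k}" using permutes_in_image[OF w] by simp
    with 3 show ?thesis by (auto simp: up_simps)
  qed (use w0 in \<open>auto simp: up_def\<close>)
  then show "Ms ! up w f = Ms ! f" "s (up w f) = s f"
    using up_less[OF w f] f Ms_nth(3) by (auto simp: s_def)
qed

lemma up_ok: assumes w: "w permutes {1..k}" shows "perm_ok ds (up w)"
  unfolding perm_ok_def
proof (intro conjI allI impI)
  note w' = permutes_inv[OF w]
  have inv: "up (inv_into UNIV w) (up w f) = f" "up w (up (inv_into UNIV w) f) = f" for f
    using up_comp[of "inv_into UNIV w" w] up_comp[of w "inv_into UNIV w"] permutes_inv_o[OF w] up_id by (metis comp_apply id_apply)+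
  show "bij_betw (up w) {..<length ds} {..<length ds}"
    by (rule bij_betw_byWitness[where f' = "up (inv_into UNIV w)"]) (use inv up_less[OF w] up_less[OF w'] in auto)
  show "ds ! up w f = ds ! f" if "f < length ds" for f
    using that up_less[OF w, of f] up_Ms(1)[OF w, of f] by (simp add: ds_nth(1))
qed

lemma perm_car: "perm_mat ds \<sigma> \<in> carrier_mat D D"
  unfolding D_def by (rule perm_mat_carrier)

text \<open>For \<open>SL\<close> the gl_n version of \<gamma> on M and N exceeds
  \<open>gamma_MN\<close> by \<open>s 0 * s 1 / n\<close>, so this amount is taken off the free
  constant of \<open>z_0\<close>.\<close>

sublocale swap_family n k e T "c\<^sub>z - (if ty = SL then s 0 * s 1 / of_nat n else 0)"
proof
  show "T w * e f i j = e (up w f) i j * T w" if w: "w permutes {1..k}" and f: "f < k + 2" for w f i j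
  proof -
    let ?u = "pr ty n (Eu n i j)"
    have u: "?u \<in> lie_alg ty n" by (rule pr_lie[OF n]) simp
    have "perm_mat ds (up w) * onf ds f (snd (Ms ! f) ?u) = onf ds (up w f) (snd (Ms ! up w f) ?u) * perm_mat ds (up w)"
      unfolding up_Ms(1)[OF w f] by (rule perm_onf[OF up_ok[OF w]]) (use f rho_carrier[OF f u] in auto)
    then have "T w * L f ?u = L (up w f) ?u * T w"
      unfolding T_def L_def emb_mult[OF D perm_car onfD[OF f rho_carrier[OF f u]], symmetric]
        emb_mult[OF D onfD[OF up_less[OF w f] rho_carrier[OF up_less[OF w f] u]] perm_car, symmetric] by simp
    then show ?thesis unfolding e_def ge_def[OF n] up_Ms(2)[OF w f] distrib_left distrib_right sc_comm[of "T w"] by simp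
  qed
  show "T id = 1" by (simp add: T_def up_id perm_mat_id D_def[symmetric] emb_one[OF D])
  show "T w * T w' = T (w \<circ> w')" if "w permutes {1..k}" "w' permutes {1..k}" for w w'
    unfolding T_def emb_mult[OF D perm_car perm_car, symmetric] perm_mat_comp[OF up_ok[OF that(1)] up_ok[OF that(2)]] up_comp ..
  show "T (transpose i j) = cg n (e (Suc i)) (e (Suc j))" if "i \<in> {1..k}" "j \<in> {1..k}" "i \<noteq> j" for i j
  proof -
    have l: "2 \<le> Suc i" "Suc i < k + 2" "2 \<le> Suc j" "Suc j < k + 2" using that by auto
    have "T (transpose i j) = (\<Sum>a<n. \<Sum>b<n. emb D (onf ds (Suc i) (Eu n a b)) * emb D (onf ds (Suc j) (Eu n b a)))"
      unfolding T_def D_def up_transpose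
      by (rule perm_transpose) (use l that ds_nth(2) D in \<open>auto simp: D_def\<close>)
    also have "\<dots> = cg n (e (Suc i)) (e (Suc j))"
      unfolding cg_def using e_std[OF l(1,2)] e_std[OF l(3,4)] by (intro sum.cong refl) simp
    finally show ?thesis .
  qed
qed

subsection \<open>The images of the generators\<close>

abbreviation "\<kappa> \<equiv> kappa r B B' Ms"

lemma kappa_Fs: "\<kappa> A i = casimir r B B' (tensor_module Ms (Fs A i))"
proof -
  have "(\<lambda>i. i + 1) ` {1..i} = {2..Suc i}"
    by (auto simp: image_iff Bex_def)
  then show ?thesis by (simp add: kappa_def Fs_def numeral_2_eq_2)
qed

lemma Fs_sub: "A \<subseteq> {0, 1} \<Longrightarrow> i \<le> k \<Longrightarrow> Fs A i \<subseteq> {..<k + 2}"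
  by (auto simp: Fs_def)

lemma kappa_carrier: "A \<subseteq> {0, 1} \<Longrightarrow> i \<le> k \<Longrightarrow> \<kappa> A i \<in> carrier_mat D D"
  unfolding kappa_Fs by (intro emb_casimir(1) Fs_sub)

lemma sum_s: "A \<subseteq> {0, 1} \<Longrightarrow> sum s (Fs A i) = sum s A + of_nat i"
proof -
  assume A: "A \<subseteq> {0, 1}"
  then have "sum s (Fs A i) = sum s A + (\<Sum>f\<in>{2..Suc i}. s f)"
    unfolding Fs_def using finite_subset[OF A] by (intro sum.union_disjoint) auto
  also have "(\<Sum>f\<in>{2..Suc i}. s f) = (\<Sum>f\<in>{2..Suc i}. 1)" by (intro sum.cong) (auto simp: s_def)
  finally show ?thesis by simp
qed

text \<open>The new copy of V adds twice \<open>W A i\<close> and its own Casimir value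
  \<open>n\<close>. For \<open>SL\<close> the total shift grows from \<open>S\<close> to
  \<open>S + 1\<close>, and its square by \<open>2 S + 1\<close>.\<close>

lemma emb_kappa_diff:
  assumes A: "A \<subseteq> {0, 1}" and i: "i \<in> {1..k}"
  shows "emb D (\<kappa> A i - \<kappa> A (i - 1)) = W A i + W A i +
    sc (of_nat n - (if ty = SL then (2 * (sum s A + (of_nat i - 1)) + 1) / of_nat n else 0))"
proof -
  let ?F = "Fs A (i - 1)" and ?S = "sum s A + (of_nat i - 1)"
  have i': "i \<le> k" "i - 1 \<le> k" using i by auto
  have Fi: "Fs A i = insert (Suc i) ?F" using i by (intro Fs_Suc) auto
  have ni: "Suc i \<notin> ?F" using A i by (auto simp: Fs_def)
  have S: "sum s ?F = ?S" "sum s (Fs A i) = ?S + 1" using i by (simp_all add: sum_s[OF A] of_nat_diff)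
  have cas: "cg n (De (Fs A i)) (De (Fs A i)) = cg n (De ?F) (De ?F) + (W A i + W A i) + sc (of_nat n)"
    unfolding Fi W_def by (subst cas_insert[OF Fs_sub[OF A i'(2)] _ ni]) (use i cas_std in auto)
  have "emb D (\<kappa> A i - \<kappa> A (i - 1)) = (cg n (De (Fs A i)) (De (Fs A i)) - sc (if ty = SL then (?S + 1) * (?S + 1) / of_nat n else 0))
      - (cg n (De ?F) (De ?F) - sc (if ty = SL then ?S * ?S / of_nat n else 0))"
    unfolding emb_diff[OF D kappa_carrier[OF A i'(1)] kappa_carrier[OF A i'(2)]]
    unfolding kappa_Fs emb_casimir(2)[OF Fs_sub[OF A i'(1)]] emb_casimir(2)[OF Fs_sub[OF A i'(2)]] S ..
  also have "\<dots> = W A i + W A i + sc (of_nat n - ((if ty = SL then (?S + 1) * (?S + 1) / of_nat n else 0) - (if ty = SL then ?S * ?S / of_nat n else 0)))"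
    unfolding cas sc_simps(6) by (simp add: algebra_simps)
  also have "(if ty = SL then (?S + 1) * (?S + 1) / of_nat n else 0) - (if ty = SL then ?S * ?S / of_nat n else 0)
      = (if ty = SL then (2 * ?S + 1) / of_nat n else 0)"
    using n by (simp add: field_simps)
  finally show ?thesis .
qed

text \<open>Values for all generators, including \<open>t_w\<close> for arbitrary \<open>w\<close>,
  whereas \<open>is_Phi\<close> prescribes only simple transpositions.\<close>

definition gm :: "gen \<Rightarrow> complex mat" where
  "gm g = (case g of
     Gen_t w \<Rightarrow> perm_mat ds (up w)
   | Gen_x i \<Rightarrow> (1/2) \<cdot>\<^sub>m (\<kappa> {0} i - \<kappa> {0} (i - 1)) + ((of_nat i - 1) * d + c\<^sub>x) \<cdot>\<^sub>m 1\<^sub>m D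
   | Gen_y i \<Rightarrow> (1/2) \<cdot>\<^sub>m (\<kappa> {1} i - \<kappa> {1} (i - 1)) + ((of_nat i - 1) * d + c\<^sub>y) \<cdot>\<^sub>m 1\<^sub>m D
   | Gen_z i \<Rightarrow> if i = 0 then gamma_MN r B B' n k M N + c\<^sub>z \<cdot>\<^sub>m 1\<^sub>m D
       else (1/2) \<cdot>\<^sub>m (\<kappa> {0, 1} i - \<kappa> {0, 1} (i - 1) + casimir_scalar r B B' (std_module n) \<cdot>\<^sub>m 1\<^sub>m D)
            + ((of_nat i - 1) * d + c\<^sub>x + c\<^sub>y) \<cdot>\<^sub>m 1\<^sub>m D)"

lemma half_double: "sc (1/2) * (X + X) = X"
proof -
  have "sc (1/2) * (X + X) = sc (1/2 + 1/2) * X" unfolding sc_simps(3) distrib_left distrib_right ..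
  then show ?thesis by (simp add: sc_simps(2))
qed

lemma emb_scalar: "emb D (c \<cdot>\<^sub>m 1\<^sub>m D) = sc c"
  by (simp add: emb_smult[OF D] emb_one[OF D])

text \<open>The hypothesis \<open>c\<close> says that all scalars balance; \<open>v\<close> is the
  Casimir value of V for \<open>z_i\<close> and 0 for \<open>x_i\<close> and
  \<open>y_i\<close>.\<close>

lemma gm_W:
  assumes A: "A \<subseteq> {0, 1}" and i: "i \<in> {1..k}"
    and c: "(1/2) * (of_nat n - (if ty = SL then (2 * (sum s A + (of_nat i - 1)) + 1) / of_nat n else 0) + v) + c' = 0"
  shows "(1/2) \<cdot>\<^sub>m (\<kappa> A i - \<kappa> A (i - 1) + v \<cdot>\<^sub>m 1\<^sub>m D) + c' \<cdot>\<^sub>m 1\<^sub>m D \<in> carrier_mat D D" (is "?X \<in> _")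
    "emb D ((1/2) \<cdot>\<^sub>m (\<kappa> A i - \<kappa> A (i - 1) + v \<cdot>\<^sub>m 1\<^sub>m D) + c' \<cdot>\<^sub>m 1\<^sub>m D) = W A i"
proof -
  let ?t = "of_nat n - (if ty = SL then (2 * (sum s A + (of_nat i - 1)) + 1) / of_nat n else 0) :: complex"
  have i': "i \<le> k" "i - 1 \<le> k" using i by auto
  have car: "\<kappa> A i - \<kappa> A (i - 1) \<in> carrier_mat D D" by (rule minus_carrier_mat[OF kappa_carrier[OF A i'(2)]])
  then have car2: "\<kappa> A i - \<kappa> A (i - 1) + v \<cdot>\<^sub>m 1\<^sub>m D \<in> carrier_mat D D" by auto
  then show "?X \<in> carrier_mat D D" by auto
  have "emb D (?X) =
      sc (1/2) * ((W A i + W A i) + (sc ?t + sc v)) + sc c'"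
    using car car2 by (simp only: emb_add[OF D] emb_smult[OF D] emb_scalar emb_kappa_diff[OF A i] smult_carrier_mat one_carrier_mat add.assoc)
  also have "\<dots> = W A i + sc ((1/2) * (?t + v) + c')"
    unfolding distrib_left[of "sc (1/2)" "W A i + W A i"] half_double sc_simps(3,4) by (simp only: add.assoc)
  finally show "emb D (?X) = W A i"
    unfolding c by (simp add: sc_simps)
qed

lemma s_eq: "s 0 = of_nat (a * p)" "s 1 = of_nat (b * q)" "s (Suc 0) = of_nat (b * q)"
  by (auto simp: s_def)

lemma add_zero_smult_one: "X \<in> carrier_mat D D \<Longrightarrow> X + 0 \<cdot>\<^sub>m 1\<^sub>m D = (X :: complex mat)"
  by (intro eq_matI) auto

lemma kappa_diff_carrier: "A \<subseteq> {0, 1} \<Longrightarrow> i \<in> {1..k} \<Longrightarrow> \<kappa> A i - \<kappa> A (i - 1) \<in> carrier_mat D D"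
  by (rule minus_carrier_mat[OF kappa_carrier]) auto

text \<open>The balance conditions of \<open>gm_W\<close> for \<open>x_i\<close>, \<open>y_i\<close>
  and \<open>z_i\<close>: for \<open>SL\<close>, \<open>d\<close> cancels the growth with
  \<open>i\<close>, and \<open>c_x\<close>, \<open>c_y\<close> cancel the rest.\<close>

lemma shift_x:
  "(1/2) * (of_nat n - (if ty = SL then (2 * (of_nat (a * p) + (of_nat i - 1)) + 1) / of_nat n else 0) + 0)
    + ((of_nat i - 1) * d + c\<^sub>x) = 0" (is ?shift_x)
  "(1/2) * (of_nat n - (if ty = SL then (2 * (of_nat (b * q) + (of_nat i - 1)) + 1) / of_nat n else 0) + 0)
    + ((of_nat i - 1) * d + c\<^sub>y) = 0" (is ?shift_y)
  "(1/2) * (of_nat n - (if ty = SL then (2 * (of_nat (a * p) + of_nat (b * q) + (of_nat i - 1)) + 1) / of_nat n else 0)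
    + (of_nat n - (if ty = SL then 1 / of_nat n else 0))) + ((of_nat i - 1) * d + c\<^sub>x + c\<^sub>y) = 0" (is ?shift_z)
proof -
  consider (GL) "ty = GL" "c\<^sub>x = - (1/2) * of_nat n" "c\<^sub>y = - (1/2) * of_nat n" "d = 0"
    | (SL) "ty = SL" "c\<^sub>x = of_nat (a * p) / of_nat n - (1/2) * (of_nat n - 1 / of_nat n)"
      "c\<^sub>y = of_nat (b * q) / of_nat n - (1/2) * (of_nat n - 1 / of_nat n)" "d = 1 / of_nat n"
    using params by blast
  then show ?shift_x ?shift_y ?shift_z
  proof (atomize (full), cases)
    case GL
    show "?shift_x \<and> ?shift_y \<and> ?shift_z" unfolding GL by simp
  next
    case SL
    show "?shift_x \<and> ?shift_y \<and> ?shift_z" unfolding SL using n by (simp add: field_simps)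
  qed
qed

lemma gm_x: assumes i: "i \<in> {1..k}"
  shows "gm (Gen_x i) \<in> carrier_mat D D" "emb D (gm (Gen_x i)) = W {0} i"
proof -
  have A: "{0} \<subseteq> {0, 1 :: nat}" by simp
  have S: "sum s {0} = of_nat (a * p)" using s_eq(1) by simp
  note g = gm_W[OF A i, where v = 0 and c' = "(of_nat i - 1) * d + c\<^sub>x", unfolded S,
      OF shift_x(1), unfolded add_zero_smult_one[OF kappa_diff_carrier[OF A i]]]
  show "gm (Gen_x i) \<in> carrier_mat D D" "emb D (gm (Gen_x i)) = W {0} i"
    unfolding gm_def gen.case by (rule g)+
qed

lemma gm_y: assumes i: "i \<in> {1..k}"
  shows "gm (Gen_y i) \<in> carrier_mat D D" "emb D (gm (Gen_y i)) = W {1} i"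
proof -
  have A: "{1} \<subseteq> {0, 1 :: nat}" by simp
  have S: "sum s {1} = of_nat (b * q)" using s_eq(2) by simp
  note g = gm_W[OF A i, where v = 0 and c' = "(of_nat i - 1) * d + c\<^sub>y", unfolded S,
      OF shift_x(2), unfolded add_zero_smult_one[OF kappa_diff_carrier[OF A i]]]
  show "gm (Gen_y i) \<in> carrier_mat D D" "emb D (gm (Gen_y i)) = W {1} i"
    unfolding gm_def gen.case by (rule g)+
qed

lemma tensor_two: "tensor ([A, C] @ replicate k (1\<^sub>m n)) = onf ds 0 A * onf ds 1 C"
  if "A \<in> carrier_mat (fst M) (fst M)" "C \<in> carrier_mat (fst N) (fst N)"
proof -
  have "onf ds 0 A * onf ds 1 C = tensor ((map 1\<^sub>m ds)[0 := A, 1 := C])"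
    by (rule onf_mult_other) (use that in \<open>auto simp: ds_eq\<close>)
  then show ?thesis by (simp add: ds_eq)
qed

lemma gamma_MN:
  "gamma_MN r B B' n k M N \<in> carrier_mat D D"
  "emb D (gamma_MN r B B' n k M N) = cg n (e 0) (e 1) - sc (if ty = SL then s 0 * s 1 / of_nat n else 0)"
proof -
  let ?t = "\<lambda>m. tensor ([snd M (B m), snd N (B' m)] @ replicate k (1\<^sub>m n))"
  have c: "snd M (B m) \<in> carrier_mat (fst M) (fst M)" "snd N (B' m) \<in> carrier_mat (fst N) (fst N)" if "m < r" for m
    using rho_carrier[of 0 "B m"] rho_carrier[of 1 "B' m"] Bl[OF that] Ms_nth ds_nth(1)[of 0] ds_nth(1)[of 1] by simp_all
  have t: "?t m = onf ds 0 (snd M (B m)) * onf ds 1 (snd N (B' m))"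
    if "m < r" for m by (rule tensor_two[OF c[OF that]])
  have o: "onf ds 0 (snd M (B m)) \<in> carrier_mat D D" "onf ds 1 (snd N (B' m)) \<in> carrier_mat D D" if "m < r" for m
    using onfD[of 0 "snd M (B m)"] onfD[of 1 "snd N (B' m)"] c[OF that] Ms_nth ds_nth(1)[of 0] ds_nth(1)[of 1] by simp_all
  have car: "?t m \<in> carrier_mat D D" if "m \<in> {..<r}" for m
    unfolding t[OF that[unfolded lessThan_iff]] using that mult_carrier_mat[OF o(1) o(2)] by auto
  note fs = emb_finsum[OF D finite_lessThan car]
  show "gamma_MN r B B' n k M N \<in> carrier_mat D D" using fs by (simp only: gamma_MN_def fst_MNV)
  have "emb D (gamma_MN r B B' n k M N) = (\<Sum>m<r. emb D (?t m))"
    using fs by (simp only: gamma_MN_def fst_MNV)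
  also have "\<dots> = (\<Sum>m<r. L 0 (B m) * L 1 (B' m))"
  proof (intro sum.cong refl)
    fix m assume "m \<in> {..<r}"
    then have m: "m < r" by simp
    show "emb D (?t m) = L 0 (B m) * L 1 (B' m)"
      unfolding t[OF m] L_def Ms_nth by (rule emb_mult[OF D o[OF m]])
  qed
  also have "\<dots> = cg n (\<lambda>i j. L 0 (pr ty n (Eu n i j))) (\<lambda>i j. L 1 (pr ty n (Eu n i j)))"
    by (rule dual_sum[OF n B linmap_L linmap_L]) auto
  also have "\<dots> = cg n (e 0) (e 1) - sc (if ty = SL then s 0 * s 1 / of_nat n else 0)"
    using cg_ge[OF n linmap_L linmap_L, of 0 1 "s 0" "s 1"] by (simp add: e_def sc_simps)
  finally show "emb D (gamma_MN r B B' n k M N) = cg n (e 0) (e 1) - sc (if ty = SL then s 0 * s 1 / of_nat n else 0)" .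
qed

lemma gm_z: assumes i: "i \<in> {0..k}"
  shows "gm (Gen_z i) \<in> carrier_mat D D" "emb D (gm (Gen_z i)) = Z i"
proof -
  have "gm (Gen_z i) \<in> carrier_mat D D \<and> emb D (gm (Gen_z i)) = Z i"
  proof (cases "i = 0")
    case True
    have "emb D (gm (Gen_z 0)) = cg n (e 0) (e 1) - sc (if ty = SL then s 0 * s 1 / of_nat n else 0) + sc c\<^sub>z"
      by (simp add: gm_def emb_add[OF D gamma_MN(1)] emb_scalar gamma_MN(2))
    also have "\<dots> = Z 0" by (simp add: Z_def sc_simps(6))
    finally show ?thesis using True gamma_MN(1) by (simp add: gm_def)
  next
    case False
    then have i': "i \<in> {1..k}" using i by auto
    have A: "{0, 1} \<subseteq> {0, 1 :: nat}" by simp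
    have S: "sum s {0, 1} = of_nat (a * p) + of_nat (b * q)" by (simp add: s_eq)
    note g = gm_W[OF A i', unfolded S, OF shift_x(3)]
    have "gm (Gen_z i) \<in> carrier_mat D D" "emb D (gm (Gen_z i)) = W {0, 1} i"
      unfolding gm_def gen.case if_not_P[OF False] casimir_V by (rule g)+
    then show ?thesis using False by (simp add: Z_def)
  qed
  then show "gm (Gen_z i) \<in> carrier_mat D D" "emb D (gm (Gen_z i)) = Z i" by auto
qed

lemma gm_t: "gm (Gen_t w) \<in> carrier_mat D D" "emb D (gm (Gen_t w)) = T w"
  by (simp_all add: gm_def T_def perm_car)

text \<open>The two exchanged copies are taken as one slot of dimension \<open>n^2\<close>, where
  the swap expands into the sum of \<open>E_ab \<otimes> E_ba\<close>; splitting the slot again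
  gives \<gamma> on the two copies.\<close>

lemma tensor_swap:
  assumes j: "j \<in> {1..<k}"
  shows "tensor ([1\<^sub>m (fst M), 1\<^sub>m (fst N)] @ replicate (j - 1) (1\<^sub>m n) @ [swap_mat n] @ replicate (k - j - 1) (1\<^sub>m n)) = gm (Gen_t (ss j))"
proof -
  let ?As = "[1\<^sub>m (fst M), 1\<^sub>m (fst N)] @ replicate (j - 1) (1\<^sub>m n)" and ?Bs = "replicate (k - j - 1) (1\<^sub>m n)"
  let ?d1 = "[fst M, fst N] @ replicate (j - 1) n" and ?d2 = "replicate (k - j - 1) n"
  have rep: "replicate k x = replicate (j - 1) x @ x # x # replicate (k - j - 1) x" for x :: 'c
  proof -
    have "k = (j - 1) + (2 + (k - j - 1))" using j by auto
    then have "replicate k x = replicate (j - 1) x @ replicate 2 x @ replicate (k - j - 1) x"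
      by (metis replicate_add)
    then show ?thesis by (simp add: numeral_2_eq_2)
  qed
  have Dd: "D = prod_list (?d1 @ (n * n) # ?d2)" by (simp add: D_def ds_eq rep mult_ac)
  have sq: "sq ?d1 ?As" "sq ?d2 ?Bs" by (rule sqI; auto simp: nth_append nth_Cons' )+
  define E where "E s = kron (Eu n (fst s) (snd s)) (Eu n (snd s) (fst s))" for s
  have E: "E s \<in> carrier_mat (n * n) (n * n)" for s unfolding E_def by (intro kron_carrier) auto
  have sw: "swap_mat n \<in> carrier_mat (n * n) (n * n)" by (simp add: swap_mat_def)
  have entries: "swap_mat n $$ (i, l) = (\<Sum>s\<in>{..<n} \<times> {..<n}. E s $$ (i, l))" if il: "i < n * n" "l < n * n" for i l
  proof -
    note less = less_mult_imp_div_less[OF il(1)] less_mult_imp_div_less[OF il(2)]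
      mod_less_of_less_mult[OF il(1)] mod_less_of_less_mult[OF il(2)]
    have "E s $$ (i, l) = (if s = (i div n, i mod n) then if i div n = l mod n \<and> i mod n = l div n then 1 else 0 else 0)" for s
      unfolding E_def using less
      by (cases s) (auto simp: kron_entry[OF Eu_carrier(1) Eu_carrier(1) il], auto simp: Eu_def)
    then show ?thesis using less il by (simp add: swap_mat_def)
  qed
  have "emb D (tensor (?As @ swap_mat n # ?Bs)) = (\<Sum>s\<in>{..<n} \<times> {..<n}. emb D (tensor (?As @ E s # ?Bs)))"
    unfolding Dd by (rule tensor_slot[OF _ sq sw E entries]) (use D Dd in auto)
  also have "\<dots> = (\<Sum>s\<in>{..<n} \<times> {..<n}. e (Suc j) (fst s) (snd s) * e (Suc (Suc j)) (snd s) (fst s))"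
  proof (intro sum.cong refl)
    fix s assume "s \<in> {..<n} \<times> {..<n}"
    then have s: "fst s < n" "snd s < n" by auto
    let ?X = "Eu n (fst s) (snd s)" and ?Y = "Eu n (snd s) (fst s)"
    have ds: "ds ! Suc j = n" "ds ! Suc (Suc j) = n" using j ds_nth(2) by auto
    have "tensor (?As @ E s # ?Bs) = tensor (?As @ ?X # ?Y # ?Bs)"
      unfolding E_def tensor_append_kron ..
    also have "?As @ ?X # ?Y # ?Bs = (map 1\<^sub>m ds)[Suc j := ?X, Suc (Suc j) := ?Y]"
    proof -
      have "length ?As = Suc j" using j by auto
      moreover have "map 1\<^sub>m ds = ?As @ 1\<^sub>m n # 1\<^sub>m n # ?Bs" by (simp add: ds_eq rep)
      moreover have "(xs @ u # v # ys)[length xs := x, Suc (length xs) := y] = xs @ x # y # ys" for xs ys and u v x y :: "complex mat"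
        by (simp add: list_update_append)
      ultimately show ?thesis by metis
    qed
    also have "tensor \<dots> = onf ds (Suc j) ?X * onf ds (Suc (Suc j)) ?Y"
      by (rule onf_mult_other[symmetric]) (use j ds in auto)
    also have "emb D \<dots> = e (Suc j) (fst s) (snd s) * e (Suc (Suc j)) (snd s) (fst s)"
      using j s ds emb_mult[OF D onfD onfD, of "Suc j" ?X "Suc (Suc j)" ?Y] by (simp add: e_std)
    finally show "emb D (tensor (?As @ E s # ?Bs)) = e (Suc j) (fst s) (snd s) * e (Suc (Suc j)) (snd s) (fst s)" .
  qed
  also have "\<dots> = cg n (e (Suc j)) (e (Suc (Suc j)))"
    unfolding cg_def by (simp add: sum.cartesian_product case_prod_unfold)
  also have "\<dots> = emb D (gm (Gen_t (ss j)))"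
    using T_transpose[of j "j + 1"] j by (simp add: gm_t)
  finally have "emb D (tensor (?As @ swap_mat n # ?Bs)) = emb D (gm (Gen_t (ss j)))" .
  moreover have "tensor (?As @ swap_mat n # ?Bs) \<in> carrier_mat D D"
    unfolding Dd by (rule tensor_carrier) (use sq sw in \<open>auto intro: list_all2_appendI\<close>)
  ultimately show ?thesis using emb_eq_iff[OF D _ gm_t(1)] by simp
qed

text \<open>\<open>x_1\<close> or \<open>y_1\<close> is a single \<gamma> on the factors
  \<open>f\<close> and 2, the latter being the first copy of V, so \<open>char_mat_quadratic\<close>
  applies with the matrix units of V.\<close>

lemma quadratic:
  assumes f: "f < 2" and L: "is_L ty n (rect a' p') (Ms ! f)" and p': "p' \<le> n" and sf: "s f = of_nat (a' * p')"
  shows "(W {f} 1 - sc (of_nat a')) * (W {f} 1 + sc (of_nat p')) = 0"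
proof -
  obtain \<rho> where Mf: "Ms ! f = (ds ! f, \<rho>)" using ds_nth(1)[of f] f by (cases "Ms ! f") auto
  have "W {f} 1 = cg n (e f) (e 2)"
    using f by (simp add: W_def Fs_def Ga_sum numeral_2_eq_2)
  moreover have "(cg n (e f) (e 2) - sc (of_nat a')) * (cg n (e f) (e 2) + sc (of_nat p')) = 0"
  proof (rule char_mat_quadratic)
    show "char_mat n (of_nat a') (of_nat p') (e f) i j = 0" if "i < n" "j < n" for i j
      using char_mat_hom[OF L[unfolded Mf] n p' hom_onf that] f
      unfolding e_def sf L_def[abs_def] Mf by simp
    show "cm (e f i j) (e 2 l l')" if "i < n" "j < n" "l < n" "l' < n" for i j l l'
      by (rule comm) (use f that k in auto)
    show "e 2 i j * e 2 l l' = (if j = l then e 2 i l' else 0)" if "i < n" "j < n" "l < n" "l' < n" for i j l l'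
    proof -
      have h: "mat_hom n (\<lambda>A. emb D (onf ds 2 A))" by (rule hom_std) (use k in auto)
      have "emb D (onf ds 2 (0\<^sub>m n n)) = 0" using h linmap_zero[OF n, of GL "\<lambda>A. emb D (onf ds 2 A)"] by (simp add: mat_hom_def)
      then show ?thesis using h Eu_mult[of i n j l l'] k that
        by (simp add: e_std mat_hom_def) (metis Eu_carrier(1))
    qed
    show "(\<Sum>i<n. e 2 i i) = 1"
      using mat_hom_one[OF n hom_std[of 2]] k by (simp add: e_std)
  qed
  ultimately show ?thesis by simp
qed

lemma quadratic_x: "(W {0} 1 - sc (of_nat a)) * (W {0} 1 + sc (of_nat p)) = 0"
  using quadratic[of 0 a p] M pn by (simp add: Ms_nth s_eq)

lemma quadratic_y: "(W {1} 1 - sc (of_nat b)) * (W {1} 1 + sc (of_nat q)) = 0"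
  using quadratic[of 1 b q] N qn Ms_nth(2) by (simp add: s_eq)

lemma gm_commutes:
  assumes g: "g \<in> gens k" and u: "u \<in> lie_alg ty n"
  shows "gm g \<in> carrier_mat D D" "gm g * snd (MNV n k M N) u = snd (MNV n k M N) u * gm g"
proof -
  let ?All = "{..<k + 2}"
  have X: "gm g \<in> carrier_mat D D \<and> (\<forall>i<n. \<forall>j<n. cm (emb D (gm g)) (De ?All i j))"
  proof -
    have W: "cm (W A i) (De ?All s t)" if "A \<subseteq> {0, 1}" "i \<in> {1..k}" "s < n" "t < n" for A i s t
      unfolding W_def by (rule Ga_De_comm) (use that in \<open>auto simp: Fs_def\<close>)
    consider w where "g = Gen_t w" "w permutes {1..k}" | i where "g = Gen_x i" "i \<in> {1..k}" | i where "g = Gen_y i" "i \<in> {1..k}"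
      | i where "g = Gen_z i" "i \<in> {0..k}"
      using g by (auto simp: gens_def)
    then show ?thesis
    proof cases
      case (1 w)
      have "T w * De ?All i j = De ?All i j * T w" if "i < n" "j < n" for i j
      proof -
        have "T w * De ?All i j = (\<Sum>f<k + 2. e (up w f) i j) * T w"
          unfolding De_def sum_distrib_left sum_distrib_right by (intro sum.cong refl T_e) (use 1 that in auto)
        also have "(\<Sum>f<k + 2. e (up w f) i j) = De ?All i j"
          unfolding De_def using up_ok[OF 1(2)] by (intro sum.reindex_bij_betw) (simp add: perm_ok_def)
        finally show ?thesis .
      qed
      then show ?thesis using gm_t 1 by simp
    next
      case (2 i)
      then show ?thesis using gm_x[of i] W by simp
    next
      case (3 i)
      then show ?thesis using gm_y[of i] W by simp
    next
      case (4 i)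
      have "cm (Z 0) (De ?All s t)" if "s < n" "t < n" for s t
        unfolding Z_def if_P[OF refl]
        by (rule cm_sym[OF cm_add[OF cm_sym[OF cg_De_comm] cm_sc]]) (use that in auto)
      moreover have "Z i = W {0, 1} i" if "i \<noteq> 0" using that by (simp add: Z_def)
      ultimately show ?thesis using gm_z[OF 4(2)] 4 W[of "{0, 1}" i] by (cases "i = 0") auto
    qed
  qed
  then show c: "gm g \<in> carrier_mat D D" by simp
  have M: "snd (MNV n k M N) = snd (tensor_module Ms ?All)" by (simp add: MNV_def Ms_def)
  have "cm (emb D (gm g)) (\<Sum>f<k + 2. L f u)"
    by (rule cm_ge_imp_cm[OF n linmap_sum[OF subset_refl] u, where s = "\<Sum>f<k + 2. s f"])
      (unfold De_eq[symmetric], use X in blast)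
  then have "emb D (gm g * snd (MNV n k M N) u) = emb D (snd (MNV n k M N) u * gm g)"
    unfolding M emb_module(2)[OF subset_refl u, symmetric]
      emb_mult[OF D c emb_module(1)[OF subset_refl u]] emb_mult[OF D emb_module(1)[OF subset_refl u] c] .
  then show "gm g * snd (MNV n k M N) u = snd (MNV n k M N) u * gm g"
    using c emb_module(1)[OF subset_refl u] unfolding M
    by (subst (asm) emb_eq_iff[OF D mult_carrier_mat mult_carrier_mat]) auto
qed

end

section \<open>Evaluation of free polynomials and quotients of algebras\<close>

definition word :: "('g \<Rightarrow> endo) \<Rightarrow> 'g fmon \<Rightarrow> endo" where
  "word \<phi> w = prod_list (map \<phi> (letters w))"

lemma word_simps: "word \<phi> 0 = 1" "word \<phi> (u + v) = word \<phi> u * word \<phi> v" "word \<phi> (Mon [g]) = \<phi> g"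
  by (simp_all add: word_def zero_fmon_def plus_fmon_def)

definition ev :: "('g \<Rightarrow> endo) \<Rightarrow> 'g fpoly \<Rightarrow> endo" where
  "ev \<phi> f = (\<Sum>w\<in>Poly_Mapping.keys f. sc (Poly_Mapping.lookup f w) * word \<phi> w)"

lemma ev_superset:
  assumes "finite K" "Poly_Mapping.keys f \<subseteq> K"
  shows "ev \<phi> f = (\<Sum>w\<in>K. sc (Poly_Mapping.lookup f w) * word \<phi> w)"
  unfolding ev_def by (rule sum.mono_neutral_left[OF assms]) (auto simp: in_keys_iff sc_simps)

lemma ev_add: "ev \<phi> (f + g) = ev \<phi> f + ev \<phi> g"
proof -
  let ?K = "Poly_Mapping.keys f \<union> Poly_Mapping.keys g"
  have fin: "finite ?K" by simp
  show ?thesis using ev_superset[OF fin, of f] ev_superset[OF fin, of g] ev_superset[OF fin keys_add]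
    by (simp add: lookup_add sc_simps distrib_right sum.distrib)
qed

lemma ev_zero: "ev \<phi> 0 = 0"
  by (simp add: ev_def)

lemma ev_minus: "ev \<phi> (f - g) = ev \<phi> f - ev \<phi> g"
  using ev_add[of \<phi> "f - g" g] by (simp add: algebra_simps)

lemma ev_sum: "ev \<phi> (sum f A) = (\<Sum>i\<in>A. ev \<phi> (f i))"
  by (induction A rule: infinite_finite_induct) (auto simp: ev_add ev_zero)

lemma ev_single: "ev \<phi> (Poly_Mapping.single w c) = sc c * word \<phi> w"
  using ev_superset[of "{w}" "Poly_Mapping.single w c" \<phi>] by simp

lemma ev_var: "ev \<phi> (var g) = \<phi> g"
  by (simp add: var_def ev_single word_simps sc_simps)

lemma ev_cst: "ev \<phi> (cst c) = sc c"
  by (simp add: cst_def ev_single word_simps)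

lemma ev_one: "ev \<phi> 1 = 1"
  using ev_cst[of \<phi> 1] by (simp add: cst_def sc_simps)

lemma fpoly_monomials: "f = (\<Sum>w\<in>Poly_Mapping.keys f. Poly_Mapping.single w (Poly_Mapping.lookup f w))"
proof (rule poly_mapping_eqI)
  fix v
  have "Poly_Mapping.lookup (\<Sum>w\<in>Poly_Mapping.keys f. Poly_Mapping.single w (Poly_Mapping.lookup f w)) v =
      (\<Sum>w\<in>Poly_Mapping.keys f. if w = v then Poly_Mapping.lookup f v else 0)"
    unfolding lookup_sum by (intro sum.cong) (auto simp: lookup_single)
  then show "Poly_Mapping.lookup f v = Poly_Mapping.lookup (\<Sum>w\<in>Poly_Mapping.keys f. Poly_Mapping.single w (Poly_Mapping.lookup f w)) v"
    by (simp add: in_keys_iff)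
qed

lemma ev_mult: "ev \<phi> (f * g) = ev \<phi> f * ev \<phi> g"
proof -
  have "f * g = (\<Sum>w\<in>Poly_Mapping.keys f. \<Sum>v\<in>Poly_Mapping.keys g.
      Poly_Mapping.single (w + v) (Poly_Mapping.lookup f w * Poly_Mapping.lookup g v))"
    by (subst fpoly_monomials[of f], subst fpoly_monomials[of g]) (simp only: sum_product mult_single)
  then have "ev \<phi> (f * g) = (\<Sum>w\<in>Poly_Mapping.keys f. \<Sum>v\<in>Poly_Mapping.keys g.
      sc (Poly_Mapping.lookup f w) * word \<phi> w * (sc (Poly_Mapping.lookup g v) * word \<phi> v))"
    by (simp add: ev_sum ev_single word_simps sc_simps mult.assoc sc_comm_left[of "word \<phi> w" for w])
  then show ?thesis by (simp add: ev_def sum_product)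
qed

lemmas ev_simps = ev_add ev_zero ev_minus ev_sum ev_var ev_cst ev_one ev_mult

text \<open>\<open>h\<close> is constant on cosets, so the image of a coset is a singleton. Scalar
  multiples are unions of cosets over all representatives, and \<open>h\<close> takes a single value
  on such a union as well.\<close>

lemma quot_alg_factor:
  assumes A: "ring A" and I: "ideal I A" and C: "ring C" and h: "h \<in> alg_hom A C"
    and zero: "\<And>x. x \<in> I \<Longrightarrow> h x = \<zero>\<^bsub>C\<^esub>"
    and smult: "\<And>c x. x \<in> carrier A \<Longrightarrow> c \<odot>\<^bsub>A\<^esub> x \<in> carrier A"
  shows "\<exists>\<Psi>\<in>alg_hom (quot_alg A I) C. \<forall>x\<in>carrier A. \<Psi> (I +>\<^bsub>A\<^esub> x) = h x"
proof -
  interpret A: ring A by (rule A)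
  interpret C: ring C by (rule C)
  interpret I: ideal I A by (rule I)
  have hom: "h \<in> Ring.ring_hom A C" and hs: "\<And>c x. x \<in> carrier A \<Longrightarrow> h (c \<odot>\<^bsub>A\<^esub> x) = c \<odot>\<^bsub>C\<^esub> h x"
    using h by (auto simp: alg_hom_def)
  have cos: "h y = h x" if x: "x \<in> carrier A" and y: "y \<in> I +>\<^bsub>A\<^esub> x" for x y
  proof -
    obtain j where j: "j \<in> I" "y = j \<oplus>\<^bsub>A\<^esub> x" using y by (auto simp: a_r_coset_def')
    then have "h y = h j \<oplus>\<^bsub>C\<^esub> h x" using ring_hom_add[OF hom _ x, of j] I.a_subset by auto
    then show ?thesis using zero[OF j(1)] ring_hom_closed[OF hom x] by simp
  qed
  define \<Psi> where "\<Psi> X = the_elem (h ` X)" for X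
  have \<Psi>: "\<Psi> (I +>\<^bsub>A\<^esub> x) = h x" if x: "x \<in> carrier A" for x
  proof -
    have "h ` (I +>\<^bsub>A\<^esub> x) \<subseteq> {h x}" using cos[OF x] by blast
    moreover have "h x \<in> h ` (I +>\<^bsub>A\<^esub> x)" using I.a_rcos_self[OF x] by (rule imageI)
    ultimately have "h ` (I +>\<^bsub>A\<^esub> x) = {h x}" by blast
    then show ?thesis by (simp add: \<Psi>_def)
  qed
  have car: "\<exists>x\<in>carrier A. X = I +>\<^bsub>A\<^esub> x" if "X \<in> carrier (quot_alg A I)" for X
    using that by (auto simp: quot_alg_simps FactRing_def A_RCOSETS_def')
  have "\<Psi> \<in> alg_hom (quot_alg A I) C"
    unfolding alg_hom_def mem_Collect_eq
  proof (intro conjI ring_hom_memI allI ballI)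
    fix X c assume "X \<in> carrier (quot_alg A I)"
    then obtain x where x: "x \<in> carrier A" "X = I +>\<^bsub>A\<^esub> x" using car by blast
    show "\<Psi> X \<in> carrier C" using x \<Psi> ring_hom_closed[OF hom] by simp
    have "h ` (c \<odot>\<^bsub>quot_alg A I\<^esub> X) = {c \<odot>\<^bsub>C\<^esub> h x}"
    proof -
      have "h z = c \<odot>\<^bsub>C\<^esub> h x" if y': "y \<in> X" and z: "z \<in> I +>\<^bsub>A\<^esub> (c \<odot>\<^bsub>A\<^esub> y)" for y z
      proof -
        have y: "y \<in> carrier A" using y' A.a_r_coset_subset_G[OF I.a_subset x(1)] unfolding x(2) by (rule subsetD[rotated])
        have "h z = c \<odot>\<^bsub>C\<^esub> h y" unfolding hs[OF y, symmetric] by (rule cos[OF smult[OF y] z])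
        also have "h y = h x" using cos[OF x(1)] y' x(2) by blast
        finally show ?thesis .
      qed
      then have "h ` (c \<odot>\<^bsub>quot_alg A I\<^esub> X) \<subseteq> {c \<odot>\<^bsub>C\<^esub> h x}" unfolding quot_alg_simps by blast
      moreover have "c \<odot>\<^bsub>A\<^esub> x \<in> c \<odot>\<^bsub>quot_alg A I\<^esub> X"
        unfolding quot_alg_simps using x(2) I.a_rcos_self[OF x(1)] I.a_rcos_self[OF smult[OF x(1)]] by blast
      then have "c \<odot>\<^bsub>C\<^esub> h x \<in> h ` (c \<odot>\<^bsub>quot_alg A I\<^esub> X)"
        unfolding hs[OF x(1), symmetric] by (rule imageI)
      ultimately show ?thesis by blast
    qed
    then show "\<Psi> (c \<odot>\<^bsub>quot_alg A I\<^esub> X) = c \<odot>\<^bsub>C\<^esub> \<Psi> X" using \<Psi>[OF x(1)] x(2) by (simp add: \<Psi>_def)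
    fix Y assume "Y \<in> carrier (quot_alg A I)"
    then obtain y where y: "y \<in> carrier A" "Y = I +>\<^bsub>A\<^esub> y" using car by blast
    have "X \<otimes>\<^bsub>quot_alg A I\<^esub> Y = I +>\<^bsub>A\<^esub> (x \<otimes>\<^bsub>A\<^esub> y)" "X \<oplus>\<^bsub>quot_alg A I\<^esub> Y = I +>\<^bsub>A\<^esub> (x \<oplus>\<^bsub>A\<^esub> y)"
      unfolding quot_alg_simps FactRing_def x(2) y(2)
      by (simp_all add: I.rcoset_mult_add[OF x(1) y(1)] I.a_rcos_sum[OF x(1) y(1)])
    then show "\<Psi> (X \<otimes>\<^bsub>quot_alg A I\<^esub> Y) = \<Psi> X \<otimes>\<^bsub>C\<^esub> \<Psi> Y" "\<Psi> (X \<oplus>\<^bsub>quot_alg A I\<^esub> Y) = \<Psi> X \<oplus>\<^bsub>C\<^esub> \<Psi> Y"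
      unfolding x(2) y(2) by (simp_all add: \<Psi> x(1) y(1) ring_hom_mult[OF hom x(1) y(1)] ring_hom_add[OF hom x(1) y(1)])
  next
    show "\<Psi> \<one>\<^bsub>quot_alg A I\<^esub> = \<one>\<^bsub>C\<^esub>"
      using \<Psi>[of "\<one>\<^bsub>A\<^esub>"] ring_hom_one[OF hom] by (simp add: quot_alg_simps FactRing_def)
  qed
  then show ?thesis using \<Psi> by blast
qed

lemma hom_zero_on_genideal:
  assumes A: "ring A" and C: "ring C" and h: "h \<in> Ring.ring_hom A C"
    and S: "S \<subseteq> carrier A" "\<And>x. x \<in> S \<Longrightarrow> h x = \<zero>\<^bsub>C\<^esub>" and x: "x \<in> Idl\<^bsub>A\<^esub> S"
  shows "h x = \<zero>\<^bsub>C\<^esub>"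
proof -
  interpret h: ring_hom_ring A C h by (rule ring_hom_ringI2[OF A C h])
  have mem: "y \<in> a_kernel A C h \<longleftrightarrow> y \<in> carrier A \<and> h y = \<zero>\<^bsub>C\<^esub>" for y
    unfolding a_kernel_def' by (rule mem_Collect_eq)
  have "S \<subseteq> a_kernel A C h"
    unfolding subset_iff mem using S(1) S(2) by (meson subsetD)
  from ring.genideal_minimal[OF A h.kernel_is_ideal this] x have "x \<in> a_kernel A C h" by (rule subsetD)
  then show ?thesis unfolding mem by (rule conjunct2)
qed

section \<open>The commutant of the Lie algebra as an algebra\<close>

lemma End_lie_simps:
  "monoid.mult (End_lie \<gg> U) = (*)" "add (End_lie \<gg> U) = (+)" "one (End_lie \<gg> U) = 1\<^sub>m (fst U)"
  "zero (End_lie \<gg> U) = 0\<^sub>m (fst U) (fst U)" "module.smult (End_lie \<gg> U) = (\<cdot>\<^sub>m)"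
  "carrier (End_lie \<gg> U) = {A \<in> carrier_mat (fst U) (fst U). \<forall>u\<in>\<gg>. A * snd U u = snd U u * A}"
  by (simp_all add: End_lie_def module_mat_simps)

context
  fixes \<gg> :: "complex mat set" and U :: lie_module and d :: nat
  assumes U_all: "\<forall>u\<in>\<gg>. snd U u \<in> carrier_mat d d" and d: "fst U = d"
begin

lemmas U = bspec[OF U_all]

abbreviation "EU \<equiv> End_lie \<gg> U"

lemma End_lie_closed:
  "1\<^sub>m d \<in> carrier (EU)"
  "0\<^sub>m d d \<in> carrier (EU)"
  "A \<in> carrier (EU) \<Longrightarrow> A' \<in> carrier (EU) \<Longrightarrow> A * A' \<in> carrier (EU)"
  "A \<in> carrier (EU) \<Longrightarrow> A' \<in> carrier (EU) \<Longrightarrow> A + A' \<in> carrier (EU)"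
  "A \<in> carrier (EU) \<Longrightarrow> c \<cdot>\<^sub>m A \<in> carrier (EU)"
proof -
  show "1\<^sub>m d \<in> carrier (EU)"
    by (auto simp: End_lie_simps d left_mult_one_mat[OF U] right_mult_one_mat[OF U])
  show "0\<^sub>m d d \<in> carrier (EU)"
    by (auto simp: End_lie_simps d left_mult_zero_mat[OF U] right_mult_zero_mat[OF U])
  show "A * A' \<in> carrier (EU)" if A: "A \<in> carrier (EU)" "A' \<in> carrier (EU)"
  proof -
    have c: "A \<in> carrier_mat d d" "A' \<in> carrier_mat d d" using A by (auto simp: End_lie_simps d)
    have "A * A' * snd U u = snd U u * (A * A')" if u: "u \<in> \<gg>" for u
    proof -
      have "A * A' * snd U u = A * (A' * snd U u)" by (rule assoc_mult_mat[OF c U[OF u]])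
      also have "\<dots> = A * snd U u * A'" using A u assoc_mult_mat[OF c(1) U[OF u] c(2)] by (simp add: End_lie_simps)
      also have "\<dots> = snd U u * (A * A')" using A u assoc_mult_mat[OF U[OF u] c] by (simp add: End_lie_simps)
      finally show ?thesis .
    qed
    then show ?thesis using c by (auto simp: End_lie_simps d)
  qed
  show "A + A' \<in> carrier (EU)" if A: "A \<in> carrier (EU)" "A' \<in> carrier (EU)"
    using A by (auto simp: End_lie_simps d add_mult_distrib_mat[OF _ _ U] mult_add_distrib_mat[OF U])
  show "c \<cdot>\<^sub>m A \<in> carrier (EU)" if A: "A \<in> carrier (EU)"
    using A by (auto simp: End_lie_simps d mult_smult_assoc_mat[OF _ U] mult_smult_distrib[OF U])
qed

lemma ring_End_lie: "ring (EU)"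
proof -
  have c: "A \<in> carrier (EU) \<Longrightarrow> A \<in> carrier_mat d d" for A by (simp add: End_lie_simps d)
  show ?thesis
  proof (rule ringI)
    show "abelian_group (EU)"
    proof (rule abelian_groupI)
      show "\<exists>y\<in>carrier (EU). y \<oplus>\<^bsub>EU\<^esub> x = \<zero>\<^bsub>EU\<^esub>" if "x \<in> carrier (EU)" for x
      proof (rule bexI[OF _ End_lie_closed(5)[OF that, of "- 1"]])
        show "- 1 \<cdot>\<^sub>m x \<oplus>\<^bsub>EU\<^esub> x = \<zero>\<^bsub>EU\<^esub>"
          unfolding End_lie_simps d using c[OF that] by (intro eq_matI) auto
      qed
    qed (auto simp: End_lie_simps(1-5) d End_lie_closed
        intro: assoc_add_mat[OF c c c] comm_add_mat[OF c c] left_add_zero_mat[OF c] right_add_zero_mat[OF c])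
    show "Group.monoid (EU)"
      by (rule Group.monoidI) (simp_all add: End_lie_simps(1-5) d End_lie_closed assoc_mult_mat[OF c c c]
        left_mult_one_mat[OF c] right_mult_one_mat[OF c])
  qed (simp_all add: End_lie_simps(1-5) add_mult_distrib_mat[OF c c c] mult_add_distrib_mat[OF c c c])
qed

end

section \<open>Construction of the homomorphism and its factorization\<close>

context hecke_data
begin

abbreviation "UU \<equiv> MNV n k M N"
abbreviation "EE \<equiv> End_lie (lie_alg ty n) UU"
abbreviation "FF \<equiv> free_alg (gens k)"
abbreviation "HH \<equiv> H_alg k (of_nat a) (of_nat b) (of_nat p) (of_nat q)"
abbreviation "HR \<equiv> H_rel k (of_nat a) (of_nat b) (of_nat p) (of_nat q)"
abbreviation "HI \<equiv> H_ideal k (of_nat a) (of_nat b) (of_nat p) (of_nat q)"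
abbreviation "Hp \<equiv> H_proj k (of_nat a) (of_nat b) (of_nat p) (of_nat q)"

lemma UU_carrier: "\<forall>u\<in>lie_alg ty n. snd UU u \<in> carrier_mat D D"
  using emb_module(1)[OF subset_refl] by (simp add: MNV_def Ms_def)

lemmas EE_closed = End_lie_closed[OF UU_carrier fst_MNV]

lemma ring_EE: "ring EE"
  by (rule ring_End_lie[OF UU_carrier fst_MNV])

lemma EE_carrier: "A \<in> carrier EE \<Longrightarrow> A \<in> carrier_mat D D"
  by (simp add: End_lie_simps fst_MNV)

lemma EE_eqI: "A \<in> carrier EE \<Longrightarrow> A' \<in> carrier EE \<Longrightarrow> emb D A = emb D A' \<Longrightarrow> A = A'"
  using emb_eq_iff[OF D EE_carrier EE_carrier] by blast

lemma gm_EE: "g \<in> gens k \<Longrightarrow> gm g \<in> carrier EE"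
  using gm_commutes(2) gm_commutes(1)[OF _ zero_lie[OF n]] by (simp add: End_lie_simps fst_MNV)

definition \<phi> :: "gen \<Rightarrow> endo" where "\<phi> g = emb D (gm g)"

lemma phi_simps: "\<phi> (Gen_t w) = T w" "i \<in> {1..k} \<Longrightarrow> \<phi> (Gen_x i) = W {0} i"
  "i \<in> {1..k} \<Longrightarrow> \<phi> (Gen_y i) = W {1} i" "i \<in> {0..k} \<Longrightarrow> \<phi> (Gen_z i) = Z i"
  by (simp_all only: \<phi>_def gm_t gm_x gm_y gm_z)

text \<open>Values of \<open>ev\<close> live in \<open>endo\<close>, while the target consists of
  matrices. The image of the commutant under \<open>emb\<close> is closed under the algebra
  operations, so every value comes from a matrix in it.\<close>

lemma ev_image:
  assumes f: "f \<in> carrier FF" shows "ev \<phi> f \<in> emb D ` carrier EE"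
proof -
  have mult: "X * Y \<in> emb D ` carrier EE" if "X \<in> emb D ` carrier EE" "Y \<in> emb D ` carrier EE" for X Y
    using that EE_closed(3) by (auto simp: emb_mult[OF D EE_carrier EE_carrier, symmetric])
  have add: "X + Y \<in> emb D ` carrier EE" if "X \<in> emb D ` carrier EE" "Y \<in> emb D ` carrier EE" for X Y
    using that EE_closed(4) by (auto simp: emb_add[OF D EE_carrier EE_carrier, symmetric])
  have sc: "sc c \<in> emb D ` carrier EE" for c
    unfolding emb_scalar[symmetric] by (rule imageI[OF EE_closed(5)[OF EE_closed(1)]])
  have w: "prod_list (map \<phi> gs) \<in> emb D ` carrier EE" if "set gs \<subseteq> gens k" for gs
    using that
  proof (induction gs)
    case Nil
    then show ?case using sc[of 1] by (simp add: sc_simps)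
  next
    case (Cons g gs)
    have "\<phi> g \<in> emb D ` carrier EE" using Cons.prems gm_EE unfolding \<phi>_def by auto
    then show ?case using Cons mult by simp
  qed
  have "(\<Sum>w\<in>K. sc (Poly_Mapping.lookup f w) * word \<phi> w) \<in> emb D ` carrier EE"
    if "finite K" "K \<subseteq> Poly_Mapping.keys f" for K
    using that
  proof (induction K rule: finite_induct)
    case empty
    then show ?case using sc[of 0] by (simp add: sc_simps)
  next
    case (insert v K)
    have "set (letters v) \<subseteq> gens k" using f insert.prems by (auto simp: free_alg_simps)
    then have "sc (Poly_Mapping.lookup f v) * word \<phi> v \<in> emb D ` carrier EE"
      unfolding word_def by (intro mult sc w)
    then show ?case using insert add by simp
  qed
  then show ?thesis unfolding ev_def by simp
qed

text \<open>Pulls the value back to a matrix; as \<open>emb\<close> is injective, identities for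
  \<open>h\<close> can be checked on values of \<open>ev\<close>.\<close>

definition h :: "gen fpoly \<Rightarrow> complex mat" where
  "h f = inv_into (carrier EE) (emb D) (ev \<phi> f)"

lemma h: assumes "f \<in> carrier FF" shows "h f \<in> carrier EE" "emb D (h f) = ev \<phi> f"
  unfolding h_def using inv_into_into[OF ev_image[OF assms]] f_inv_into_f[OF ev_image[OF assms]] by auto

lemma h_eqI: "f \<in> carrier FF \<Longrightarrow> A \<in> carrier EE \<Longrightarrow> ev \<phi> f = emb D A \<Longrightarrow> h f = A"
  by (rule EE_eqI) (simp_all add: h)

lemma h_alg_hom: "h \<in> alg_hom FF EE"
  unfolding alg_hom_def mem_Collect_eq
proof (intro conjI ring_hom_memI allI ballI)
  fix f assume f: "f \<in> carrier FF"
  show "h f \<in> carrier EE" by (rule h[OF f])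
  show "h (c \<odot>\<^bsub>FF\<^esub> f) = c \<odot>\<^bsub>EE\<^esub> h f" for c
    unfolding free_alg_simps End_lie_simps
    by (rule h_eqI) (simp_all add: free_alg_carrier f EE_closed h ev_simps emb_smult[OF D EE_carrier])
  fix g assume g: "g \<in> carrier FF"
  show "h (f \<otimes>\<^bsub>FF\<^esub> g) = h f \<otimes>\<^bsub>EE\<^esub> h g"
    unfolding free_alg_simps End_lie_simps
    by (rule h_eqI) (simp_all add: free_alg_carrier f g EE_closed h ev_simps emb_mult[OF D EE_carrier EE_carrier])
  show "h (f \<oplus>\<^bsub>FF\<^esub> g) = h f \<oplus>\<^bsub>EE\<^esub> h g"
    unfolding free_alg_simps End_lie_simps
    by (rule h_eqI) (simp_all add: free_alg_carrier f g EE_closed h ev_simps emb_add[OF D EE_carrier EE_carrier])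
next
  show "h \<one>\<^bsub>FF\<^esub> = \<one>\<^bsub>EE\<^esub>"
    unfolding free_alg_simps End_lie_simps fst_MNV
    by (rule h_eqI) (simp_all add: free_alg_carrier EE_closed ev_simps emb_one[OF D])
qed

text \<open>\<open>W_conj\<close> turns \<open>m_{i-1,i}\<close> into a simple transposition, and
  the conjugation in \<open>m2\<close> moves it to \<open>(j i)\<close>.\<close>

lemma ev_m1: assumes i: "i \<in> {1..k}" shows "ev \<phi> (m1 i) = (\<Sum>j\<in>{1..<i}. T (transpose j i))"
  unfolding m1_def ev_sum
proof (intro sum.cong refl)
  fix j assume "j \<in> {1..<i}"
  then have j: "1 \<le> j" "j \<le> i - 1" "i - 1 \<in> {1..<k}" "i - 1 + 1 = i" using i by auto
  have W: "W {0} i - T (transpose (i - 1) i) * W {0} (i - 1) * T (transpose (i - 1) i) = T (transpose (i - 1) i)"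
    using W_conj[of "{0}" "i - 1"] j by simp
  have m: "ev \<phi> (xx i - tt (ss (i - 1)) * xx (i - 1) * tt (ss (i - 1))) = T (transpose (i - 1) i)"
    using i j W by (simp add: ev_simps phi_simps)
  show "ev \<phi> (m2 j i) = T (transpose j i)"
  proof (cases "j = i - 1")
    case True
    then show ?thesis using m by (simp add: m2_def)
  next
    case False
    then have m2: "m2 j i = tt (transpose j (i - 1)) * (xx i - tt (ss (i - 1)) * xx (i - 1) * tt (ss (i - 1))) * tt (transpose j (i - 1))"
      by (simp add: m2_def Let_def)
    have "ev \<phi> (m2 j i) = T (transpose j (i - 1)) * T (transpose (i - 1) i) * T (transpose j (i - 1))"
      unfolding m2 ev_mult m ev_var phi_simps(1) ..
    also have "\<dots> = T (transpose j i)" by (rule T_conj) (use i j False in auto)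
    finally show ?thesis .
  qed
qed

lemma ev_G_rel: assumes "G_rel k u v" shows "ev \<phi> u = ev \<phi> v"
proof -
  have X: "{0} \<subseteq> {0, 1 :: nat}" "{1} \<subseteq> {0, 1 :: nat}" by auto
  have x: "i \<in> {1..k} \<Longrightarrow> ev \<phi> (xx i) = W {0} i" and y: "i \<in> {1..k} \<Longrightarrow> ev \<phi> (yy i) = W {1} i"
    and z: "i \<in> {0..k} \<Longrightarrow> ev \<phi> (zz i) = Z i" and t: "ev \<phi> (tt w) = T w" for i w
    by (simp_all only: ev_var phi_simps)
  have succ: "i \<in> {1..k}" "i + 1 \<in> {1..k}" if "i \<in> {1..<k}" for i using that by auto
  have br: "i \<in> {1..k}" "i + 1 \<in> {1..k}" "i + 2 \<in> {1..k}" if "1 \<le> i" "i + 2 \<le> k" for i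
    using that by auto
  have Zsum: "ev \<phi> (\<Sum>l\<in>{0..i}. zz l) = (\<Sum>l\<in>{0..i}. Z l)" if "i \<in> {1..k}" for i
    unfolding ev_sum using that by (intro sum.cong refl z) auto
  show ?thesis using assms
  proof cases
    case (1 i)
    then show ?thesis using Z_eq[of i] by (simp add: ev_add ev_minus ev_m1 x y z)
  next
    case 2
    then show ?thesis by (simp only: t T_id ev_one)
  next
    case (3 w w')
    then show ?thesis by (simp only: ev_mult t T_mult)
  next
    case (4 i j)
    then show ?thesis using W_comm[OF X(1), of i j] by (simp only: ev_mult x)
  next
    case (5 i j)
    then show ?thesis using W_comm[OF X(2), of i j] by (simp only: ev_mult y)
  next
    case (6 i j)
    then show ?thesis using Z_comm[of i j] by (simp only: ev_mult z)
  next
    case (7 i j)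
    then have "j \<in> {1..k}" by blast
    then show ?thesis using T_W_comm[OF X(1) 7(3,4)] unfolding 7(1,2) by (simp only: ev_mult x t)
  next
    case (8 i j)
    then have "j \<in> {1..k}" by blast
    then show ?thesis using T_W_comm[OF X(2) 8(3,4)] unfolding 8(1,2) by (simp only: ev_mult y t)
  next
    case (9 i j)
    then have "j \<in> {0..k}" by blast
    then show ?thesis using T_Z_comm[OF 9(3,4)] unfolding 9(1,2) by (simp only: ev_mult z t)
  next
    case (10 i j)
    then show ?thesis using Zsum[of i] Z_sum_comm[OF X(1), of i j] x[of j] by (simp add: ev_mult)
  next
    case (11 i j)
    then show ?thesis using Zsum[of i] Z_sum_comm[OF X(2), of i j] y[of j] by (simp add: ev_mult)
  next
    case (12 i)
    then show ?thesis using T_W_sum[OF X(1), of i] by (simp only: ev_mult ev_add x t succ)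
  next
    case (13 i)
    then show ?thesis using T_W_sum[OF X(2), of i] by (simp only: ev_mult ev_add y t succ)
  next
    case (14 i)
    note b = br[OF 14(3,4)]
    show ?thesis unfolding 14(1,2) ev_mult ev_minus t x[OF b(1)] x[OF b(2)] x[OF b(3)] by (rule W_braid[OF X(1) 14(3,4)])
  next
    case (15 i)
    note b = br[OF 15(3,4)]
    show ?thesis unfolding 15(1,2) ev_mult ev_minus t y[OF b(1)] y[OF b(2)] y[OF b(3)] by (rule W_braid[OF X(2) 15(3,4)])
  next
    case (16 i)
    then show ?thesis using W_conj[OF X(1), of i] W_conj[OF X(2), of i]
      by (simp only: ev_mult ev_minus x y t succ)
  qed
qed

lemma is_Phi_iff: "is_Phi r B B' n k M N c\<^sub>x c\<^sub>y c\<^sub>z d \<Phi> \<longleftrightarrow>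
    (\<forall>i\<in>{1..k}. \<Phi> (G_cls k (xx i)) = gm (Gen_x i)) \<and> (\<forall>i\<in>{1..k}. \<Phi> (G_cls k (yy i)) = gm (Gen_y i)) \<and>
    (\<forall>i\<in>{1..k}. \<Phi> (G_cls k (zz i)) = gm (Gen_z i)) \<and> \<Phi> (G_cls k (zz 0)) = gm (Gen_z 0) \<and>
    (\<forall>j\<in>{1..<k}. \<Phi> (G_cls k (tt (ss j))) = gm (Gen_t (ss j)))"
proof -
  have z: "(\<forall>i\<in>{1..k}. \<Phi> (G_cls k (zz i)) = gm (Gen_z i)) \<longleftrightarrow> (\<forall>i\<in>{1..k}. \<Phi> (G_cls k (zz i)) =
      (1/2) \<cdot>\<^sub>m (\<kappa> {0, 1} i - \<kappa> {0, 1} (i - 1) + casimir_scalar r B B' (std_module n) \<cdot>\<^sub>m 1\<^sub>m D)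
            + ((of_nat i - 1) * d + c\<^sub>x + c\<^sub>y) \<cdot>\<^sub>m 1\<^sub>m D)"
    by (intro ball_cong refl) (simp add: gm_def)
  have t: "(\<forall>j\<in>{1..<k}. \<Phi> (G_cls k (tt (ss j))) = gm (Gen_t (ss j))) \<longleftrightarrow> (\<forall>j\<in>{1..<k}. \<Phi> (G_cls k (tt (ss j))) =
      tensor ([1\<^sub>m (fst M), 1\<^sub>m (fst N)] @ replicate (j - 1) (1\<^sub>m n) @ [swap_mat n] @ replicate (k - j - 1) (1\<^sub>m n)))"
    by (intro ball_cong refl) (simp only: tensor_swap)
  show ?thesis unfolding is_Phi_def Let_def fst_MNV Ms_def[symmetric] z t by (simp add: gm_def)
qed

lemma gens_FF:
  "i \<in> {1..k} \<Longrightarrow> xx i \<in> carrier FF" "i \<in> {1..k} \<Longrightarrow> yy i \<in> carrier FF" "i \<in> {0..k} \<Longrightarrow> zz i \<in> carrier FF"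
  "j \<in> {1..<k} \<Longrightarrow> tt (ss j) \<in> carrier FF"
  using tr_permutes(1) by (auto intro: gens_carrier)

lemma h_gen: "g \<in> gens k \<Longrightarrow> h (var g) = gm g"
  by (rule h_eqI) (auto simp: gm_EE ev_var \<phi>_def intro: free_alg_carrier)

lemma Phi_exists: "\<exists>\<Phi>\<in>alg_hom (G_alg k) EE. is_Phi r B B' n k M N c\<^sub>x c\<^sub>y c\<^sub>z d \<Phi>"
proof -
  have h0: "h x = \<zero>\<^bsub>EE\<^esub>" if "x \<in> G_ideal k" for x
  proof (rule hom_zero_on_genideal[OF ring_free_alg ring_EE _ _ _ that[unfolded G_ideal_def]])
    show "h \<in> Ring.ring_hom FF EE" using h_alg_hom by (simp add: alg_hom_def)
    show "{u - v |u v. G_rel k u v} \<subseteq> carrier FF" by (auto dest: G_rel_carrier intro: free_alg_carrier)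
    fix x assume "x \<in> {u - v |u v. G_rel k u v}"
    then obtain u v where uv: "x = u - v" "G_rel k u v" by blast
    show "h x = \<zero>\<^bsub>EE\<^esub>"
      unfolding uv(1) End_lie_simps fst_MNV
      by (rule h_eqI)
        (use G_rel_carrier[OF uv(2)] ev_G_rel[OF uv(2)] in \<open>auto simp: EE_closed ev_minus emb_zero[OF D] intro: free_alg_carrier\<close>)
  qed
  obtain \<Phi> where \<Phi>: "\<Phi> \<in> alg_hom (G_alg k) EE" "\<And>x. x \<in> carrier FF \<Longrightarrow> \<Phi> (G_cls k x) = h x"
    using quot_alg_factor[OF ring_free_alg ideal_G ring_EE h_alg_hom h0]
    unfolding G_alg_def[symmetric] G_cls_def[symmetric]
    by (auto simp: free_alg_simps(6) intro: free_alg_carrier)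
  have "\<Phi> (G_cls k (var g)) = gm g" if "g \<in> gens k" for g
    using \<Phi>(2)[OF free_alg_carrier(8)[OF that]] h_gen[OF that] by simp
  then have "is_Phi r B B' n k M N c\<^sub>x c\<^sub>y c\<^sub>z d \<Phi>"
    unfolding is_Phi_iff using tr_permutes(1) by (auto simp: gens_def)
  then show ?thesis using \<Phi>(1) by blast
qed

text \<open>The given homomorphism is known only at the prescribed generators, so it is not assumed
  to come from \<open>h\<close>. The Hecke relations involve just these generators and constants,
  and the images \<open>E\<close> of both sides follow from the homomorphism property.\<close>

lemma Phi_factors:
  assumes \<Phi>: "\<Phi> \<in> alg_hom (G_alg k) EE" and iP: "is_Phi r B B' n k M N c\<^sub>x c\<^sub>y c\<^sub>z d \<Phi>"
  shows "\<exists>\<Psi>\<in>alg_hom (HH) EE.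
    (\<forall>g\<in>carrier (G_alg k). \<Psi> (Hp g) = \<Phi> g) \<and>
    (\<forall>h\<in>carrier (HH). \<forall>u\<in>lie_alg ty n. \<forall>v\<in>carrier_vec (fst UU).
       \<Psi> h *\<^sub>v (snd UU u *\<^sub>v v) = snd UU u *\<^sub>v (\<Psi> h *\<^sub>v v))"
proof -
  interpret I: ideal "G_ideal k" FF by (rule ideal_G)
  have hom: "\<Phi> \<in> Ring.ring_hom (G_alg k) EE"
    and smult: "\<And>c X. X \<in> carrier (G_alg k) \<Longrightarrow> \<Phi> (c \<odot>\<^bsub>G_alg k\<^esub> X) = c \<odot>\<^bsub>EE\<^esub> \<Phi> X"
    using \<Phi> by (auto simp: alg_hom_def)
  define E where "E f = emb D (\<Phi> (G_cls k f))" for f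
  have car: "\<Phi> (G_cls k f) \<in> carrier EE" if "f \<in> carrier FF" for f
    using ring_hom_closed[OF hom G_cls_carrier[OF that]] .
  have E_mult: "E (f * g) = E f * E g" and E_add: "E (f + g) = E f + E g"
    if fg: "f \<in> carrier FF" "g \<in> carrier FF" for f g
  proof -
    have "G_cls k (f * g) = G_cls k f \<otimes>\<^bsub>G_alg k\<^esub> G_cls k g"
      using I.rcoset_mult_add[OF fg] by (simp add: G_alg_def quot_alg_simps FactRing_def G_cls_def free_alg_simps(2))
    then show "E (f * g) = E f * E g"
      unfolding E_def using ring_hom_mult[OF hom G_cls_carrier[OF fg(1)] G_cls_carrier[OF fg(2)]]
      by (simp add: End_lie_simps emb_mult[OF D EE_carrier[OF car[OF fg(1)]] EE_carrier[OF car[OF fg(2)]]])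
    have "G_cls k (f + g) = G_cls k f \<oplus>\<^bsub>G_alg k\<^esub> G_cls k g"
      using I.a_rcos_sum[OF fg] by (simp add: G_alg_def quot_alg_simps FactRing_def G_cls_def free_alg_simps(5))
    then show "E (f + g) = E f + E g"
      unfolding E_def using ring_hom_add[OF hom G_cls_carrier[OF fg(1)] G_cls_carrier[OF fg(2)]]
      by (simp add: End_lie_simps emb_add[OF D EE_carrier[OF car[OF fg(1)]] EE_carrier[OF car[OF fg(2)]]])
  qed
  have E_one: "E 1 = 1"
  proof -
    have "G_cls k 1 = \<one>\<^bsub>G_alg k\<^esub>" by (simp add: G_alg_def quot_alg_simps FactRing_def G_cls_def free_alg_simps(3))
    then show ?thesis unfolding E_def using ring_hom_one[OF hom] by (simp add: End_lie_simps fst_MNV emb_one[OF D])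
  qed
  have E_cst: "E (cst c) = sc c" for c
  proof -
    have "\<Phi> (G_cls k (cst c)) = c \<cdot>\<^sub>m \<Phi> (G_cls k 1)"
      using smult[OF G_cls_carrier[OF free_alg_carrier(2)], of c] smult_cls[OF free_alg_carrier(2), where c = c and k = k]
      by (simp add: End_lie_simps)
    then show ?thesis using E_one emb_smult[OF D EE_carrier[OF car[OF free_alg_carrier(2)]]] by (simp add: E_def)
  qed
  have E_diff: "E (f - g) = E f - E g" if "f \<in> carrier FF" "g \<in> carrier FF" for f g
    using E_add[OF free_alg_carrier(5)[OF that] that(2)] by (simp add: algebra_simps)
  have E_x: "E (xx i) = W {0} i" and E_y: "E (yy i) = W {1} i" if "i \<in> {1..k}" for i
    using iP that gm_x(2)[OF that] gm_y(2)[OF that] unfolding is_Phi_iff E_def by auto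
  have E_t: "E (tt (ss j)) = T (ss j)" if "j \<in> {1..<k}" for j
    using iP that gm_t(2)[of "ss j"] unfolding is_Phi_iff E_def by auto
  have E_zero: "E 0 = 0" using E_diff[OF free_alg_carrier(1) free_alg_carrier(1)] by simp
  have X: "{0} \<subseteq> {0, 1 :: nat}" "{1} \<subseteq> {0, 1 :: nat}" by auto
  have t_rel: "tt (ss i) * g i \<in> carrier FF \<and> g (i + 1) * tt (ss i) - 1 \<in> carrier FF \<and>
      E (tt (ss i) * g i) = E (g (i + 1) * tt (ss i) - 1)"
    if g: "\<And>i. i \<in> {1..k} \<Longrightarrow> g i \<in> carrier FF" "\<And>i. i \<in> {1..k} \<Longrightarrow> E (g i) = W A i"
      and A: "A \<subseteq> {0, 1}" and i: "i \<in> {1..<k}" for g A i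
  proof -
    have i': "i \<in> {1..k}" "i + 1 \<in> {1..k}" using i by auto
    note c = g(1)[OF i'(1)] g(1)[OF i'(2)] gens_FF(4)[OF i]
    show ?thesis
      unfolding E_mult[OF c(3,1)] E_diff[OF free_alg_carrier(6)[OF c(2,3)] free_alg_carrier(2)] E_mult[OF c(2,3)]
        E_one E_t[OF i] g(2)[OF i'(1)] g(2)[OF i'(2)]
      by (intro conjI T_W[OF A i] free_alg_carrier(2,5,6) c)
  qed
  have quad_rel: "(g - cst x) * (g + cst y) \<in> carrier FF \<and> 0 \<in> carrier FF \<and> E ((g - cst x) * (g + cst y)) = E 0"
    if g: "g \<in> carrier FF" and q: "(E g - sc x) * (E g + sc y) = 0" for g x y
    unfolding E_mult[OF free_alg_carrier(5)[OF g free_alg_carrier(7)] free_alg_carrier(3)[OF g free_alg_carrier(7)]]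
      E_diff[OF g free_alg_carrier(7)] E_add[OF g free_alg_carrier(7)] E_cst E_zero q
    by (simp add: free_alg_carrier g)
  have H_rel: "u \<in> carrier FF" "v \<in> carrier FF" "E u = E v"
    if H: "HR u v" for u v
  proof -
    have k1: "1 \<in> {1..k}" using k by simp
    have "u \<in> carrier FF \<and> v \<in> carrier FF \<and> E u = E v"
      using H
    proof cases
      case (1 i)
      then show ?thesis using t_rel[of xx "{0}" i] gens_FF(1) E_x X(1) by blast
    next
      case (2 i)
      then show ?thesis using t_rel[of yy "{1}" i] gens_FF(2) E_y X(2) by blast
    next
      case 3
      show ?thesis unfolding 3 using quadratic_x E_x[OF k1] by (intro quad_rel gens_FF(1)[OF k1]) simp
    next
      case 4
      show ?thesis unfolding 4 using quadratic_y E_y[OF k1] by (intro quad_rel gens_FF(2)[OF k1]) simp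
    qed
    then show "u \<in> carrier FF" "v \<in> carrier FF" "E u = E v" by auto
  qed
  have zero: "\<Phi> x = \<zero>\<^bsub>EE\<^esub>" if "x \<in> HI" for x
  proof (rule hom_zero_on_genideal[OF ring_G_alg ring_EE hom _ _ that[unfolded H_ideal_def]])
    show "{G_cls k (u - v) |u v. HR u v} \<subseteq> carrier (G_alg k)"
      using H_rel by (auto intro!: G_cls_carrier free_alg_carrier(5))
    fix x assume "x \<in> {G_cls k (u - v) |u v. HR u v}"
    then obtain u v where x: "x = G_cls k (u - v)" "HR u v" by blast
    note uv = H_rel[OF x(2)]
    have "E (u - v) = 0" using E_diff[OF uv(1,2)] uv(3) by simp
    then have "emb D (\<Phi> x) = emb D (0\<^sub>m D D)" by (simp add: E_def x(1) emb_zero[OF D])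
    then show "\<Phi> x = \<zero>\<^bsub>EE\<^esub>"
      unfolding End_lie_simps fst_MNV x(1) by (intro EE_eqI car free_alg_carrier(5) uv EE_closed)
  qed
  have sm: "c \<odot>\<^bsub>G_alg k\<^esub> X \<in> carrier (G_alg k)" if X: "X \<in> carrier (G_alg k)" for c X
  proof -
    obtain u where "u \<in> carrier FF" "X = G_cls k u"
      using X by (auto simp: G_alg_def quot_alg_simps FactRing_def A_RCOSETS_def' G_cls_def)
    then show ?thesis using smult_cls[where c = c and k = k and u = u] G_cls_carrier[OF free_alg_carrier(6)[OF free_alg_carrier(7)], where k = k] by simp
  qed
  have comm: "\<Psi> h *\<^sub>v (snd UU u *\<^sub>v v) = snd UU u *\<^sub>v (\<Psi> h *\<^sub>v v)"
    if \<Psi>: "\<Psi> \<in> alg_hom (HH) EE"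
      and h: "h \<in> carrier (HH)"
      and u: "u \<in> lie_alg ty n" and v: "v \<in> carrier_vec (fst UU)" for \<Psi> h u v
  proof -
    have A: "\<Psi> h \<in> carrier EE" using \<Psi> h by (auto simp: alg_hom_def intro: ring_hom_closed)
    note c = EE_carrier[OF A] bspec[OF UU_carrier u] v[unfolded fst_MNV]
    have "\<Psi> h *\<^sub>v (snd UU u *\<^sub>v v) = (\<Psi> h * snd UU u) *\<^sub>v v"
      by (rule assoc_mult_mat_vec[symmetric, OF c])
    also have "\<Psi> h * snd UU u = snd UU u * \<Psi> h" using A u by (simp add: End_lie_simps)
    also have "\<dots> *\<^sub>v v = snd UU u *\<^sub>v (\<Psi> h *\<^sub>v v)" by (rule assoc_mult_mat_vec[OF c(2,1,3)])
    finally show ?thesis .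
  qed
  show ?thesis
    using comm quot_alg_factor[OF ring_G_alg ideal_H[OF k] ring_EE \<Phi> zero sm]
    unfolding H_alg_def[symmetric] H_proj_def[symmetric] by blast
qed

end

theorem theorem4p9:
  fixes ty :: lie_type and k n a b p q r :: nat
    and M N :: lie_module
    and B B' :: "nat \<Rightarrow> complex mat"
    and c\<^sub>x c\<^sub>y c\<^sub>z d :: complex
  assumes "1 \<le> k" and "0 < a" and "0 < b" and "0 < p" and "0 < q" and "q \<le> p"
    and "(ty = GL \<and> p + q \<le> n \<and>
            c\<^sub>x = - (1/2) * of_nat n \<and> c\<^sub>y = - (1/2) * of_nat n \<and> d = 0) \<or>
         (ty = SL \<and> p + q \<le> n - 1 \<and>
            c\<^sub>x = of_nat (a * p) / of_nat n - (1/2) * (of_nat n - 1 / of_nat n) \<and>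
            c\<^sub>y = of_nat (b * q) / of_nat n - (1/2) * (of_nat n - 1 / of_nat n) \<and>
            d = 1 / of_nat n)"
    and "is_L ty n (rect a p) M" and "is_L ty n (rect b q) N"
    and "dual_bases ty n r B B'"
  shows "(\<exists>\<Phi> \<in> alg_hom (G_alg k) (End_lie (lie_alg ty n) (MNV n k M N)).
            is_Phi r B B' n k M N c\<^sub>x c\<^sub>y c\<^sub>z d \<Phi>) \<and>
         (\<forall>\<Phi> \<in> alg_hom (G_alg k) (End_lie (lie_alg ty n) (MNV n k M N)).
            is_Phi r B B' n k M N c\<^sub>x c\<^sub>y c\<^sub>z d \<Phi> \<longrightarrow>
            (\<exists>\<Psi> \<in> alg_hom (H_alg k (of_nat a) (of_nat b) (of_nat p) (of_nat q))
                      (End_lie (lie_alg ty n) (MNV n k M N)).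
               (\<forall>g\<in>carrier (G_alg k).
                  \<Psi> (H_proj k (of_nat a) (of_nat b) (of_nat p) (of_nat q) g) = \<Phi> g) \<and>
               (\<forall>h\<in>carrier (H_alg k (of_nat a) (of_nat b) (of_nat p) (of_nat q)).
                  \<forall>u\<in>lie_alg ty n. \<forall>v\<in>carrier_vec (fst (MNV n k M N)).
                    \<Psi> h *\<^sub>v (snd (MNV n k M N) u *\<^sub>v v) = snd (MNV n k M N) u *\<^sub>v (\<Psi> h *\<^sub>v v))))"
proof -
  interpret hecke_data ty k n a b p q r M N B B' c\<^sub>x c\<^sub>y c\<^sub>z d
    by unfold_locales (use assms in auto)
  show ?thesis using Phi_exists Phi_factors by blast
qed

end
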